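(* For every $\Delta$-institution $\mathcal{I}$ in the class $\mathbf{DINS}_b$, the syntactic sequent $\vdash^{\omega\,\mathcal{I}}$ of $\mathsf{FOL}_\omega(\mathcal I)$ is compact: for every directed diagram $(\langle\Gamma_i,\Sigma_i,\Delta_i\rangle)_{i\in(J,\le)}$ in $\mathsf{Modify}(\mathsf{FOL}_\omega(\mathcal I))$ with colimit $\langle\Gamma,\Sigma,\Delta\rangle$, if $\Gamma_i\not\vdash^{\omega\,\mathcal I}_{\Sigma_i}\Delta_i$ for every $i\in J$, then $\Gamma\not\vdash^{\omega\,\mathcal I}_\Sigma\Delta$.
   Context: A $\Delta$-institution $\mathcal{I}$ consists of a locally small category $\mathsf{Sig}$, a functor $\mathsf{Mod}:\mathsf{Sig}^{op}\to\mathbf{CAT}$ (morphisms of $\mathsf{Mod}(\Sigma)$ are homomorphisms), a functor $\mathsf{Sen}:\mathsf{Sig}\to\mathbf{Set}$, satisfaction relations $\models_\Sigma$ with $\mathsf{Mod}(\chi)(\mathfrak{A}')\models\gamma$ iff $\mathfrak{A}'\models\mathsf{Sen}(\chi)(\gamma)$, and a variable structure: (i) a functor $(\cdot)_\Delta:\mathsf{Sig}\to\mathbf{Cat}$ (objects of $\Sigma_\Delta$ are blocks); (ii) morphisms $\Sigma(X):\Sigma\to\Sigma[X]$ for $X\in|\Sigma_\Delta|$, and $\Sigma[\iota]:\Sigma[X]\to\Sigma[Y]$ for $\iota:X\to Y$, with $\Sigma[\iota]\circ\Sigma(X)=\Sigma(Y)$, functorial in $\iota$; (iii) morphisms $\chi[X]:\Sigma[X]\to\Sigma'[\chi_\Delta(X)]$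 for $\chi:\Sigma\to\Sigma'$, with $\chi[X]\circ\Sigma(X)=\Sigma'(\chi_\Delta(X))\circ\chi$, $\chi[Y]\circ\Sigma[\iota]=\Sigma'[\chi_\Delta(\iota)]\circ\chi[X]$, $\mathrm{id}_\Sigma[X]=\mathrm{id}$, $(\chi'\circ\chi)[X]=\chi'[\chi_\Delta(X)]\circ\chi[X]$; (iv) each square $\chi[X]\circ\Sigma(X)=\Sigma'(\chi_\Delta(X))\circ\chi$ is a pushout; (v) for $\chi:\Sigma\to\Sigma'$, $\mathfrak{A}'\in|\mathsf{Mod}(\Sigma')|$, every $\Sigma(X)$-expansion $\hat{\mathfrak A}$ of $\mathsf{Mod}(\chi)(\mathfrak A')$ (model of $\Sigma[X]$ with $\mathsf{Mod}(\Sigma(X))$-reduct $\mathsf{Mod}(\chi)(\mathfrak A')$) has a unique $\Sigma'(\chi_\Delta(X))$-expansion $\hat{\mathfrak A}'$ of $\mathfrak A'$ with $\mathsf{Mod}(\chi[X])(\hat{\mathfrak A}')=\hat{\mathfrak A}$. A $\rho$-substitution ($\rho:\Sigma\to\Sigma_1$) is $\theta:\Sigma_1\to\Sigma$ with $\theta\circ\rho=\mathrm{id}_\Sigma$. $\mathsf{FOL}_\alpha(\mathcal I)$ ($\alpha$ an infinite cardinal) has the same signatures, models and variable structure as $\mathcal I$; its sentences $\mathsf{Sen}^\alpha(\Sigma)$ are generated recursively: atomic $\phi\in\mathsf{Sen}(\Sigma)$ (tagged), $\neg\phi$, $\vee\phi$ for $\phi:N\to\mathsf{Sen}^\alpha(\Sigma)$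 with $N\in\alpha$, and $\exists X\cdot\phi$ for $X\in|\Sigma_\Delta|$, $\phi\in\mathsf{Sen}^\alpha(\Sigma[X])$; translation along $\chi$ is $\mathsf{Sen}(\chi)$ on atoms, componentwise on $\neg,\vee$, and $\exists X\cdot\phi\mapsto\exists\chi_\Delta(X)\cdot\mathsf{Sen}^\alpha(\chi[X])(\phi)$; satisfaction is as in $\mathcal I$ on atoms, classical for $\neg,\vee$, and $\mathfrak A\models\exists X\cdot\phi$ iff some $\Sigma(X)$-expansion of $\mathfrak A$ satisfies $\phi$. For a structure $\mathcal J$ of this kind (here $\mathcal I$ or $\mathsf{FOL}_\omega(\mathcal I)$), $\Gamma\models^{\mathcal J}_\Sigma\Delta$ means no $\Sigma$-model satisfies all of $\Gamma$ and none of $\Delta$. $\mathsf{Modify}(\mathcal J)$ is the category of triples $\langle\Gamma,\Sigma,\Delta\rangle$ ($\Gamma,\Delta$ sets of $\Sigma$-sentences of $\mathcal J$) with morphisms $\chi:\Sigma\to\Sigma'$ such that $\mathsf{Sen}^{\mathcal J}(\chi)(\Gamma)\subseteq\Gamma'$, $\mathsf{Sen}^{\mathcal J}(\chi)(\Delta)\subseteq\Delta'$. A family $\vdash=\{\vdash_\Sigma\}$ of relations is compact if for every directed diagram in $\mathsf{Modify}(\mathcal J)$ with colimit $\langle\Gamma,\Sigma,\Delta\rangle$, $\Gamma_i\not\vdash_{\Sigma_i}\Delta_i$ for all $i$ implies $\Gamma\not\vdash_\Sigma\Delta$. The syntactic sequent $\vdash^{\alpha\,\mathcal I}$ is the smallest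 family of relations $\vdash_\Sigma$ between sets of $\mathsf{FOL}_\alpha(\mathcal I)$-sentences closed under: (Modify) from $\Gamma\vdash_\Sigma\Delta$ infer $\Gamma'\vdash_{\Sigma'}\Delta'$ for $\chi:\Sigma\to\Sigma'$, $\Gamma'\supseteq\mathsf{Sen}^\alpha(\chi)(\Gamma)$, $\Delta'\supseteq\mathsf{Sen}^\alpha(\chi)(\Delta)$; (Init) $\{\psi\}\cup\Gamma\vdash_\Sigma\Delta\cup\{\psi\}$; (Cut) from $\Gamma\vdash\Delta\cup\{\psi\}$ and $\{\psi\}\cup\Gamma'\vdash\Delta'$ infer $\Gamma\cup\Gamma'\vdash\Delta\cup\Delta'$; (Atom) $\Gamma_b\cup\Gamma\vdash_\Sigma\Delta\cup\Delta_b$ for sets of atomic sentences with $\Gamma_b\models^{\mathcal I}_\Sigma\Delta_b$; ($\neg_L$) from $\Gamma\vdash\Delta\cup\{\phi\}$ infer $\{\neg\phi\}\cup\Gamma\vdash\Delta$; ($\neg_R$) from $\{\phi\}\cup\Gamma\vdash\Delta$ infer $\Gamma\vdash\Delta\cup\{\neg\phi\}$; ($\vee_L$) from $\{\phi_n\}\cup\Gamma_n\vdash\Delta_n$ for all $n\in N$ infer $\{\vee\phi\}\cup\bigcup\Gamma_n\vdash\bigcup\Delta_n$; ($\vee_R$) from $\Gamma\vdash\Delta\cup\{\phi_n\}$ infer $\Gamma\vdash\Delta\cup\{\vee\phi\}$; ($\exists_L$) from $\{\phi\}\cup\mathsf{Sen}^\alpha(\Sigma(X))(\Gamma)\vdash_{\Sigma[X]}\mathsf{Sen}^\alpha(\Sigma(X))(\Delta)$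 infer $\{\exists X\cdot\phi\}\cup\Gamma\vdash_\Sigma\Delta$; ($\exists_R$) from $\Gamma\vdash_\Sigma\Delta\cup\{\mathsf{Sen}^\alpha(\theta)(\phi)\}$, $\theta$ a $\Sigma(X)$-substitution, infer $\Gamma\vdash_\Sigma\Delta\cup\{\exists X\cdot\phi\}$. Epi-basic model of $\Gamma\subseteq\mathsf{Sen}(\Sigma)$: a model $T_{\Sigma,\Gamma}$ such that $\mathfrak A\models\Gamma$ iff there is a homomorphism $T_{\Sigma,\Gamma}\to\mathfrak A$, such homomorphism being unique. Reachable model $\mathfrak A$: every $\Sigma(X)$-expansion of $\mathfrak A$ equals $\mathsf{Mod}(\theta)(\mathfrak A)$ for some $\Sigma(X)$-substitution $\theta$. $\mathcal I\in\mathbf{DINS}_b$ means: $\mathsf{Sig}$ has directed colimits; $\mathsf{Sen}$, $(\cdot)_\Delta$ and $\mathsf{Sub}$ preserve directed colimits, where $\mathsf{Sub}(\Sigma)$ is the set of pairs $(X,\theta)$, $\theta$ a $\Sigma(X)$-substitution, and $\mathsf{Sub}(\chi)(X,\theta)=(\chi_\Delta(X),\theta')$ with $\theta'$ the unique $\Sigma'(\chi_\Delta(X))$-substitution with $\theta'\circ\chi[X]=\chi\circ\theta$; every $\Gamma\subseteq\mathsf{Sen}(\Sigma)$ has a reachable epi-basic model; and $\models^{\mathcal I}$ is compact. *)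

theory Defs
  imports Main "HOL-Library.FuncSet"
begin

section \<open>Categories, functors and colimits\<close>

record ('o, 'a) cat =
  Obj :: "'o set"
  Arr :: "'a set"
  Dom :: "'a \<Rightarrow> 'o"
  Cod :: "'a \<Rightarrow> 'o"
  Id :: "'o \<Rightarrow> 'a"
  Comp :: "'a \<Rightarrow> 'a \<Rightarrow> 'a"  (infixl "\<cdot>\<index>" 70)

definition hom :: "('o, 'a) cat \<Rightarrow> 'o \<Rightarrow> 'o \<Rightarrow> 'a set" where
  "hom C a b = {f \<in> Arr C. Dom C f = a \<and> Cod C f = b}"

text \<open>\<open>g \<cdot>\<^bsub>C\<^esub> f\<close> is "first f, then g"; it is only meaningful when \<open>Dom C g = Cod C f\<close>.\<close>

locale category =
  fixes C :: "('o, 'a) cat"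
  assumes dom_obj: "f \<in> Arr C \<Longrightarrow> Dom C f \<in> Obj C"
    and cod_obj: "f \<in> Arr C \<Longrightarrow> Cod C f \<in> Obj C"
    and id_hom: "a \<in> Obj C \<Longrightarrow> Id C a \<in> hom C a a"
    and comp_hom: "f \<in> hom C a b \<Longrightarrow> g \<in> hom C b c \<Longrightarrow> g \<cdot>\<^bsub>C\<^esub> f \<in> hom C a c"
    and id_left: "f \<in> hom C a b \<Longrightarrow> Id C b \<cdot>\<^bsub>C\<^esub> f = f"
    and id_right: "f \<in> hom C a b \<Longrightarrow> f \<cdot>\<^bsub>C\<^esub> Id C a = f"
    and comp_assoc: "f \<in> hom C a b \<Longrightarrow> g \<in> hom C b c \<Longrightarrow> h \<in> hom C c d \<Longrightarrow>
      h \<cdot>\<^bsub>C\<^esub> (g \<cdot>\<^bsub>C\<^esub> f) = (h \<cdot>\<^bsub>C\<^esub> g) \<cdot>\<^bsub>C\<^esub> f"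

definition op_cat :: "('o, 'a) cat \<Rightarrow> ('o, 'a) cat" where
  "op_cat C = \<lparr>Obj = Obj C, Arr = Arr C, Dom = Cod C, Cod = Dom C, Id = Id C,
    Comp = (\<lambda>g f. f \<cdot>\<^bsub>C\<^esub> g)\<rparr>"

record ('o1, 'a1, 'o2, 'a2) fctr =
  fobj :: "'o1 \<Rightarrow> 'o2"
  farr :: "'a1 \<Rightarrow> 'a2"

definition is_functor :: "('o1, 'a1) cat \<Rightarrow> ('o2, 'a2) cat \<Rightarrow> ('o1, 'a1, 'o2, 'a2) fctr \<Rightarrow> bool" where
  "is_functor C D F \<longleftrightarrow> category C \<and> category D \<and>
     (\<forall>a\<in>Obj C. fobj F a \<in> Obj D) \<and>
     (\<forall>f\<in>Arr C. farr F f \<in> hom D (fobj F (Dom C f)) (fobj F (Cod C f))) \<and>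
     (\<forall>a\<in>Obj C. farr F (Id C a) = Id D (fobj F a)) \<and>
     (\<forall>f\<in>Arr C. \<forall>g\<in>Arr C. Cod C f = Dom C g \<longrightarrow>
        farr F (g \<cdot>\<^bsub>C\<^esub> f) = farr F g \<cdot>\<^bsub>D\<^esub> farr F f)"

definition comp_fctr :: "('o2, 'a2, 'o3, 'a3) fctr \<Rightarrow> ('o1, 'a1, 'o2, 'a2) fctr \<Rightarrow> ('o1, 'a1, 'o3, 'a3) fctr" where
  "comp_fctr G F = \<lparr>fobj = fobj G \<circ> fobj F, farr = farr G \<circ> farr F\<rparr>"

definition is_cocone ::
  "('k, 'u) cat \<Rightarrow> ('o, 'a) cat \<Rightarrow> ('k, 'u, 'o, 'a) fctr \<Rightarrow> 'o \<Rightarrow> ('k \<Rightarrow> 'a) \<Rightarrow> bool" where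
  "is_cocone K C D a l \<longleftrightarrow> a \<in> Obj C \<and>
     (\<forall>k\<in>Obj K. l k \<in> hom C (fobj D k) a) \<and>
     (\<forall>u\<in>Arr K. l (Cod K u) \<cdot>\<^bsub>C\<^esub> farr D u = l (Dom K u))"

definition is_colimit ::
  "('k, 'u) cat \<Rightarrow> ('o, 'a) cat \<Rightarrow> ('k, 'u, 'o, 'a) fctr \<Rightarrow> 'o \<Rightarrow> ('k \<Rightarrow> 'a) \<Rightarrow> bool" where
  "is_colimit K C D a l \<longleftrightarrow> is_functor K C D \<and> is_cocone K C D a l \<and>
     (\<forall>b m. is_cocone K C D b m \<longrightarrow>
        (\<exists>!h. h \<in> hom C a b \<and> (\<forall>k\<in>Obj K. h \<cdot>\<^bsub>C\<^esub> l k = m k)))"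

definition is_pushout :: "('o, 'a) cat \<Rightarrow> 'a \<Rightarrow> 'a \<Rightarrow> 'a \<Rightarrow> 'a \<Rightarrow> bool" where
  "is_pushout C f g p q \<longleftrightarrow>
     f \<in> Arr C \<and> g \<in> Arr C \<and> p \<in> Arr C \<and> q \<in> Arr C \<and>
     Dom C f = Dom C g \<and> Dom C p = Cod C f \<and> Dom C q = Cod C g \<and> Cod C p = Cod C q \<and>
     p \<cdot>\<^bsub>C\<^esub> f = q \<cdot>\<^bsub>C\<^esub> g \<and>
     (\<forall>b. \<forall>p'\<in>hom C (Cod C f) b. \<forall>q'\<in>hom C (Cod C g) b. p' \<cdot>\<^bsub>C\<^esub> f = q' \<cdot>\<^bsub>C\<^esub> g \<longrightarrow>
        (\<exists>!h. h \<in> hom C (Cod C p) b \<and> h \<cdot>\<^bsub>C\<^esub> p = p' \<and> h \<cdot>\<^bsub>C\<^esub> q = q'))"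

subsection \<open>Directed colimits\<close>

definition directed_poset :: "'j set \<Rightarrow> 'j rel \<Rightarrow> bool" where
  "directed_poset J r \<longleftrightarrow> partial_order_on J r \<and> J \<noteq> {} \<and>
     (\<forall>i\<in>J. \<forall>j\<in>J. \<exists>k\<in>J. (i, k) \<in> r \<and> (j, k) \<in> r)"

definition poset_cat :: "'j set \<Rightarrow> 'j rel \<Rightarrow> ('j, 'j \<times> 'j) cat" where
  "poset_cat J r = \<lparr>Obj = J, Arr = r, Dom = fst, Cod = snd, Id = (\<lambda>i. (i, i)),
     Comp = (\<lambda>v u. (fst u, snd v))\<rparr>"

text \<open>
  Directed diagrams are indexed by directed posets carried by subsets of a type \<open>'j\<close>, which is an
  explicit parameter below because HOL cannot quantify over all index types inside a formula.
\<close>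

definition has_directed_colimits :: "'j itself \<Rightarrow> ('o, 'a) cat \<Rightarrow> bool" where
  "has_directed_colimits _ C \<longleftrightarrow>
     (\<forall>(J :: 'j set) r D. directed_poset J r \<and> is_functor (poset_cat J r) C D \<longrightarrow>
        (\<exists>a l. is_colimit (poset_cat J r) C D a l))"

definition preserves_directed_colimits ::
  "'j itself \<Rightarrow> ('o1, 'a1) cat \<Rightarrow> ('o2, 'a2) cat \<Rightarrow> ('o1, 'a1, 'o2, 'a2) fctr \<Rightarrow> bool" where
  "preserves_directed_colimits _ C E F \<longleftrightarrow>
     (\<forall>(J :: 'j set) r D a l. directed_poset J r \<and> is_colimit (poset_cat J r) C D a l \<longrightarrow>
        is_colimit (poset_cat J r) E (comp_fctr F D) (fobj F a) (\<lambda>j. farr F (l j)))"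

subsection \<open>The categories of sets and of categories\<close>

text \<open>
  Arrows carry their domain and codomain, and the underlying maps are \<open>undefined\<close> outside the domain,
  so that equality of arrows is equality of maps on the domain. The types \<open>'s\<close>, \<open>'o\<close>, \<open>'a\<close> act as
  universes.
\<close>

definition set_cat :: "('s set, 's set \<times> ('s \<Rightarrow> 's) \<times> 's set) cat" where
  "set_cat = \<lparr>Obj = UNIV,
     Arr = {(A, f, B). f \<in> A \<rightarrow>\<^sub>E B},
     Dom = (\<lambda>(A, f, B). A),
     Cod = (\<lambda>(A, f, B). B),
     Id = (\<lambda>A. (A, restrict (\<lambda>x. x) A, A)),
     Comp = (\<lambda>(B', g, D) (A, f, B). (A, compose A g f, D))\<rparr>"

definition restr_fctr :: "('o1, 'a1) cat \<Rightarrow> ('o1, 'a1, 'o2, 'a2) fctr \<Rightarrow> ('o1, 'a1, 'o2, 'a2) fctr" where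
  "restr_fctr C F = \<lparr>fobj = restrict (fobj F) (Obj C), farr = restrict (farr F) (Arr C)\<rparr>"

definition cat_cat ::
  "(('o, 'a) cat, ('o, 'a) cat \<times> ('o, 'a, 'o, 'a) fctr \<times> ('o, 'a) cat) cat" where
  "cat_cat = \<lparr>Obj = {C. category C},
     Arr = {(C, F, D). is_functor C D F \<and> fobj F \<in> extensional (Obj C) \<and> farr F \<in> extensional (Arr C)},
     Dom = (\<lambda>(C, F, D). C),
     Cod = (\<lambda>(C, F, D). D),
     Id = (\<lambda>C. (C, restr_fctr C \<lparr>fobj = (\<lambda>x. x), farr = (\<lambda>f. f)\<rparr>, C)),
     Comp = (\<lambda>(D', G, E) (C, F, D). (C, restr_fctr C (comp_fctr G F), E))\<rparr>"

lemma category_poset_cat: "partial_order_on J r \<Longrightarrow> category (poset_cat J r)"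
  by unfold_locales
    (auto simp: poset_cat_def hom_def partial_order_on_def preorder_on_def dest: refl_onD transD)

lemma hom_set_cat: "f \<in> hom set_cat A B \<longleftrightarrow> (\<exists>f'. f = (A, f', B) \<and> f' \<in> A \<rightarrow>\<^sub>E B)"
  by (cases f) (auto simp only: hom_def set_cat_def cat.simps mem_Collect_eq case_prod_conv prod.inject)

lemma category_set_cat: "category set_cat"
proof
  fix f :: "'a set \<times> ('a \<Rightarrow> 'a) \<times> 'a set"
  show "Dom set_cat f \<in> Obj set_cat" "Cod set_cat f \<in> Obj set_cat" by (simp_all add: set_cat_def)
next
  fix A :: "'a set"
  have "restrict (\<lambda>x. x) A \<in> A \<rightarrow>\<^sub>E A" by simp
  then show "Id set_cat A \<in> hom set_cat A A" unfolding hom_set_cat by (simp add: set_cat_def)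
next
  fix f g :: "'a set \<times> ('a \<Rightarrow> 'a) \<times> 'a set" and A B C
  assume "f \<in> hom set_cat A B" "g \<in> hom set_cat B C"
  then obtain f' g' where *: "f = (A, f', B)" "g = (B, g', C)" "f' \<in> A \<rightarrow>\<^sub>E B" "g' \<in> B \<rightarrow>\<^sub>E C"
    unfolding hom_set_cat by blast
  have "compose A g' f' \<in> A \<rightarrow>\<^sub>E C"
    using *(3,4) by (intro PiE_I) (auto simp: compose_def dest: PiE_mem)
  then show "g \<cdot>\<^bsub>set_cat\<^esub> f \<in> hom set_cat A C" unfolding hom_set_cat by (simp add: *(1,2) set_cat_def)
next
  fix f :: "'a set \<times> ('a \<Rightarrow> 'a) \<times> 'a set" and A B
  assume "f \<in> hom set_cat A B"
  then obtain f' where f: "f = (A, f', B)" "f' \<in> A \<rightarrow>\<^sub>E B" unfolding hom_set_cat by blast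
  have "compose A (restrict (\<lambda>x. x) B) f' = f'" "compose A f' (restrict (\<lambda>x. x) A) = f'"
    using PiE_mem[OF f(2)] PiE_arb[OF f(2)] by (auto simp: compose_def fun_eq_iff)
  then show "Id set_cat B \<cdot>\<^bsub>set_cat\<^esub> f = f" "f \<cdot>\<^bsub>set_cat\<^esub> Id set_cat A = f"
    by (simp_all add: f(1) set_cat_def)
next
  fix f g h :: "'a set \<times> ('a \<Rightarrow> 'a) \<times> 'a set" and A B C D
  assume "f \<in> hom set_cat A B" "g \<in> hom set_cat B C" "h \<in> hom set_cat C D"
  then obtain f' g' h' where *: "f = (A, f', B)" "g = (B, g', C)" "h = (C, h', D)" "f' \<in> A \<rightarrow>\<^sub>E B"
    unfolding hom_set_cat by blast
  have "compose A h' (compose A g' f') = compose A (compose B h' g') f'"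
    using PiE_mem[OF *(4)] by (simp add: compose_def fun_eq_iff)
  then show "h \<cdot>\<^bsub>set_cat\<^esub> (g \<cdot>\<^bsub>set_cat\<^esub> f) = (h \<cdot>\<^bsub>set_cat\<^esub> g) \<cdot>\<^bsub>set_cat\<^esub> f"
    by (simp add: *(1-3) set_cat_def)
qed

lemma is_functor_restr: 
  assumes "is_functor C D F" shows "is_functor C D (restr_fctr C F)"
proof -
  interpret C: category C using assms by (simp add: is_functor_def)
  have "Id C a \<in> Arr C" if "a \<in> Obj C" for a using C.id_hom[OF that] by (simp add: hom_def)
  moreover have "g \<cdot>\<^bsub>C\<^esub> f \<in> Arr C" if "f \<in> Arr C" "g \<in> Arr C" "Cod C f = Dom C g" for f g
    using C.comp_hom[of f "Dom C f" "Cod C f" g "Cod C g"] that by (simp add: hom_def)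
  ultimately show ?thesis using assms
    by (auto simp: is_functor_def restr_fctr_def C.dom_obj C.cod_obj)
qed

lemma is_functor_comp: "is_functor C D F \<Longrightarrow> is_functor D E G \<Longrightarrow> is_functor C E (comp_fctr G F)"
  by (auto simp: is_functor_def comp_fctr_def hom_def)

lemma is_functor_id: "category C \<Longrightarrow> is_functor C C \<lparr>fobj = (\<lambda>x. x), farr = (\<lambda>f. f)\<rparr>"
  by (auto simp: is_functor_def hom_def)

lemma is_functor_in_objD: "is_functor C D F \<Longrightarrow> a \<in> Obj C \<Longrightarrow> fobj F a \<in> Obj D"
  and is_functor_in_arrD: "is_functor C D F \<Longrightarrow> f \<in> Arr C \<Longrightarrow> farr F f \<in> Arr D"
  by (auto simp: is_functor_def hom_def)

lemma category_cat_cat: "category cat_cat"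
proof unfold_locales
  fix f :: "('a, 'b) cat \<times> ('a, 'b, 'a, 'b) fctr \<times> ('a, 'b) cat" assume "f \<in> Arr cat_cat"
  then show "Dom cat_cat f \<in> Obj cat_cat" "Cod cat_cat f \<in> Obj cat_cat"
    by (auto simp: cat_cat_def is_functor_def)
next
  fix a :: "('a, 'b) cat" assume "a \<in> Obj cat_cat"
  then show "Id cat_cat a \<in> hom cat_cat a a"
    by (auto simp: cat_cat_def hom_def intro!: is_functor_restr is_functor_id)
       (auto simp: restr_fctr_def)
next
  fix f g :: "('a, 'b) cat \<times> ('a, 'b, 'a, 'b) fctr \<times> ('a, 'b) cat" and a b c
  assume "f \<in> hom cat_cat a b" "g \<in> hom cat_cat b c"
  then show "g \<cdot>\<^bsub>cat_cat\<^esub> f \<in> hom cat_cat a c"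
    by (auto simp: cat_cat_def hom_def intro!: is_functor_restr is_functor_comp)
       (auto simp: restr_fctr_def)
next
  fix f :: "('a, 'b) cat \<times> ('a, 'b, 'a, 'b) fctr \<times> ('a, 'b) cat" and a b
  assume f: "f \<in> hom cat_cat a b"
  then show "Id cat_cat b \<cdot>\<^bsub>cat_cat\<^esub> f = f" "f \<cdot>\<^bsub>cat_cat\<^esub> Id cat_cat a = f"
    by (auto simp: cat_cat_def hom_def restr_fctr_def comp_fctr_def extensional_def fun_eq_iff
          is_functor_in_objD is_functor_in_arrD intro!: fctr.equality)
next
  fix f g h :: "('a, 'b) cat \<times> ('a, 'b, 'a, 'b) fctr \<times> ('a, 'b) cat" and a b c d
  assume "f \<in> hom cat_cat a b" "g \<in> hom cat_cat b c" "h \<in> hom cat_cat c d"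
  then show "h \<cdot>\<^bsub>cat_cat\<^esub> (g \<cdot>\<^bsub>cat_cat\<^esub> f) = (h \<cdot>\<^bsub>cat_cat\<^esub> g) \<cdot>\<^bsub>cat_cat\<^esub> f"
    by (auto simp: cat_cat_def hom_def restr_fctr_def comp_fctr_def fun_eq_iff
          is_functor_in_objD is_functor_in_arrD intro!: fctr.equality)
qed

section \<open>$\Delta$-institutions\<close>

text \<open>
  For a signature \<open>S\<close>, a block \<open>X\<close> of \<open>S\<close>, a block morphism \<open>u\<close> and a signature morphism \<open>h\<close>:
  \<open>Red_obj I h\<close>, \<open>Red_arr I h\<close> are the two parts of the reduct functor $\mathsf{Mod}(\chi)$,
  \<open>Blk I S\<close> is $\Sigma_\Delta$ with \<open>Blk_obj I h\<close>, \<open>Blk_arr I h\<close> the two parts of $\chi_\Delta$,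
  \<open>Ext I S X\<close> is $\Sigma[X]$, \<open>Incl I S X\<close> is $\Sigma(X)$, \<open>Ext_arr I S u\<close> is $\Sigma[\iota]$ and
  \<open>Ext_mor I h X\<close> is $\chi[X]$.
\<close>

record ('sig, 'mor, 'm, 'h, 's, 'x, 'y) inst =
  Sig :: "('sig, 'mor) cat"
  Mods :: "'sig \<Rightarrow> ('m, 'h) cat"
  Red_obj :: "'mor \<Rightarrow> 'm \<Rightarrow> 'm"
  Red_arr :: "'mor \<Rightarrow> 'h \<Rightarrow> 'h"
  Sen :: "'sig \<Rightarrow> 's set"
  Sen_map :: "'mor \<Rightarrow> 's \<Rightarrow> 's"
  Sat :: "'sig \<Rightarrow> 'm \<Rightarrow> 's \<Rightarrow> bool"
  Blk :: "'sig \<Rightarrow> ('x, 'y) cat"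
  Blk_obj :: "'mor \<Rightarrow> 'x \<Rightarrow> 'x"
  Blk_arr :: "'mor \<Rightarrow> 'y \<Rightarrow> 'y"
  Ext :: "'sig \<Rightarrow> 'x \<Rightarrow> 'sig"
  Incl :: "'sig \<Rightarrow> 'x \<Rightarrow> 'mor"
  Ext_arr :: "'sig \<Rightarrow> 'y \<Rightarrow> 'mor"
  Ext_mor :: "'mor \<Rightarrow> 'x \<Rightarrow> 'mor"

definition Mod_fctr ::
  "('sig, 'mor, 'm, 'h, 's, 'x, 'y) inst \<Rightarrow>
    ('sig, 'mor, ('m, 'h) cat, ('m, 'h) cat \<times> ('m, 'h, 'm, 'h) fctr \<times> ('m, 'h) cat) fctr" where
  "Mod_fctr I = \<lparr>fobj = Mods I,
     farr = (\<lambda>h. (Mods I (Cod (Sig I) h),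
       restr_fctr (Mods I (Cod (Sig I) h)) \<lparr>fobj = Red_obj I h, farr = Red_arr I h\<rparr>,
       Mods I (Dom (Sig I) h)))\<rparr>"

definition Sen_fctr ::
  "('sig, 'mor, 'm, 'h, 's, 'x, 'y) inst \<Rightarrow>
    ('sig, 'mor, 's set, 's set \<times> ('s \<Rightarrow> 's) \<times> 's set) fctr" where
  "Sen_fctr I = \<lparr>fobj = Sen I,
     farr = (\<lambda>h. (Sen I (Dom (Sig I) h), restrict (Sen_map I h) (Sen I (Dom (Sig I) h)),
       Sen I (Cod (Sig I) h)))\<rparr>"

definition Blk_fctr ::
  "('sig, 'mor, 'm, 'h, 's, 'x, 'y) inst \<Rightarrow>
    ('sig, 'mor, ('x, 'y) cat, ('x, 'y) cat \<times> ('x, 'y, 'x, 'y) fctr \<times> ('x, 'y) cat) fctr" where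
  "Blk_fctr I = \<lparr>fobj = Blk I,
     farr = (\<lambda>h. (Blk I (Dom (Sig I) h),
       restr_fctr (Blk I (Dom (Sig I) h)) \<lparr>fobj = Blk_obj I h, farr = Blk_arr I h\<rparr>,
       Blk I (Cod (Sig I) h)))\<rparr>"

text \<open>\<open>expansion I h A B\<close>: \<open>B\<close> is an \<open>h\<close>-expansion of \<open>A\<close>.\<close>

definition expansion :: "('sig, 'mor, 'm, 'h, 's, 'x, 'y) inst \<Rightarrow> 'mor \<Rightarrow> 'm \<Rightarrow> 'm \<Rightarrow> bool" where
  "expansion I h A B \<longleftrightarrow> B \<in> Obj (Mods I (Cod (Sig I) h)) \<and> Red_obj I h B = A"

locale delta_institution =
  fixes I :: "('sig, 'mor, 'm, 'h, 's, 'x, 'y) inst"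
  assumes sig_category: "category (Sig I)"
    and mod_functor: "is_functor (op_cat (Sig I)) cat_cat (Mod_fctr I)"
    and sen_functor: "is_functor (Sig I) set_cat (Sen_fctr I)"
    and satisfaction_condition:
      "h \<in> hom (Sig I) S S' \<Longrightarrow> A' \<in> Obj (Mods I S') \<Longrightarrow> \<gamma> \<in> Sen I S \<Longrightarrow>
        Sat I S (Red_obj I h A') \<gamma> \<longleftrightarrow> Sat I S' A' (Sen_map I h \<gamma>)"
    and blk_functor: "is_functor (Sig I) cat_cat (Blk_fctr I)"
    and incl_hom: "S \<in> Obj (Sig I) \<Longrightarrow> X \<in> Obj (Blk I S) \<Longrightarrow> Incl I S X \<in> hom (Sig I) S (Ext I S X)"
    and ext_arr_hom: "S \<in> Obj (Sig I) \<Longrightarrow> u \<in> hom (Blk I S) X Y \<Longrightarrow>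
      Ext_arr I S u \<in> hom (Sig I) (Ext I S X) (Ext I S Y)"
    and ext_arr_incl: "S \<in> Obj (Sig I) \<Longrightarrow> u \<in> hom (Blk I S) X Y \<Longrightarrow>
      Ext_arr I S u \<cdot>\<^bsub>Sig I\<^esub> Incl I S X = Incl I S Y"
    and ext_arr_id: "S \<in> Obj (Sig I) \<Longrightarrow> X \<in> Obj (Blk I S) \<Longrightarrow>
      Ext_arr I S (Id (Blk I S) X) = Id (Sig I) (Ext I S X)"
    and ext_arr_comp:
      "S \<in> Obj (Sig I) \<Longrightarrow> u \<in> hom (Blk I S) X Y \<Longrightarrow> v \<in> hom (Blk I S) Y Z \<Longrightarrow>
        Ext_arr I S (v \<cdot>\<^bsub>Blk I S\<^esub> u) = Ext_arr I S v \<cdot>\<^bsub>Sig I\<^esub> Ext_arr I S u"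
    and ext_mor_hom: "h \<in> hom (Sig I) S S' \<Longrightarrow> X \<in> Obj (Blk I S) \<Longrightarrow>
      Ext_mor I h X \<in> hom (Sig I) (Ext I S X) (Ext I S' (Blk_obj I h X))"
    and ext_mor_incl: "h \<in> hom (Sig I) S S' \<Longrightarrow> X \<in> Obj (Blk I S) \<Longrightarrow>
      Ext_mor I h X \<cdot>\<^bsub>Sig I\<^esub> Incl I S X = Incl I S' (Blk_obj I h X) \<cdot>\<^bsub>Sig I\<^esub> h"
    and ext_mor_ext_arr: "h \<in> hom (Sig I) S S' \<Longrightarrow> u \<in> hom (Blk I S) X Y \<Longrightarrow>
      Ext_mor I h Y \<cdot>\<^bsub>Sig I\<^esub> Ext_arr I S u = Ext_arr I S' (Blk_arr I h u) \<cdot>\<^bsub>Sig I\<^esub> Ext_mor I h X"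
    and ext_mor_id: "S \<in> Obj (Sig I) \<Longrightarrow> X \<in> Obj (Blk I S) \<Longrightarrow>
      Ext_mor I (Id (Sig I) S) X = Id (Sig I) (Ext I S X)"
    and ext_mor_comp:
      "h \<in> hom (Sig I) S S' \<Longrightarrow> h' \<in> hom (Sig I) S' S'' \<Longrightarrow> X \<in> Obj (Blk I S) \<Longrightarrow>
        Ext_mor I (h' \<cdot>\<^bsub>Sig I\<^esub> h) X = Ext_mor I h' (Blk_obj I h X) \<cdot>\<^bsub>Sig I\<^esub> Ext_mor I h X"
    and ext_pushout: "h \<in> hom (Sig I) S S' \<Longrightarrow> X \<in> Obj (Blk I S) \<Longrightarrow>
      is_pushout (Sig I) (Incl I S X) h (Ext_mor I h X) (Incl I S' (Blk_obj I h X))"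
    and ext_amalgamation:
      "h \<in> hom (Sig I) S S' \<Longrightarrow> X \<in> Obj (Blk I S) \<Longrightarrow> A' \<in> Obj (Mods I S') \<Longrightarrow>
        expansion I (Incl I S X) (Red_obj I h A') B \<Longrightarrow>
        \<exists>!B'. expansion I (Incl I S' (Blk_obj I h X)) A' B' \<and> Red_obj I (Ext_mor I h X) B' = B"

definition substitution ::
  "('sig, 'mor, 'm, 'h, 's, 'x, 'y) inst \<Rightarrow> 'mor \<Rightarrow> 'mor \<Rightarrow> bool" where
  "substitution I \<rho> \<theta> \<longleftrightarrow> \<theta> \<in> hom (Sig I) (Cod (Sig I) \<rho>) (Dom (Sig I) \<rho>) \<and>
     \<theta> \<cdot>\<^bsub>Sig I\<^esub> \<rho> = Id (Sig I) (Dom (Sig I) \<rho>)"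

definition Sub :: "('sig, 'mor, 'm, 'h, 's, 'x, 'y) inst \<Rightarrow> 'sig \<Rightarrow> ('x \<times> 'mor) set" where
  "Sub I S = {(X, \<theta>). X \<in> Obj (Blk I S) \<and> substitution I (Incl I S X) \<theta>}"

definition Sub_map :: "('sig, 'mor, 'm, 'h, 's, 'x, 'y) inst \<Rightarrow> 'mor \<Rightarrow> 'x \<times> 'mor \<Rightarrow> 'x \<times> 'mor" where
  "Sub_map I h = (\<lambda>(X, \<theta>). (Blk_obj I h X,
     THE \<theta>'. substitution I (Incl I (Cod (Sig I) h) (Blk_obj I h X)) \<theta>' \<and>
       \<theta>' \<cdot>\<^bsub>Sig I\<^esub> Ext_mor I h X = h \<cdot>\<^bsub>Sig I\<^esub> \<theta>))"

definition Sub_fctr ::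
  "('sig, 'mor, 'm, 'h, 's, 'x, 'y) inst \<Rightarrow>
    ('sig, 'mor, ('x \<times> 'mor) set,
      ('x \<times> 'mor) set \<times> ('x \<times> 'mor \<Rightarrow> 'x \<times> 'mor) \<times> ('x \<times> 'mor) set) fctr" where
  "Sub_fctr I = \<lparr>fobj = Sub I,
     farr = (\<lambda>h. (Sub I (Dom (Sig I) h), restrict (Sub_map I h) (Sub I (Dom (Sig I) h)),
       Sub I (Cod (Sig I) h)))\<rparr>"

section \<open>Semantic sequents and compactness\<close>

definition entails ::
  "('sig, 'mor, 'm, 'h, 's, 'x, 'y) inst \<Rightarrow> 'sig \<Rightarrow> 's set \<Rightarrow> 's set \<Rightarrow> bool" where
  "entails I S \<Gamma> \<Delta> \<longleftrightarrow>
     \<not> (\<exists>A\<in>Obj (Mods I S). (\<forall>\<gamma>\<in>\<Gamma>. Sat I S A \<gamma>) \<and> (\<forall>\<delta>\<in>\<Delta>. \<not> Sat I S A \<delta>))"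

definition modify_cat ::
  "('sig, 'mor, 'm, 'h, 's, 'x, 'y) inst \<Rightarrow>
    ('s set \<times> 'sig \<times> 's set, ('s set \<times> 'sig \<times> 's set) \<times> 'mor \<times> ('s set \<times> 'sig \<times> 's set)) cat" where
  "modify_cat I = \<lparr>
     Obj = {(\<Gamma>, S, \<Delta>). S \<in> Obj (Sig I) \<and> \<Gamma> \<subseteq> Sen I S \<and> \<Delta> \<subseteq> Sen I S},
     Arr = {((\<Gamma>, S, \<Delta>), h, (\<Gamma>', S', \<Delta>')).
       S \<in> Obj (Sig I) \<and> \<Gamma> \<subseteq> Sen I S \<and> \<Delta> \<subseteq> Sen I S \<and>
       S' \<in> Obj (Sig I) \<and> \<Gamma>' \<subseteq> Sen I S' \<and> \<Delta>' \<subseteq> Sen I S' \<and>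
       h \<in> hom (Sig I) S S' \<and> Sen_map I h ` \<Gamma> \<subseteq> \<Gamma>' \<and> Sen_map I h ` \<Delta> \<subseteq> \<Delta>'},
     Dom = (\<lambda>(P, h, Q). P),
     Cod = (\<lambda>(P, h, Q). Q),
     Id = (\<lambda>(\<Gamma>, S, \<Delta>). ((\<Gamma>, S, \<Delta>), Id (Sig I) S, (\<Gamma>, S, \<Delta>))),
     Comp = (\<lambda>(Q', h', R) (P, h, Q). (P, h' \<cdot>\<^bsub>Sig I\<^esub> h, R))\<rparr>"

lemma Sen_map_in:
  assumes "is_functor (Sig I) set_cat (Sen_fctr I)" and "h \<in> hom (Sig I) S S'" and "\<gamma> \<in> Sen I S"
  shows "Sen_map I h \<gamma> \<in> Sen I S'"
proof -
  have "farr (Sen_fctr I) h \<in> Arr set_cat" using assms(1,2) by (auto simp: is_functor_def hom_def)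
  then have "restrict (Sen_map I h) (Sen I S) \<in> Sen I S \<rightarrow>\<^sub>E Sen I S'"
    using assms(2) by (simp add: Sen_fctr_def set_cat_def hom_def)
  from PiE_mem[OF this assms(3)] show ?thesis using assms(3) by simp
qed

lemma Sen_map_id:
  assumes "is_functor (Sig I) set_cat (Sen_fctr I)" and "S \<in> Obj (Sig I)" and "\<gamma> \<in> Sen I S"
  shows "Sen_map I (Id (Sig I) S) \<gamma> = \<gamma>"
proof -
  have "Id (Sig I) S \<in> hom (Sig I) S S"
    using assms(1,2) category.id_hom by (fastforce simp: is_functor_def)
  moreover have "farr (Sen_fctr I) (Id (Sig I) S) = Id set_cat (fobj (Sen_fctr I) S)"
    using assms(1,2) by (simp add: is_functor_def)
  ultimately have "restrict (Sen_map I (Id (Sig I) S)) (Sen I S) = restrict (\<lambda>x. x) (Sen I S)"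
    by (simp add: Sen_fctr_def set_cat_def hom_def)
  from fun_cong[OF this, of \<gamma>] show ?thesis using assms(3) by simp
qed

lemma Sen_map_comp:
  assumes "is_functor (Sig I) set_cat (Sen_fctr I)" and "f \<in> hom (Sig I) a b" and "g \<in> hom (Sig I) b c"
    and "\<gamma> \<in> Sen I a"
  shows "Sen_map I (g \<cdot>\<^bsub>Sig I\<^esub> f) \<gamma> = Sen_map I g (Sen_map I f \<gamma>)"
proof -
  have "g \<cdot>\<^bsub>Sig I\<^esub> f \<in> hom (Sig I) a c"
    using assms(1-3) category.comp_hom by (fastforce simp: is_functor_def)
  moreover have "farr (Sen_fctr I) (g \<cdot>\<^bsub>Sig I\<^esub> f) = farr (Sen_fctr I) g \<cdot>\<^bsub>set_cat\<^esub> farr (Sen_fctr I) f"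
    using assms(1-3) by (simp add: is_functor_def hom_def)
  ultimately have "restrict (Sen_map I (g \<cdot>\<^bsub>Sig I\<^esub> f)) (Sen I a) =
      compose (Sen I a) (restrict (Sen_map I g) (Sen I b)) (restrict (Sen_map I f) (Sen I a))"
    using assms(2,3) by (simp add: Sen_fctr_def set_cat_def hom_def)
  from fun_cong[OF this, of \<gamma>] show ?thesis
    using assms(4) Sen_map_in[OF assms(1,2,4)] by (simp add: compose_def)
qed

lemma hom_modify_cat:
  "f \<in> hom (modify_cat I) a b \<longleftrightarrow>
     (\<exists>h. f = (a, h, b) \<and> a \<in> Obj (modify_cat I) \<and> b \<in> Obj (modify_cat I) \<and>
        h \<in> hom (Sig I) (fst (snd a)) (fst (snd b)) \<and>
        Sen_map I h ` fst a \<subseteq> fst b \<and> Sen_map I h ` snd (snd a) \<subseteq> snd (snd b))"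
proof -
  obtain p h q where f: "f = (p, h, q)" by (metis prod_cases3)
  show ?thesis unfolding f hom_def[of "modify_cat I"]
    by (cases p; cases q) (auto simp: modify_cat_def image_subset_iff)
qed

lemma category_modify_cat:
  assumes "category (Sig I)" and F: "is_functor (Sig I) set_cat (Sen_fctr I)"
  shows "category (modify_cat I)"
proof -
  interpret S: category "Sig I" by fact
  show ?thesis
  proof
    fix f assume "f \<in> Arr (modify_cat I)"
    then show "Dom (modify_cat I) f \<in> Obj (modify_cat I)" "Cod (modify_cat I) f \<in> Obj (modify_cat I)"
      by (auto simp: modify_cat_def)
  next
    fix a assume a: "a \<in> Obj (modify_cat I)"
    then have "Sen_map I (Id (Sig I) (fst (snd a))) ` \<Gamma> = \<Gamma>" if "\<Gamma> = fst a \<or> \<Gamma> = snd (snd a)" for \<Gamma>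
      using that by (auto simp: modify_cat_def Sen_map_id[OF F] subset_iff image_iff)
    then show "Id (modify_cat I) a \<in> hom (modify_cat I) a a"
      using a S.id_hom unfolding hom_modify_cat by (auto simp: modify_cat_def)
  next
    fix f g a b c
    assume f: "f \<in> hom (modify_cat I) a b" and g: "g \<in> hom (modify_cat I) b c"
    obtain u v where uv: "f = (a, u, b)" "g = (b, v, c)"
      "u \<in> hom (Sig I) (fst (snd a)) (fst (snd b))" "v \<in> hom (Sig I) (fst (snd b)) (fst (snd c))"
      using f g by (auto simp: hom_modify_cat)
    have "fst a \<union> snd (snd a) \<subseteq> Sen I (fst (snd a))"
      using f by (auto simp: hom_modify_cat) (auto simp: modify_cat_def)
    then have "Sen_map I (v \<cdot>\<^bsub>Sig I\<^esub> u) \<gamma> = Sen_map I v (Sen_map I u \<gamma>)" if "\<gamma> \<in> fst a \<union> snd (snd a)" for \<gamma>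
      using Sen_map_comp[OF F uv(3,4)] that by blast
    then have "Sen_map I (v \<cdot>\<^bsub>Sig I\<^esub> u) ` fst a \<subseteq> fst c" "Sen_map I (v \<cdot>\<^bsub>Sig I\<^esub> u) ` snd (snd a) \<subseteq> snd (snd c)"
      using f g by (auto simp: hom_modify_cat uv(1,2) image_subset_iff)
    moreover have "g \<cdot>\<^bsub>modify_cat I\<^esub> f = (a, v \<cdot>\<^bsub>Sig I\<^esub> u, c)"
      by (simp add: modify_cat_def uv(1,2))
    ultimately show "g \<cdot>\<^bsub>modify_cat I\<^esub> f \<in> hom (modify_cat I) a c"
      using f g S.comp_hom[OF uv(3,4)] unfolding hom_modify_cat by blast
  next
    fix f a b assume "f \<in> hom (modify_cat I) a b"
    then obtain u where u: "f = (a, u, b)" "u \<in> hom (Sig I) (fst (snd a)) (fst (snd b))"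
      by (auto simp: hom_modify_cat)
    show "Id (modify_cat I) b \<cdot>\<^bsub>modify_cat I\<^esub> f = f" "f \<cdot>\<^bsub>modify_cat I\<^esub> Id (modify_cat I) a = f"
      using S.id_left[OF u(2)] S.id_right[OF u(2)]
      by (cases a; cases b; simp add: u(1) modify_cat_def)+
  next
    fix f g h a b c d
    assume "f \<in> hom (modify_cat I) a b" "g \<in> hom (modify_cat I) b c" "h \<in> hom (modify_cat I) c d"
    then obtain u v w where *: "f = (a, u, b)" "g = (b, v, c)" "h = (c, w, d)"
      "u \<in> hom (Sig I) (fst (snd a)) (fst (snd b))" "v \<in> hom (Sig I) (fst (snd b)) (fst (snd c))"
      "w \<in> hom (Sig I) (fst (snd c)) (fst (snd d))"
      unfolding hom_modify_cat by blast
    show "h \<cdot>\<^bsub>modify_cat I\<^esub> (g \<cdot>\<^bsub>modify_cat I\<^esub> f) = (h \<cdot>\<^bsub>modify_cat I\<^esub> g) \<cdot>\<^bsub>modify_cat I\<^esub> f"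
      using S.comp_assoc[OF *(4-6)] by (simp add: *(1-3) modify_cat_def)
  qed
qed

definition compact_sequent ::
  "'j itself \<Rightarrow> ('sig, 'mor, 'm, 'h, 's, 'x, 'y) inst \<Rightarrow> ('sig \<Rightarrow> 's set \<Rightarrow> 's set \<Rightarrow> bool) \<Rightarrow> bool" where
  "compact_sequent _ I R \<longleftrightarrow>
     (\<forall>(J :: 'j set) r D \<Gamma> S \<Delta> l.
        directed_poset J r \<and> is_colimit (poset_cat J r) (modify_cat I) D (\<Gamma>, S, \<Delta>) l \<and>
        (\<forall>i\<in>J. \<forall>\<Gamma>\<^sub>i S\<^sub>i \<Delta>\<^sub>i. fobj D i = (\<Gamma>\<^sub>i, S\<^sub>i, \<Delta>\<^sub>i) \<longrightarrow> \<not> R S\<^sub>i \<Gamma>\<^sub>i \<Delta>\<^sub>i) \<longrightarrow>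
        \<not> R S \<Gamma> \<Delta>)"

section \<open>First-order sentences over an institution\<close>

text \<open>
  \<open>FOL I\<close> is $\mathsf{FOL}_\alpha(\mathcal{I})$ for $\alpha = \omega$: the families
  $N \to \mathsf{Sen}^\omega(\Sigma)$ with $N \in \omega$ are exactly the finite lists.
  \<open>fol_sen I \<phi> S\<close> says that \<open>\<phi>\<close> is one of the sentences generated over the signature \<open>S\<close>.
\<close>

datatype ('s, 'x) fol = Atom 's | Neg "('s, 'x) fol" | Disj "('s, 'x) fol list" | Exists 'x "('s, 'x) fol"

primrec fol_sen :: "('sig, 'mor, 'm, 'h, 's, 'x, 'y) inst \<Rightarrow> ('s, 'x) fol \<Rightarrow> 'sig \<Rightarrow> bool" where
  "fol_sen I (Atom \<gamma>) = (\<lambda>S. \<gamma> \<in> Sen I S)"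
| "fol_sen I (Neg \<phi>) = (\<lambda>S. fol_sen I \<phi> S)"
| "fol_sen I (Disj \<phi>s) = (\<lambda>S. \<forall>p\<in>set (map (fol_sen I) \<phi>s). p S)"
| "fol_sen I (Exists X \<phi>) = (\<lambda>S. X \<in> Obj (Blk I S) \<and> fol_sen I \<phi> (Ext I S X))"

primrec fol_map :: "('sig, 'mor, 'm, 'h, 's, 'x, 'y) inst \<Rightarrow> ('s, 'x) fol \<Rightarrow> 'mor \<Rightarrow> ('s, 'x) fol" where
  "fol_map I (Atom \<gamma>) = (\<lambda>h. Atom (Sen_map I h \<gamma>))"
| "fol_map I (Neg \<phi>) = (\<lambda>h. Neg (fol_map I \<phi> h))"
| "fol_map I (Disj \<phi>s) = (\<lambda>h. Disj (map (\<lambda>t. t h) (map (fol_map I) \<phi>s)))"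
| "fol_map I (Exists X \<phi>) = (\<lambda>h. Exists (Blk_obj I h X) (fol_map I \<phi> (Ext_mor I h X)))"

primrec fol_sat :: "('sig, 'mor, 'm, 'h, 's, 'x, 'y) inst \<Rightarrow> ('s, 'x) fol \<Rightarrow> 'sig \<Rightarrow> 'm \<Rightarrow> bool" where
  "fol_sat I (Atom \<gamma>) = (\<lambda>S A. Sat I S A \<gamma>)"
| "fol_sat I (Neg \<phi>) = (\<lambda>S A. \<not> fol_sat I \<phi> S A)"
| "fol_sat I (Disj \<phi>s) = (\<lambda>S A. \<exists>p\<in>set (map (fol_sat I) \<phi>s). p S A)"
| "fol_sat I (Exists X \<phi>) = (\<lambda>S A. \<exists>B. expansion I (Incl I S X) A B \<and> fol_sat I \<phi> (Ext I S X) B)"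

definition FOL ::
  "('sig, 'mor, 'm, 'h, 's, 'x, 'y) inst \<Rightarrow> ('sig, 'mor, 'm, 'h, ('s, 'x) fol, 'x, 'y) inst" where
  "FOL I = \<lparr>Sig = Sig I, Mods = Mods I, Red_obj = Red_obj I, Red_arr = Red_arr I,
     Sen = (\<lambda>S. {\<phi>. fol_sen I \<phi> S}), Sen_map = (\<lambda>h \<phi>. fol_map I \<phi> h),
     Sat = (\<lambda>S A \<phi>. fol_sat I \<phi> S A),
     Blk = Blk I, Blk_obj = Blk_obj I, Blk_arr = Blk_arr I,
     Ext = Ext I, Incl = Incl I, Ext_arr = Ext_arr I, Ext_mor = Ext_mor I\<rparr>"

lemma FOL_sen_functor:
  assumes "delta_institution I"
  shows "is_functor (Sig (FOL I)) set_cat (Sen_fctr (FOL I))"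
proof -
  interpret delta_institution I by fact
  interpret S: category "Sig I" by (rule sig_category)
  have Blk1: "Blk_obj I h X \<in> Obj (Blk I S')" if "h \<in> hom (Sig I) S S'" "X \<in> Obj (Blk I S)" for h S S' X
  proof -
    have "farr (Blk_fctr I) h \<in> Arr cat_cat" using blk_functor that by (auto simp: is_functor_def hom_def)
    then show ?thesis
      using that by (simp add: Blk_fctr_def restr_fctr_def cat_cat_def hom_def is_functor_def)
  qed
  have map: "fol_sen I (fol_map I \<phi> h) S'" if "fol_sen I \<phi> S" "h \<in> hom (Sig I) S S'" for \<phi> h S S'
    using that
  proof (induction \<phi> arbitrary: S S' h)
    case (Exists X \<phi>)
    then show ?case using Blk1 ext_mor_hom by fastforce
  qed (auto intro: Sen_map_in[OF sen_functor])
  have Sid: "Sen_map I (Id (Sig I) S) \<gamma> = \<gamma>" if "S \<in> Obj (Sig I)" "\<gamma> \<in> Sen I S" for S \<gamma>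
    using Sen_map_id[OF sen_functor that] .
  have Bid: "Blk_obj I (Id (Sig I) S) X = X" if "S \<in> Obj (Sig I)" "X \<in> Obj (Blk I S)" for S X
  proof -
    have "farr (Blk_fctr I) (Id (Sig I) S) = Id cat_cat (fobj (Blk_fctr I) S)"
      using blk_functor that by (simp add: is_functor_def)
    then have "restrict (Blk_obj I (Id (Sig I) S)) (Obj (Blk I S)) = restrict (\<lambda>x. x) (Obj (Blk I S))"
      using S.id_hom[OF that(1)] by (simp add: Blk_fctr_def cat_cat_def restr_fctr_def hom_def)
    from fun_cong[OF this, of X] show ?thesis using that by simp
  qed
  have id: "fol_map I \<phi> (Id (Sig I) S) = \<phi>" if "fol_sen I \<phi> S" "S \<in> Obj (Sig I)" for \<phi> S
    using that
  proof (induction \<phi> arbitrary: S)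
    case (Exists X \<phi>)
    have "Ext I S X \<in> Obj (Sig I)" using incl_hom[of S X] S.cod_obj[of "Incl I S X"] Exists.prems by (auto simp: hom_def)
    then show ?case using Exists Bid ext_mor_id by simp
  next
    case (Disj \<phi>s)
    then show ?case by (auto intro!: map_idI)
  qed (auto simp: Sid)
  have Bcomp: "Blk_obj I (g \<cdot>\<^bsub>Sig I\<^esub> f) X = Blk_obj I g (Blk_obj I f X)"
    if "f \<in> hom (Sig I) a b" "g \<in> hom (Sig I) b c" "X \<in> Obj (Blk I a)" for f g a b c X
  proof -
    have "farr (Blk_fctr I) (g \<cdot>\<^bsub>Sig I\<^esub> f) = farr (Blk_fctr I) g \<cdot>\<^bsub>cat_cat\<^esub> farr (Blk_fctr I) f"
      using blk_functor that by (simp add: is_functor_def hom_def)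
    then have "restrict (Blk_obj I (g \<cdot>\<^bsub>Sig I\<^esub> f)) (Obj (Blk I a)) =
        restrict (restrict (Blk_obj I g) (Obj (Blk I b)) \<circ> restrict (Blk_obj I f) (Obj (Blk I a))) (Obj (Blk I a))"
      using S.comp_hom[OF that(1,2)] that by (simp add: Blk_fctr_def cat_cat_def restr_fctr_def comp_fctr_def hom_def)
    from fun_cong[OF this, of X] show ?thesis using that Blk1[OF that(1,3)] by simp
  qed
  have comp: "fol_map I \<phi> (g \<cdot>\<^bsub>Sig I\<^esub> f) = fol_map I (fol_map I \<phi> f) g"
    if "fol_sen I \<phi> a" "f \<in> hom (Sig I) a b" "g \<in> hom (Sig I) b c" for \<phi> f g a b c
    using that
  proof (induction \<phi> arbitrary: f g a b c)
    case (Exists X \<phi>)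
    have "Ext_mor I f X \<in> hom (Sig I) (Ext I a X) (Ext I b (Blk_obj I f X))"
      "Ext_mor I g (Blk_obj I f X) \<in> hom (Sig I) (Ext I b (Blk_obj I f X)) (Ext I c (Blk_obj I g (Blk_obj I f X)))"
      using Exists.prems Blk1 ext_mor_hom by auto
    then show ?case using Exists Bcomp ext_mor_comp by auto
  qed (auto simp: Sen_map_comp[OF sen_functor])
  have Id: "farr (Sen_fctr (FOL I)) (Id (Sig I) S) = Id set_cat (fobj (Sen_fctr (FOL I)) S)"
    if "S \<in> Obj (Sig I)" for S
  proof -
    have "Dom (Sig I) (Id (Sig I) S) = S" "Cod (Sig I) (Id (Sig I) S) = S"
      using S.id_hom[OF that] by (simp_all add: hom_def)
    then show ?thesis using id that by (simp add: Sen_fctr_def FOL_def set_cat_def fun_eq_iff)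
  qed
  have Comp: "farr (Sen_fctr (FOL I)) (g \<cdot>\<^bsub>Sig I\<^esub> f) =
      farr (Sen_fctr (FOL I)) g \<cdot>\<^bsub>set_cat\<^esub> farr (Sen_fctr (FOL I)) f"
    if "f \<in> Arr (Sig I)" "g \<in> Arr (Sig I)" "Cod (Sig I) f = Dom (Sig I) g" for f g
  proof -
    have fg: "f \<in> hom (Sig I) (Dom (Sig I) f) (Dom (Sig I) g)"
      "g \<in> hom (Sig I) (Dom (Sig I) g) (Cod (Sig I) g)"
      using that by (simp_all add: hom_def)
    then have "Dom (Sig I) (g \<cdot>\<^bsub>Sig I\<^esub> f) = Dom (Sig I) f" "Cod (Sig I) (g \<cdot>\<^bsub>Sig I\<^esub> f) = Cod (Sig I) g"
      using S.comp_hom[OF fg] by (simp_all add: hom_def)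
    then show ?thesis using map[OF _ fg(1)] comp[OF _ fg] that(3)
      by (simp add: Sen_fctr_def FOL_def set_cat_def compose_def fun_eq_iff)
  qed
  have "farr (Sen_fctr (FOL I)) f \<in>
      hom set_cat (fobj (Sen_fctr (FOL I)) (Dom (Sig I) f)) (fobj (Sen_fctr (FOL I)) (Cod (Sig I) f))"
    if "f \<in> Arr (Sig I)" for f
    using map[of _ "Dom (Sig I) f" f "Cod (Sig I) f"] that
    by (simp add: Sen_fctr_def FOL_def set_cat_def hom_def)
  moreover have "Sig (FOL I) = Sig I" by (simp add: FOL_def)
  ultimately show ?thesis
    using sig_category Id Comp
    by (simp add: is_functor_def category_set_cat) (simp add: set_cat_def)
qed

section \<open>The syntactic sequent\<close>

text \<open>\<open>fol_sequent\<close> confines every rule to sets of sentences over its signature.\<close>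

definition fol_sequent ::
  "('sig, 'mor, 'm, 'h, 's, 'x, 'y) inst \<Rightarrow> 'sig \<Rightarrow> ('s, 'x) fol set \<Rightarrow> ('s, 'x) fol set \<Rightarrow> bool" where
  "fol_sequent I S \<Gamma> \<Delta> \<longleftrightarrow>
     S \<in> Obj (Sig (FOL I)) \<and> \<Gamma> \<subseteq> Sen (FOL I) S \<and> \<Delta> \<subseteq> Sen (FOL I) S"

inductive derives ::
  "('sig, 'mor, 'm, 'h, 's, 'x, 'y) inst \<Rightarrow> 'sig \<Rightarrow> ('s, 'x) fol set \<Rightarrow> ('s, 'x) fol set \<Rightarrow> bool"
  for I :: "('sig, 'mor, 'm, 'h, 's, 'x, 'y) inst" where
  Modify: "derives I S' \<Gamma>' \<Delta>'"
    if "derives I S \<Gamma> \<Delta>" and "h \<in> hom (Sig I) S S'" and "fol_sequent I S' \<Gamma>' \<Delta>'"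
      and "Sen_map (FOL I) h ` \<Gamma> \<subseteq> \<Gamma>'" and "Sen_map (FOL I) h ` \<Delta> \<subseteq> \<Delta>'"
| Init: "derives I S ({\<psi>} \<union> \<Gamma>) (\<Delta> \<union> {\<psi>})"
    if "fol_sequent I S ({\<psi>} \<union> \<Gamma>) (\<Delta> \<union> {\<psi>})"
| Cut: "derives I S (\<Gamma> \<union> \<Gamma>') (\<Delta> \<union> \<Delta>')"
    if "derives I S \<Gamma> (\<Delta> \<union> {\<psi>})" and "derives I S ({\<psi>} \<union> \<Gamma>') \<Delta>'"
      and "fol_sequent I S (\<Gamma> \<union> \<Gamma>') (\<Delta> \<union> \<Delta>')"
| Atomic: "derives I S (Atom ` \<Gamma>\<^sub>b \<union> \<Gamma>) (\<Delta> \<union> Atom ` \<Delta>\<^sub>b)"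
    if "\<Gamma>\<^sub>b \<subseteq> Sen I S" and "\<Delta>\<^sub>b \<subseteq> Sen I S" and "entails I S \<Gamma>\<^sub>b \<Delta>\<^sub>b"
      and "fol_sequent I S (Atom ` \<Gamma>\<^sub>b \<union> \<Gamma>) (\<Delta> \<union> Atom ` \<Delta>\<^sub>b)"
| Neg_left: "derives I S ({Neg \<phi>} \<union> \<Gamma>) \<Delta>"
    if "derives I S \<Gamma> (\<Delta> \<union> {\<phi>})" and "fol_sequent I S ({Neg \<phi>} \<union> \<Gamma>) \<Delta>"
| Neg_right: "derives I S \<Gamma> (\<Delta> \<union> {Neg \<phi>})"
    if "derives I S ({\<phi>} \<union> \<Gamma>) \<Delta>" and "fol_sequent I S \<Gamma> (\<Delta> \<union> {Neg \<phi>})"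
| Disj_left: "derives I S ({Disj \<phi>s} \<union> (\<Union>n<length \<phi>s. \<Gamma>s n)) (\<Union>n<length \<phi>s. \<Delta>s n)"
    if "\<And>n. n < length \<phi>s \<Longrightarrow> derives I S ({\<phi>s ! n} \<union> \<Gamma>s n) (\<Delta>s n)"
      and "fol_sequent I S ({Disj \<phi>s} \<union> (\<Union>n<length \<phi>s. \<Gamma>s n)) (\<Union>n<length \<phi>s. \<Delta>s n)"
| Disj_right: "derives I S \<Gamma> (\<Delta> \<union> {Disj \<phi>s})"
    if "n < length \<phi>s" and "derives I S \<Gamma> (\<Delta> \<union> {\<phi>s ! n})" and "fol_sequent I S \<Gamma> (\<Delta> \<union> {Disj \<phi>s})"
| Ex_left: "derives I S ({Exists X \<phi>} \<union> \<Gamma>) \<Delta>"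
    if "derives I (Ext I S X) ({\<phi>} \<union> Sen_map (FOL I) (Incl I S X) ` \<Gamma>)
          (Sen_map (FOL I) (Incl I S X) ` \<Delta>)"
      and "fol_sequent I S ({Exists X \<phi>} \<union> \<Gamma>) \<Delta>"
| Ex_right: "derives I S \<Gamma> (\<Delta> \<union> {Exists X \<phi>})"
    if "substitution I (Incl I S X) \<theta>" and "derives I S \<Gamma> (\<Delta> \<union> {Sen_map (FOL I) \<theta> \<phi>})"
      and "fol_sequent I S \<Gamma> (\<Delta> \<union> {Exists X \<phi>})"

section \<open>The class $\mathbf{DINS}_b$\<close>

definition epi_basic :: "('sig, 'mor, 'm, 'h, 's, 'x, 'y) inst \<Rightarrow> 'sig \<Rightarrow> 's set \<Rightarrow> 'm \<Rightarrow> bool" where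
  "epi_basic I S \<Gamma> T \<longleftrightarrow> T \<in> Obj (Mods I S) \<and>
     (\<forall>A\<in>Obj (Mods I S).
        ((\<forall>\<gamma>\<in>\<Gamma>. Sat I S A \<gamma>) \<longleftrightarrow> (\<exists>f. f \<in> hom (Mods I S) T A)) \<and>
        (\<forall>f\<in>hom (Mods I S) T A. \<forall>g\<in>hom (Mods I S) T A. f = g))"

definition reachable :: "('sig, 'mor, 'm, 'h, 's, 'x, 'y) inst \<Rightarrow> 'sig \<Rightarrow> 'm \<Rightarrow> bool" where
  "reachable I S A \<longleftrightarrow>
     (\<forall>X\<in>Obj (Blk I S). \<forall>B. expansion I (Incl I S X) A B \<longrightarrow>
        (\<exists>\<theta>. substitution I (Incl I S X) \<theta> \<and> B = Red_obj I \<theta> A))"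

definition DINS_b :: "'j itself \<Rightarrow> ('sig, 'mor, 'm, 'h, 's, 'x, 'y) inst \<Rightarrow> bool" where
  "DINS_b j I \<longleftrightarrow> delta_institution I \<and>
     has_directed_colimits j (Sig I) \<and>
     preserves_directed_colimits j (Sig I) set_cat (Sen_fctr I) \<and>
     preserves_directed_colimits j (Sig I) cat_cat (Blk_fctr I) \<and>
     preserves_directed_colimits j (Sig I) set_cat (Sub_fctr I) \<and>
     (\<forall>S\<in>Obj (Sig I). \<forall>\<Gamma>\<subseteq>Sen I S. \<exists>T. epi_basic I S \<Gamma> T \<and> reachable I S T) \<and>
     compact_sequent j I (entails I)"

end

(*
  By induction on a derivation of Gamma |- Delta over S one shows: whenever h : S -> T, T is a
  directed colimit of signatures T_k, and compatible sets G_k, H_k of T_k-sentences cover the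
  translations of Gamma and Delta along h, some stage satisfies G_k |- H_k. The translation h is
  part of the induction hypothesis so that the rule (Modify) causes no trouble: it has no reason to
  be compatible with the diagram.

  Every rule is then carried out at a sufficiently late stage. Finitary first-order sentences over T
  come from some stage, and equal ones become equal at some stage, because Sen and the blocks
  preserve directed colimits and because T[X] is the directed colimit of the T_k[X_k], by the
  pushout squares. (Atom) is the compactness of the base institution, the existential rule on the
  right uses that Sub preserves directed colimits, and the one on the left passes to T[X].
*)
theory Submission
  imports Defs
begin

section \<open>Directed colimits of sets and of categories\<close>

text \<open>Preservation of colimits gives, in \<open>set_cat\<close> and \<open>cat_cat\<close>,
  only a universal property among objects carried by the given types. The familiar description of a
  directed colimit (every element comes from a stage, equal elements become equal at a later stage)
  has to be recovered by testing against cocones small enough to fit into those types. A second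
  obstacle comes from the blocks: two representatives of an existential sentence have bodies over
  different signatures until their blocks have been merged. Statements about sentences are therefore
  generalised over all directed diagrams, so that they apply again to the diagram of extended
  signatures. The stage sets are required to cover the translated sequent, not to equal it. Thus the
  family given for the conclusion of a rule also serves its premises, once the active formula has
  been adjoined, and several premises can be met at one later stage. Models are looked at only for
  the atomic rule.\<close>

lemma directed_posetD:
  assumes "directed_poset J r"
  shows "(i, k) \<in> r \<Longrightarrow> i \<in> J" "(i, k) \<in> r \<Longrightarrow> k \<in> J" "i \<in> J \<Longrightarrow> (i, i) \<in> r"
    "(i, k) \<in> r \<Longrightarrow> (k, m) \<in> r \<Longrightarrow> (i, m) \<in> r"
    "i \<in> J \<Longrightarrow> k \<in> J \<Longrightarrow> \<exists>m\<in>J. (i, m) \<in> r \<and> (k, m) \<in> r"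
    "J \<noteq> {}"
  using assms unfolding directed_poset_def partial_order_on_def preorder_on_def refl_on_def trans_def
  by blast+

lemma directed_poset_bound:
  assumes "directed_poset J r" "finite F" "F \<subseteq> J"
  shows "\<exists>k\<in>J. \<forall>i\<in>F. (i, k) \<in> r"
  using assms(2,3)
proof (induction F)
  case empty
  then show ?case using directed_posetD(6)[OF assms(1)] by auto
next
  case (insert x F)
  then obtain k where "k \<in> J" "\<forall>i\<in>F. (i, k) \<in> r" by auto
  moreover obtain m where "m \<in> J" "(x, m) \<in> r" "(k, m) \<in> r"
    using directed_posetD(5)[OF assms(1)] \<open>k \<in> J\<close> insert.prems by blast
  ultimately show ?case using directed_posetD(4)[OF assms(1)] by blast
qed

text \<open>
  The quotient of the disjoint union of a directed system need not fit into the type that serves as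
  universe. A two-valued cocone separating two given elements always does.
\<close>

lemma directed_system_separation:
  assumes dir: "directed_poset J r"
    and comp: "\<And>j k m z. (j, k) \<in> r \<Longrightarrow> (k, m) \<in> r \<Longrightarrow> z \<in> A j \<Longrightarrow> t (j, m) z = t (k, m) (t (j, k) z)"
    and a: "i \<in> J" "a \<in> A i" "b \<in> A i"
    and ne: "\<And>k. (i, k) \<in> r \<Longrightarrow> t (i, k) a \<noteq> t (i, k) b"
  shows "\<exists>q. (\<forall>j k z. (j, k) \<in> r \<longrightarrow> z \<in> A j \<longrightarrow> q k (t (j, k) z) = q j z) \<and> q i a \<and> \<not> q i b"
proof -
  note D = directed_posetD[OF dir]
  \<comment> \<open>\<open>q j\<close> marks the elements of stage \<open>j\<close> that are
    eventually identified with \<open>a\<close>: it is the characteristic function of the class of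
    \<open>a\<close> in the usual quotient, and \<open>ne\<close> keeps \<open>b\<close> out of that
    class.\<close>
  define q where "q j z \<longleftrightarrow> (\<exists>k. (i, k) \<in> r \<and> (j, k) \<in> r \<and> t (j, k) z = t (i, k) a)" for j z
  have "q k (t (j, k) z) = q j z" if jk: "(j, k) \<in> r" "z \<in> A j" for j k z
  proof
    assume "q k (t (j, k) z)"
    then show "q j z" unfolding q_def using comp[OF jk(1) _ jk(2)] D(4) jk(1) by metis
  next
    assume "q j z"
    then obtain m where m: "(i, m) \<in> r" "(j, m) \<in> r" "t (j, m) z = t (i, m) a" unfolding q_def by blast
    \<comment> \<open>The witness \<open>m\<close> need not lie above \<open>k\<close>, so it is
      moved to a common upper bound.\<close>
    obtain n where n: "(k, n) \<in> r" "(m, n) \<in> r" using D(2,5) jk(1) m(1) by metis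
    have "t (k, n) (t (j, k) z) = t (m, n) (t (j, m) z)"
      using comp[OF jk(1) n(1) jk(2)] comp[OF m(2) n(2) jk(2)] by simp
    also have "\<dots> = t (i, n) a" using comp[OF m(1) n(2) a(2)] m(3) by simp
    finally show "q k (t (j, k) z)" unfolding q_def using n(1) D(4)[OF m(1) n(2)] by blast
  qed
  moreover have "q i a" unfolding q_def using D(3) a by blast
  moreover have "\<not> q i b" unfolding q_def using ne by metis
  ultimately show ?thesis by blast
qed

text \<open>Arrows of \<open>set_cat\<close>, \<open>cat_cat\<close> and \<open>modify_cat\<close>
  are all triples carrying their source and target; one projection serves for the three
  categories.\<close>

definition amap :: "'p \<times> 'f \<times> 'q \<Rightarrow> 'f" where "amap f = fst (snd f)"

lemma poset_cat_simps [simp]: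
  "Obj (poset_cat J r) = J" "Arr (poset_cat J r) = r" "Dom (poset_cat J r) = fst" "Cod (poset_cat J r) = snd"
  "Id (poset_cat J r) i = (i, i)" "Comp (poset_cat J r) v u = (fst u, snd v)"
  by (simp_all add: poset_cat_def)

lemma poset_functorD:
  assumes "is_functor (poset_cat J r) C D"
  shows "i \<in> J \<Longrightarrow> fobj D i \<in> Obj C" "(i, k) \<in> r \<Longrightarrow> farr D (i, k) \<in> hom C (fobj D i) (fobj D k)"
    "i \<in> J \<Longrightarrow> farr D (i, i) = Id C (fobj D i)"
    "(i, k) \<in> r \<Longrightarrow> (k, m) \<in> r \<Longrightarrow> farr D (i, m) = farr D (k, m) \<cdot>\<^bsub>C\<^esub> farr D (i, k)"
  using assms unfolding is_functor_def by force+

lemma poset_cocone_iff: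
  "is_cocone (poset_cat J r) C D a l \<longleftrightarrow> a \<in> Obj C \<and> (\<forall>k\<in>J. l k \<in> hom C (fobj D k) a) \<and>
    (\<forall>i k. (i, k) \<in> r \<longrightarrow> l k \<cdot>\<^bsub>C\<^esub> farr D (i, k) = l i)"
  unfolding is_cocone_def by auto

text \<open>Both arrows mediate the cocone obtained by composing \<open>h\<close> with the legs, so
  the uniqueness clause identifies them.\<close>

lemma colimit_joint_epi:
  assumes col: "is_colimit K C D a l" and h: "h \<in> hom C a b" and h': "h' \<in> hom C a b"
    and eq: "\<And>k. k \<in> Obj K \<Longrightarrow> h \<cdot>\<^bsub>C\<^esub> l k = h' \<cdot>\<^bsub>C\<^esub> l k"
  shows "h = h'"
proof -
  have F: "is_functor K C D" and l: "is_cocone K C D a l" using col by (auto simp: is_colimit_def)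
  interpret K: category K using F by (simp add: is_functor_def)
  interpret C: category C using F by (simp add: is_functor_def)
  have lk: "l k \<in> hom C (fobj D k) a" if "k \<in> Obj K" for k using l that by (simp add: is_cocone_def)
  have "h \<cdot>\<^bsub>C\<^esub> l (Cod K u) \<cdot>\<^bsub>C\<^esub> farr D u = h \<cdot>\<^bsub>C\<^esub> l (Dom K u)" if "u \<in> Arr K" for u
  proof -
    have "farr D u \<in> hom C (fobj D (Dom K u)) (fobj D (Cod K u))" using F that by (simp add: is_functor_def)
    from C.comp_assoc[OF this lk h] show ?thesis using l that K.cod_obj by (simp add: is_cocone_def)
  qed
  moreover have "b \<in> Obj C" using h C.cod_obj by (auto simp: hom_def)
  ultimately have "is_cocone K C D b (\<lambda>k. h \<cdot>\<^bsub>C\<^esub> l k)"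
    using C.comp_hom[OF lk h] by (simp add: is_cocone_def)
  then have "\<exists>!g. g \<in> hom C a b \<and> (\<forall>k\<in>Obj K. g \<cdot>\<^bsub>C\<^esub> l k = h \<cdot>\<^bsub>C\<^esub> l k)"
    using col unfolding is_colimit_def by blast
  then show ?thesis using h h' eq by metis
qed

text \<open>Serves to show that a subobject through which all legs factor is the whole colimit: the
  mediating arrow into it, followed by the inclusion, fixes every leg.\<close>

lemma colimit_endo_Id:
  assumes col: "is_colimit K C D a l" and h: "h \<in> hom C a a"
    and eq: "\<And>k. k \<in> Obj K \<Longrightarrow> h \<cdot>\<^bsub>C\<^esub> l k = l k"
  shows "h = Id C a"
proof (rule colimit_joint_epi[OF col h])
  have C: "category C" and l: "is_cocone K C D a l"
    using col by (auto simp: is_colimit_def is_functor_def)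
  then show "Id C a \<in> hom C a a" using category.id_hom by (auto simp: is_cocone_def)
  show "h \<cdot>\<^bsub>C\<^esub> l k = Id C a \<cdot>\<^bsub>C\<^esub> l k" if "k \<in> Obj K" for k
    using category.id_left[OF C, of "l k"] l that eq by (auto simp: is_cocone_def)
qed

lemma is_colimitI:
  assumes "is_functor K C D" "is_cocone K C D a l"
    and "\<And>b m. is_cocone K C D b m \<Longrightarrow> \<exists>h. h \<in> hom C a b \<and> (\<forall>k\<in>Obj K. h \<cdot>\<^bsub>C\<^esub> l k = m k)"
    and "\<And>b h h'. h \<in> hom C a b \<Longrightarrow> h' \<in> hom C a b \<Longrightarrow>
      (\<And>k. k \<in> Obj K \<Longrightarrow> h \<cdot>\<^bsub>C\<^esub> l k = h' \<cdot>\<^bsub>C\<^esub> l k) \<Longrightarrow> h = h'"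
  shows "is_colimit K C D a l"
  unfolding is_colimit_def using assms by (metis (no_types, lifting))

lemma colimit_factor:
  assumes "is_colimit K C D a l" "is_cocone K C D b m"
  shows "\<exists>h. h \<in> hom C a b \<and> (\<forall>k\<in>Obj K. h \<cdot>\<^bsub>C\<^esub> l k = m k)"
  using assms unfolding is_colimit_def by blast

section \<open>Elements of directed colimits of sets\<close>

lemma set_cat_comp [simp]: "(B', g, E) \<cdot>\<^bsub>set_cat\<^esub> (A, f, B) = (A, compose A g f, E)"
  by (simp add: set_cat_def)

lemma set_cat_hom_triple: "f \<in> hom set_cat A B \<Longrightarrow> f = (A, amap f, B) \<and> amap f \<in> A \<rightarrow>\<^sub>E B"
  by (auto simp: hom_set_cat amap_def)

lemma amap_set_compose:
  assumes "f \<in> hom set_cat A B" "g \<in> hom set_cat B E"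
  shows "amap (g \<cdot>\<^bsub>set_cat\<^esub> f) = compose A (amap g) (amap f)"
proof -
  obtain f' g' where "f = (A, f', B)" "g = (B, g', E)" using assms(1,2) unfolding hom_set_cat by blast
  then show ?thesis by (simp add: amap_def)
qed

lemma amap_set_comp:
  assumes "f \<in> hom set_cat A B" "g \<in> hom set_cat B E" "x \<in> A"
  shows "amap (g \<cdot>\<^bsub>set_cat\<^esub> f) x = amap g (amap f x)"
proof -
  obtain f' g' where "f = (A, f', B)" "g = (B, g', E)" using assms(1,2) unfolding hom_set_cat by blast
  then show ?thesis using assms(3) by (simp add: amap_def compose_def)
qed

text \<open>The union of the images of the legs is itself the vertex of a cocone. The mediating map
  into it, viewed as an endomap of \<open>A\<close>, fixes the legs and is the identity, which
  leaves no room for further elements.\<close>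

lemma set_directed_colimit_surj:
  assumes col: "is_colimit (poset_cat J r) set_cat D A l" and x: "x \<in> A"
  shows "\<exists>i\<in>J. \<exists>y\<in>fobj D i. x = amap (l i) y"
proof -
  define B where "B = (\<Union>i\<in>J. amap (l i) ` fobj D i)"
  define m where "m k = (fobj D k, amap (l k), B)" for k
  have coc: "is_cocone (poset_cat J r) set_cat D A l" and F: "is_functor (poset_cat J r) set_cat D"
    using col by (auto simp: is_colimit_def)
  have l: "l k = (fobj D k, amap (l k), A)" "amap (l k) \<in> fobj D k \<rightarrow>\<^sub>E A" if "k \<in> J" for k
    using coc that set_cat_hom_triple[of "l k"] unfolding poset_cocone_iff by auto
  \<comment> \<open>The bounds on \<open>r\<close> come from the index category, whose axioms are
    part of the functoriality of \<open>D\<close>.\<close>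
  have r: "i \<in> J \<and> k \<in> J" if "(i, k) \<in> r" for i k
    using category.dom_obj[of "poset_cat J r" "(i, k)"] category.cod_obj[of "poset_cat J r" "(i, k)"] F that
    by (auto simp: is_functor_def)
  have D: "farr D (i, k) = (fobj D i, amap (farr D (i, k)), fobj D k)" if "(i, k) \<in> r" for i k
    using poset_functorD(2)[OF F that] set_cat_hom_triple by blast
  have BA: "B \<subseteq> A" unfolding B_def using l(2) by auto
  have "amap (l k) \<in> fobj D k \<rightarrow>\<^sub>E B" if "k \<in> J" for k
    using l(2)[OF that] that unfolding B_def by auto
  then have 1: "m k \<in> hom set_cat (fobj D k) B" if "k \<in> J" for k
    using that unfolding hom_set_cat m_def by simp
  have 2: "m k \<cdot>\<^bsub>set_cat\<^esub> farr D (i, k) = m i" if "(i, k) \<in> r" for i k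
  proof -
    have "l k \<cdot>\<^bsub>set_cat\<^esub> farr D (i, k) = l i" using coc that unfolding poset_cocone_iff by blast
    moreover have "l k \<in> hom set_cat (fobj D k) A" using coc r[OF that] unfolding poset_cocone_iff by blast
    ultimately have "compose (fobj D i) (amap (l k)) (amap (farr D (i, k))) = amap (l i)"
      using amap_set_compose[OF poset_functorD(2)[OF F that]] by metis
    then show ?thesis by (subst D[OF that]) (simp add: m_def)
  qed
  have "is_cocone (poset_cat J r) set_cat D B m"
    using 1 2 unfolding poset_cocone_iff by (auto simp: set_cat_def)
  from colimit_factor[OF col this]
  obtain h where h: "h \<in> hom set_cat A B" "\<And>k. k \<in> J \<Longrightarrow> h \<cdot>\<^bsub>set_cat\<^esub> l k = m k" unfolding poset_cat_simps by blast
  obtain h' where h': "h = (A, h', B)" "h' \<in> A \<rightarrow>\<^sub>E B" using h(1) unfolding hom_set_cat by blast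
  \<comment> \<open>Replacing the codomain \<open>B\<close> by \<open>A\<close> amounts to composing
    \<open>h\<close> with the inclusion of \<open>B\<close> into \<open>A\<close>.\<close>
  have "(A, h', A) = Id set_cat A"
  proof (rule colimit_endo_Id[OF col])
    show "(A, h', A) \<in> hom set_cat A A" using h'(2) BA unfolding hom_set_cat by auto
    fix k assume "k \<in> Obj (poset_cat J r)"
    then have k: "k \<in> J" by simp
    have "l k \<in> hom set_cat (fobj D k) A" using coc k unfolding poset_cocone_iff by blast
    from amap_set_compose[OF this h(1)] have "compose (fobj D k) h' (amap (l k)) = amap (l k)"
      using h(2)[OF k] h'(1) by (simp add: m_def amap_def)
    then have "(A, h', A) \<cdot>\<^bsub>set_cat\<^esub> (fobj D k, amap (l k), A) = (fobj D k, amap (l k), A)" by simp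
    then show "(A, h', A) \<cdot>\<^bsub>set_cat\<^esub> l k = l k" by (simp only: l(1)[OF k, symmetric])
  qed
  then have "h' x = x" using x by (simp add: set_cat_def)
  then have "x \<in> B" using PiE_mem[OF h'(2) x] by simp
  then show ?thesis unfolding B_def by blast
qed

text \<open>If the two elements stayed apart at every stage, the separating predicate would give a
  cocone into a two-element set that tells them apart, and no mediating map could send their common
  image to both values.\<close>

lemma set_directed_colimit_eq:
  assumes dir: "directed_poset J r" and col: "is_colimit (poset_cat J r) set_cat D A l"
    and i: "i \<in> J" and ab: "a \<in> fobj D i" "b \<in> fobj D i" and eq: "amap (l i) a = amap (l i) b"
  shows "\<exists>k. (i, k) \<in> r \<and> amap (farr D (i, k)) a = amap (farr D (i, k)) b"
proof (rule ccontr)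
  assume ne: "\<not> ?thesis"
  have coc: "is_cocone (poset_cat J r) set_cat D A l" and F: "is_functor (poset_cat J r) set_cat D"
    using col by (auto simp: is_colimit_def)
  note FD = poset_functorD[OF F] and DP = directed_posetD[OF dir]
  have t: "amap (farr D (j, m)) z = amap (farr D (k, m)) (amap (farr D (j, k)) z)"
    if "(j, k) \<in> r" "(k, m) \<in> r" "z \<in> fobj D j" for j k m z
    unfolding FD(4)[OF that(1,2)] using amap_set_comp[OF FD(2)[OF that(1)] FD(2)[OF that(2)] that(3)] .
  have "amap (farr D (i, k)) a \<noteq> amap (farr D (i, k)) b" if "(i, k) \<in> r" for k using ne that by blast
  from directed_system_separation[OF dir, where A="fobj D" and t="\<lambda>p. amap (farr D p)", OF t i ab this]
  obtain q where q: "\<And>j k z. (j, k) \<in> r \<Longrightarrow> z \<in> fobj D j \<Longrightarrow> q k (amap (farr D (j, k)) z) = q j z"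
      "q i a" "\<not> q i b"
    by blast
  \<comment> \<open>The truth values are represented by \<open>a\<close> and \<open>b\<close>
    themselves, two distinct elements certain to exist in the type.\<close>
  define m where "m k = (fobj D k, \<lambda>z\<in>fobj D k. if q k z then a else b, {a, b})" for k
  have D: "farr D (j, k) = (fobj D j, amap (farr D (j, k)), fobj D k)" "amap (farr D (j, k)) \<in> fobj D j \<rightarrow>\<^sub>E fobj D k"
    if "(j, k) \<in> r" for j k
    using FD(2)[OF that] set_cat_hom_triple by blast+
  have "is_cocone (poset_cat J r) set_cat D {a, b} m"
    unfolding poset_cocone_iff
  proof (intro conjI ballI allI impI)
    show "{a, b} \<in> Obj set_cat" by (simp add: set_cat_def)
    show "m k \<in> hom set_cat (fobj D k) {a, b}" if "k \<in> J" for k unfolding hom_set_cat m_def by auto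
    show "m k \<cdot>\<^bsub>set_cat\<^esub> farr D (j, k) = m j" if "(j, k) \<in> r" for j k
    proof (subst D(1)[OF that])
      have "compose (fobj D j) (\<lambda>z\<in>fobj D k. if q k z then a else b) (amap (farr D (j, k))) =
          (\<lambda>z\<in>fobj D j. if q j z then a else b)"
        using q(1)[OF that] PiE_mem[OF D(2)[OF that]] by (auto simp: compose_def fun_eq_iff)
      then show "m k \<cdot>\<^bsub>set_cat\<^esub> (fobj D j, amap (farr D (j, k)), fobj D k) = m j" by (simp add: m_def)
    qed
  qed
  from colimit_factor[OF col this]
  obtain h where h: "h \<in> hom set_cat A {a, b}" "\<And>k. k \<in> J \<Longrightarrow> h \<cdot>\<^bsub>set_cat\<^esub> l k = m k" unfolding poset_cat_simps by blast
  have "l i \<in> hom set_cat (fobj D i) A" using coc i unfolding poset_cocone_iff by blast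
  then have "amap (m i) a = amap (m i) b" using h(2)[OF i] h(1) ab eq by (metis amap_set_comp)
  then have "a = b" using q(2,3) ab by (auto simp: m_def amap_def)
  then show False using q by blast
qed

section \<open>Objects of directed colimits of categories\<close>

definition omap :: "'p \<times> ('o1, 'a1, 'o2, 'a2) fctr \<times> 'q \<Rightarrow> 'o1 \<Rightarrow> 'o2" where "omap f = fobj (amap f)"

lemma cat_cat_comp [simp]:
  "(B', G, E) \<cdot>\<^bsub>cat_cat\<^esub> (A, F, B) = (A, restr_fctr A (comp_fctr G F), E)"
  by (simp add: cat_cat_def)

lemma hom_cat_cat:
  "f \<in> hom cat_cat A B \<longleftrightarrow> (\<exists>F. f = (A, F, B) \<and> is_functor A B F \<and> fobj F \<in> extensional (Obj A) \<and>
     farr F \<in> extensional (Arr A))"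
  by (cases f) (auto simp: hom_def cat_cat_def)

lemma cat_cat_hom_triple: "f \<in> hom cat_cat A B \<Longrightarrow> f = (A, amap f, B) \<and> is_functor A B (amap f) \<and>
     fobj (amap f) \<in> extensional (Obj A) \<and> farr (amap f) \<in> extensional (Arr A)"
  by (auto simp: hom_cat_cat amap_def)

lemma amap_cat_comp:
  assumes "f \<in> hom cat_cat A B" "g \<in> hom cat_cat B E"
  shows "amap (g \<cdot>\<^bsub>cat_cat\<^esub> f) = restr_fctr A (comp_fctr (amap g) (amap f))"
proof -
  obtain f' g' where "f = (A, f', B)" "g = (B, g', E)" using assms(1,2) unfolding hom_cat_cat by blast
  then show ?thesis by (simp add: amap_def)
qed

lemma omap_comp:
  assumes "f \<in> hom cat_cat A B" "g \<in> hom cat_cat B E" "x \<in> Obj A"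
  shows "omap (g \<cdot>\<^bsub>cat_cat\<^esub> f) x = omap g (omap f x)"
proof -
  obtain f' g' where "f = (A, f', B)" "g = (B, g', E)" using assms(1,2) unfolding hom_cat_cat by blast
  then show ?thesis using assms(3) by (simp add: omap_def amap_def restr_fctr_def comp_fctr_def)
qed

text \<open>The argument for sets, with the full subcategory spanned by the objects that come from a
  stage. Being full, it contains every arrow in the image of a leg, so the legs corestrict to
  it.\<close>

lemma cat_directed_colimit_surj:
  assumes col: "is_colimit (poset_cat J r) cat_cat D A l" and x: "x \<in> Obj A"
  shows "\<exists>i\<in>J. \<exists>y\<in>Obj (fobj D i). x = omap (l i) y"
proof -
  define P where "P = (\<Union>i\<in>J. omap (l i) ` Obj (fobj D i))"
  define B where "B = A\<lparr>Obj := P, Arr := {u \<in> Arr A. Dom A u \<in> P \<and> Cod A u \<in> P}\<rparr>"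
  define m where "m k = (fobj D k, amap (l k), B)" for k
  have coc: "is_cocone (poset_cat J r) cat_cat D A l" and F: "is_functor (poset_cat J r) cat_cat D"
    using col by (auto simp: is_colimit_def)
  have l: "l k = (fobj D k, amap (l k), A)" "is_functor (fobj D k) A (amap (l k))"
     "fobj (amap (l k)) \<in> extensional (Obj (fobj D k))" "farr (amap (l k)) \<in> extensional (Arr (fobj D k))"
     if "k \<in> J" for k
    using coc that cat_cat_hom_triple[of "l k"] unfolding poset_cocone_iff by auto
  have r: "i \<in> J \<and> k \<in> J" if "(i, k) \<in> r" for i k
    using category.dom_obj[of "poset_cat J r" "(i, k)"] category.cod_obj[of "poset_cat J r" "(i, k)"] F that
    by (auto simp: is_functor_def)
  have D: "farr D (i, k) = (fobj D i, amap (farr D (i, k)), fobj D k)" if "(i, k) \<in> r" for i k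
    using poset_functorD(2)[OF F that] cat_cat_hom_triple by blast
  have cA: "category A" using coc by (simp add: poset_cocone_iff cat_cat_def)
  then interpret A: category A .
  have PA: "P \<subseteq> Obj A" unfolding P_def omap_def using l(2) by (auto simp: is_functor_def)
  have hB: "f \<in> hom B a b \<longleftrightarrow> f \<in> hom A a b \<and> a \<in> P \<and> b \<in> P" for f a b
    by (auto simp: B_def hom_def)
  have cB: "category B"
  proof
    show "f \<in> Arr B \<Longrightarrow> Dom B f \<in> Obj B" "f \<in> Arr B \<Longrightarrow> Cod B f \<in> Obj B" for f by (auto simp: B_def)
    show "a \<in> Obj B \<Longrightarrow> Id B a \<in> hom B a a" for a unfolding hB using PA A.id_hom by (auto simp: B_def)
    show "g \<cdot>\<^bsub>B\<^esub> f \<in> hom B a c" if "f \<in> hom B a b" "g \<in> hom B b c" for f g a b c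
      using that A.comp_hom unfolding hB by (simp add: B_def) blast
    show "Id B b \<cdot>\<^bsub>B\<^esub> f = f" "f \<cdot>\<^bsub>B\<^esub> Id B a = f" if "f \<in> hom B a b" for f a b
      using that A.id_left[of f a b] A.id_right[of f a b] unfolding hB by (simp_all add: B_def)
    show "h \<cdot>\<^bsub>B\<^esub> (g \<cdot>\<^bsub>B\<^esub> f) = (h \<cdot>\<^bsub>B\<^esub> g) \<cdot>\<^bsub>B\<^esub> f" if "f \<in> hom B a b" "g \<in> hom B b c" "h \<in> hom B c d"
      for f g h a b c d
      using that A.comp_assoc[of f a b g c h d] unfolding hB by (simp add: B_def)
  qed
  have FB: "is_functor (fobj D k) B (amap (l k))" if "k \<in> J" for k
  proof -
    have "category (fobj D k)" using l(2)[OF that] by (simp add: is_functor_def)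
    then have "Dom (fobj D k) f \<in> Obj (fobj D k) \<and> Cod (fobj D k) f \<in> Obj (fobj D k)"
      if "f \<in> Arr (fobj D k)" for f using that by (simp add: category.dom_obj category.cod_obj)
    moreover have "fobj (amap (l k)) y \<in> P" if "y \<in> Obj (fobj D k)" for y
      unfolding P_def omap_def using that \<open>k \<in> J\<close> by blast
    moreover have "Id B = Id A" "Comp B = Comp A" "Obj B = P" by (simp_all add: B_def)
    ultimately show ?thesis using l(2)[OF that] cB by (simp add: is_functor_def hB)
  qed
  then have 1: "m k \<in> hom cat_cat (fobj D k) B" if "k \<in> J" for k
    using l(3,4)[OF that] that unfolding hom_cat_cat m_def by simp
  have 2: "m k \<cdot>\<^bsub>cat_cat\<^esub> farr D (i, k) = m i" if "(i, k) \<in> r" for i k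
  proof -
    have "l k \<cdot>\<^bsub>cat_cat\<^esub> farr D (i, k) = l i" using coc that unfolding poset_cocone_iff by blast
    moreover have "l k \<in> hom cat_cat (fobj D k) A" using coc r[OF that] unfolding poset_cocone_iff by blast
    ultimately have "restr_fctr (fobj D i) (comp_fctr (amap (l k)) (amap (farr D (i, k)))) = amap (l i)"
      using amap_cat_comp[OF poset_functorD(2)[OF F that]] by metis
    then show ?thesis by (subst D[OF that]) (simp add: m_def)
  qed
  have "is_cocone (poset_cat J r) cat_cat D B m"
    using 1 2 cB unfolding poset_cocone_iff by (auto simp: cat_cat_def)
  from colimit_factor[OF col this]
  obtain h where h: "h \<in> hom cat_cat A B" "\<And>k. k \<in> J \<Longrightarrow> h \<cdot>\<^bsub>cat_cat\<^esub> l k = m k" unfolding poset_cat_simps by blast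
  obtain h' where h': "h = (A, h', B)" "is_functor A B h'" "fobj h' \<in> extensional (Obj A)"
      "farr h' \<in> extensional (Arr A)"
    using h(1) unfolding hom_cat_cat by blast
  have "(A, h', A) = Id cat_cat A"
  proof (rule colimit_endo_Id[OF col])
    \<comment> \<open>Hom-sets of \<open>B\<close> are hom-sets of \<open>A\<close>, so enlarging
      the codomain keeps \<open>h'\<close> a functor.\<close>
    have "is_functor A A h'"
      using h'(2) PA cA unfolding is_functor_def hB by (auto simp: B_def)
    then show "(A, h', A) \<in> hom cat_cat A A" using h'(3,4) unfolding hom_cat_cat by auto
    fix k assume "k \<in> Obj (poset_cat J r)"
    then have k: "k \<in> J" by simp
    have "l k \<in> hom cat_cat (fobj D k) A" using coc k unfolding poset_cocone_iff by blast
    from amap_cat_comp[OF this h(1)] have "restr_fctr (fobj D k) (comp_fctr h' (amap (l k))) = amap (l k)"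
      using h(2)[OF k] h'(1) by (simp add: m_def amap_def)
    then have "(A, h', A) \<cdot>\<^bsub>cat_cat\<^esub> (fobj D k, amap (l k), A) = (fobj D k, amap (l k), A)" by simp
    then show "(A, h', A) \<cdot>\<^bsub>cat_cat\<^esub> l k = l k" by (simp only: l(1)[OF k, symmetric])
  qed
  then have "fobj h' x = x" using x by (simp add: cat_cat_def restr_fctr_def)
  then have "x \<in> P" using is_functor_in_objD[OF h'(2) x] by (simp add: B_def)
  then show ?thesis unfolding P_def by blast
qed

text \<open>The argument for sets, applied to objects, with a preorder on two objects in place of
  the two-element set. Objects are all that is wanted, since blocks enter sentences only as
  objects.\<close>

lemma cat_directed_colimit_eq:
  assumes dir: "directed_poset J r" and col: "is_colimit (poset_cat J r) cat_cat D A l"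
    and i: "i \<in> J" and ab: "a \<in> Obj (fobj D i)" "b \<in> Obj (fobj D i)" and eq: "omap (l i) a = omap (l i) b"
  shows "\<exists>k. (i, k) \<in> r \<and> omap (farr D (i, k)) a = omap (farr D (i, k)) b"
proof (rule ccontr)
  assume ne: "\<not> ?thesis"
  have coc: "is_cocone (poset_cat J r) cat_cat D A l" and F: "is_functor (poset_cat J r) cat_cat D"
    using col by (auto simp: is_colimit_def)
  note FD = poset_functorD[OF F] and DP = directed_posetD[OF dir]
  have t: "omap (farr D (j, m)) z = omap (farr D (k, m)) (omap (farr D (j, k)) z)"
    if "(j, k) \<in> r" "(k, m) \<in> r" "z \<in> Obj (fobj D j)" for j k m z
    unfolding FD(4)[OF that(1,2)] using omap_comp[OF FD(2)[OF that(1)] FD(2)[OF that(2)] that(3)] .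
  have "omap (farr D (i, k)) a \<noteq> omap (farr D (i, k)) b" if "(i, k) \<in> r" for k using ne that by blast
  from directed_system_separation[OF dir, where A="\<lambda>j. Obj (fobj D j)" and t="\<lambda>p. omap (farr D p)", OF t i ab this]
  obtain q where q: "\<And>j k z. (j, k) \<in> r \<Longrightarrow> z \<in> Obj (fobj D j) \<Longrightarrow> q k (omap (farr D (j, k)) z) = q j z"
      "q i a" "\<not> q i b"
    by blast
  have ab': "a \<noteq> b" using q by blast
  have DF: "is_functor (fobj D j) (fobj D k) (amap (farr D (j, k)))" if "(j, k) \<in> r" for j k
    using FD(2)[OF that] cat_cat_hom_triple by blast
  have cat: "category (fobj D j)" if "j \<in> J" for j using FD(1)[OF that] by (simp add: cat_cat_def)
  define s where "s j u = (q j (Dom (fobj D j) u), q j (Cod (fobj D j) u))" for j u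
  have s: "s k (farr (amap (farr D (j, k))) u) = s j u \<and> farr (amap (farr D (j, k))) u \<in> Arr (fobj D k)"
    if "(j, k) \<in> r" "u \<in> Arr (fobj D j)" for j k u
  proof -
    have "farr (amap (farr D (j, k))) u \<in> hom (fobj D k) (omap (farr D (j, k)) (Dom (fobj D j) u))
        (omap (farr D (j, k)) (Cod (fobj D j) u))"
      using DF[OF that(1)] that(2) by (simp add: is_functor_def omap_def)
    moreover have "Dom (fobj D j) u \<in> Obj (fobj D j)" "Cod (fobj D j) u \<in> Obj (fobj D j)"
      using category.dom_obj[OF cat that(2)] category.cod_obj[OF cat that(2)] DP(1)[OF that(1)] by simp_all
    ultimately show ?thesis using q(1)[OF that(1)] by (simp add: s_def hom_def)
  qed
  \<comment> \<open>The separating category is a preorder on \<open>{a, b}\<close>. The arrow type may be too small for the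
    chaotic one, so it gets only the arrows required by the stages, each represented by an arrow of
    one late stage \<open>K\<close>.\<close>
  define R where "R = (\<Union>j\<in>J. s j ` Arr (fobj D j))"
  have "\<forall>p\<in>R. \<exists>j\<in>J. p \<in> s j ` Arr (fobj D j)" unfolding R_def by blast
  then obtain g where g: "\<And>p. p \<in> R \<Longrightarrow> g p \<in> J \<and> p \<in> s (g p) ` Arr (fobj D (g p))" by metis
  \<comment> \<open>Elements of \<open>R\<close> are pairs of truth values, at most four of them, so
    a single stage \<open>K\<close> can supply all representatives.\<close>
  have "finite (g ` R)" "g ` R \<subseteq> J" using g by auto
  from directed_poset_bound[OF dir this]
  obtain K where K: "K \<in> J" "\<And>p. p \<in> R \<Longrightarrow> (g p, K) \<in> r" by blast
  have "\<exists>u. s K u = p" if p: "p \<in> R" for p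
  proof -
    obtain u where "u \<in> Arr (fobj D (g p))" "s (g p) u = p" using g[OF p] by auto
    then have "s K (farr (amap (farr D (g p, K))) u) = p" using s[OF K(2)[OF p]] by simp
    then show ?thesis ..
  qed
  \<comment> \<open>Since \<open>s K\<close> recovers \<open>p\<close>, the map \<open>e\<close> is
    injective on \<open>R\<close>: the chosen arrows are distinct, and each determines its own
    endpoints.\<close>
  then obtain e where e: "\<And>p. p \<in> R \<Longrightarrow> s K (e p) = p" by metis
  define c where "c x = (if x then a else b)" for x
  have c: "c x = c y \<longleftrightarrow> x = y" for x y using ab' by (simp add: c_def)
  define B where "B = \<lparr>Obj = {a, b}, Arr = e ` R, Dom = (\<lambda>u. c (fst (s K u))), Cod = (\<lambda>u. c (snd (s K u))),
    Id = (\<lambda>x. e (x = a, x = a)), Comp = (\<lambda>v u. e (fst (s K u), snd (s K v)))\<rparr>"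
  have R_diag: "(x, x) \<in> R" for x
  proof -
    \<comment> \<open>Stage \<open>i\<close> has objects of either truth value, namely
      \<open>a\<close> and \<open>b\<close>; their identities yield both diagonal pairs.\<close>
    have "\<exists>z\<in>Obj (fobj D i). q i z = x" using q(2,3) ab by (cases x) auto
    then obtain z where z: "z \<in> Obj (fobj D i)" "q i z = x" by blast
    have "Id (fobj D i) z \<in> hom (fobj D i) z z" using category.id_hom[OF cat[OF i] z(1)] .
    then show ?thesis unfolding R_def s_def using i z(2) by (force simp: hom_def)
  qed
  \<comment> \<open>On a two-element set every reflexive relation is transitive.\<close>
  have R_trans: "(x, y) \<in> R \<Longrightarrow> (y, z) \<in> R \<Longrightarrow> (x, z) \<in> R" for x y z
    using R_diag by (cases x; cases y; cases z) auto
  have hB: "u \<in> hom B x y \<longleftrightarrow> (\<exists>x' y'. x = c x' \<and> y = c y' \<and> (x', y') \<in> R \<and> u = e (x', y'))" for u x y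
    by (auto simp: hom_def B_def e c)
  have c_obj: "x \<in> Obj B \<longleftrightarrow> (\<exists>x'. x = c x')" for x by (auto simp: B_def c_def)
  have B_Id: "Id B (c x) = e (x, x)" for x using ab' by (auto simp: B_def c_def)
  have B_comp: "e (y', z) \<cdot>\<^bsub>B\<^esub> e (x, y) = e (x, z)" if "(x, y) \<in> R" "(y', z) \<in> R" for x y y' z
    using that by (simp add: B_def e)
  have cB: "category B"
  proof
    show "Dom B f \<in> Obj B" "Cod B f \<in> Obj B" for f by (auto simp: B_def c_def)
    show "x \<in> Obj B \<Longrightarrow> Id B x \<in> hom B x x" for x unfolding c_obj hB using R_diag B_Id by auto
    show "v \<cdot>\<^bsub>B\<^esub> u \<in> hom B x z" if uv: "u \<in> hom B x y" "v \<in> hom B y z" for u v x y z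
    proof -
      from uv(1) obtain p1 p2 where 1: "x = c p1" "y = c p2" "(p1, p2) \<in> R" "u = e (p1, p2)"
        unfolding hB by blast
      from uv(2) obtain p2' p3 where 2: "y = c p2'" "z = c p3" "(p2', p3) \<in> R" "v = e (p2', p3)"
        unfolding hB by blast
      have "p2' = p2" using 1(2) 2(1) c by simp
      then show ?thesis using 1 2 B_comp[of p1 p2 p2 p3] R_trans[of p1 p2 p3] unfolding hB by auto
    qed
    show "Id B y \<cdot>\<^bsub>B\<^esub> u = u" "u \<cdot>\<^bsub>B\<^esub> Id B x = u" if u: "u \<in> hom B x y" for u x y
    proof -
      from u obtain p1 p2 where "x = c p1" "y = c p2" "(p1, p2) \<in> R" "u = e (p1, p2)"
        unfolding hB by blast
      then show "Id B y \<cdot>\<^bsub>B\<^esub> u = u" "u \<cdot>\<^bsub>B\<^esub> Id B x = u"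
        using B_comp[OF _ R_diag] B_comp[OF R_diag] B_Id by simp_all
    qed
    show "w \<cdot>\<^bsub>B\<^esub> (v \<cdot>\<^bsub>B\<^esub> u) = (w \<cdot>\<^bsub>B\<^esub> v) \<cdot>\<^bsub>B\<^esub> u" if "u \<in> hom B x y" "v \<in> hom B y z" "w \<in> hom B z z'"
      for u v w x y z z'
    proof -
      from that(1) obtain p1 p2 where 1: "y = c p2" "(p1, p2) \<in> R" "u = e (p1, p2)" unfolding hB by blast
      from that(2) obtain p2' p3 where 2: "y = c p2'" "z = c p3" "(p2', p3) \<in> R" "v = e (p2', p3)"
        unfolding hB by blast
      from that(3) obtain p3' p4 where 3: "z = c p3'" "(p3', p4) \<in> R" "w = e (p3', p4)" unfolding hB by blast
      have "p2' = p2" "p3' = p3" using 1(1) 2(1,2) 3(1) c by simp_all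
      then have *: "(p1, p2) \<in> R" "(p2, p3) \<in> R" "(p3, p4) \<in> R" "u = e (p1, p2)" "v = e (p2, p3)" "w = e (p3, p4)"
        using 1 2 3 by simp_all
      have "w \<cdot>\<^bsub>B\<^esub> e (p1, p3) = e (p2, p4) \<cdot>\<^bsub>B\<^esub> u"
        unfolding *(4,6) using B_comp R_trans *(1-3) by metis
      then show ?thesis using * B_comp by simp
    qed
  qed
  \<comment> \<open>\<open>restr_fctr\<close> makes both parts undefined outside the stage, as
    arrows of \<open>cat_cat\<close> must be.\<close>
  define m where "m k = (fobj D k, restr_fctr (fobj D k) \<lparr>fobj = \<lambda>z. c (q k z), farr = \<lambda>u. e (s k u)\<rparr>, B)" for k
  have mF: "is_functor (fobj D k) B \<lparr>fobj = \<lambda>z. c (q k z), farr = \<lambda>u. e (s k u)\<rparr>" if k: "k \<in> J" for k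
  proof -
    interpret K: category "fobj D k" using cat[OF k] .
    have sR: "s k u \<in> R" if "u \<in> Arr (fobj D k)" for u unfolding R_def using k that by blast
    have s_Id: "s k (Id (fobj D k) z) = (q k z, q k z)" if "z \<in> Obj (fobj D k)" for z
      using K.id_hom[OF that] by (simp add: s_def hom_def)
    have s_comp: "s k (v \<cdot>\<^bsub>fobj D k\<^esub> u) = (fst (s k u), snd (s k v))"
      if "u \<in> Arr (fobj D k)" "v \<in> Arr (fobj D k)" "Cod (fobj D k) u = Dom (fobj D k) v" for u v
      using K.comp_hom[of u "Dom (fobj D k) u" "Cod (fobj D k) u" v "Cod (fobj D k) v"] that
      by (simp add: s_def hom_def)
    have "e (s k u) \<in> hom B (c (q k (Dom (fobj D k) u))) (c (q k (Cod (fobj D k) u)))" if "u \<in> Arr (fobj D k)" for u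
      using sR[OF that] unfolding hB s_def by blast
    moreover have "e (s k (v \<cdot>\<^bsub>fobj D k\<^esub> u)) = e (s k v) \<cdot>\<^bsub>B\<^esub> e (s k u)"
      if "u \<in> Arr (fobj D k)" "v \<in> Arr (fobj D k)" "Cod (fobj D k) u = Dom (fobj D k) v" for u v
      using B_comp[of "fst (s k u)" "snd (s k u)" "fst (s k v)" "snd (s k v)"] sR that s_comp by simp
    ultimately show ?thesis unfolding is_functor_def using cB K.category_axioms s_Id
      by (auto simp: B_Id c_obj)
  qed
  have m1: "m k \<in> hom cat_cat (fobj D k) B" if "k \<in> J" for k
    unfolding m_def hom_cat_cat using is_functor_restr[OF mF[OF that]] by (simp add: restr_fctr_def)
  have "is_cocone (poset_cat J r) cat_cat D B m"
    unfolding poset_cocone_iff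
  proof (intro conjI ballI allI impI)
    show "B \<in> Obj cat_cat" using cB by (simp add: cat_cat_def)
    show "k \<in> J \<Longrightarrow> m k \<in> hom cat_cat (fobj D k) B" for k by (fact m1)
    show "m k \<cdot>\<^bsub>cat_cat\<^esub> farr D (j, k) = m j" if jk: "(j, k) \<in> r" for j k
    proof -
      have D: "farr D (j, k) = (fobj D j, amap (farr D (j, k)), fobj D k)"
        using FD(2)[OF jk] cat_cat_hom_triple by blast
      have "restr_fctr (fobj D j) (comp_fctr (restr_fctr (fobj D k) \<lparr>fobj = \<lambda>z. c (q k z), farr = \<lambda>u. e (s k u)\<rparr>)
          (amap (farr D (j, k)))) = restr_fctr (fobj D j) \<lparr>fobj = \<lambda>z. c (q j z), farr = \<lambda>u. e (s j u)\<rparr>"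
        using q(1)[OF jk] s[OF jk] is_functor_in_objD[OF DF[OF jk]]
        by (auto simp: restr_fctr_def comp_fctr_def omap_def fun_eq_iff)
      then show ?thesis by (subst D) (simp add: m_def)
    qed
  qed
  from colimit_factor[OF col this]
  obtain h where h: "h \<in> hom cat_cat A B" "\<And>k. k \<in> J \<Longrightarrow> h \<cdot>\<^bsub>cat_cat\<^esub> l k = m k" unfolding poset_cat_simps by blast
  have l: "l i \<in> hom cat_cat (fobj D i) A" using coc i unfolding poset_cocone_iff by blast
  have "omap (m i) z = omap h (omap (l i) z)" if "z \<in> Obj (fobj D i)" for z
    using omap_comp[OF l h(1) that] h(2)[OF i] by simp
  then have "omap (m i) a = omap (m i) b" using ab eq by simp
  then have "c (q i a) = c (q i b)" using ab by (simp add: m_def amap_def omap_def restr_fctr_def)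
  then show False using q by (simp add: c)
qed

section \<open>Directed colimits of signatures\<close>

abbreviation upset :: "'j set \<Rightarrow> 'j rel \<Rightarrow> 'j \<Rightarrow> 'j set" where
  "upset J r i \<equiv> {k \<in> J. (i, k) \<in> r}"

abbreviation uprel :: "'j set \<Rightarrow> 'j rel \<Rightarrow> 'j \<Rightarrow> 'j rel" where
  "uprel J r i \<equiv> {(k, m) \<in> r. (i, k) \<in> r}"

text \<open>Blocks and sentences get chosen at a stage \<open>i\<close> and have translates only
  above it, hence the passage to final segments.\<close>

lemma directed_poset_upset:
  assumes dir: "directed_poset J r" and i: "i \<in> J"
  shows "directed_poset (upset J r i) (uprel J r i)"
proof -
  note DP = directed_posetD[OF dir]
  have r: "antisym r" "trans r"
    using dir by (simp_all add: directed_poset_def partial_order_on_def preorder_on_def)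
  have "uprel J r i \<subseteq> upset J r i \<times> upset J r i"
    using DP(1,2) DP(4)[of i] by blast
  moreover have "refl_on (upset J r i) (uprel J r i)" using DP(3) by (simp add: refl_on_def)
  moreover have "trans (uprel J r i)" "antisym (uprel J r i)"
    using r unfolding trans_def antisym_def by blast+
  moreover have "i \<in> upset J r i" using DP(3) i by blast
  moreover have "\<exists>m\<in>upset J r i. (j, m) \<in> uprel J r i \<and> (k, m) \<in> uprel J r i"
    if "j \<in> upset J r i" "k \<in> upset J r i" for j k
    using DP(5)[of j k] DP(4)[of i j] that by blast
  ultimately show ?thesis
    unfolding directed_poset_def partial_order_on_def preorder_on_def by blast
qed

text \<open>Cofinality of the final segment: a cocone on it extends to every \<open>j\<close> by
  first moving to some stage \<open>\<kappa> j\<close> above both \<open>i\<close> and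
  \<open>j\<close>.\<close>

lemma colimit_upset:
  assumes dir: "directed_poset J r" and i: "i \<in> J" and col: "is_colimit (poset_cat J r) C D a l"
  shows "is_colimit (poset_cat (upset J r i) (uprel J r i)) C D a l"
proof -
  note DP = directed_posetD[OF dir]
  have F: "is_functor (poset_cat J r) C D" and coc: "is_cocone (poset_cat J r) C D a l"
    using col by (auto simp: is_colimit_def)
  note FD = poset_functorD[OF F]
  interpret C: category C using F by (simp add: is_functor_def)
  have l: "l k \<in> hom C (fobj D k) a" if "k \<in> J" for k using coc that by (simp add: poset_cocone_iff)
  have lD: "l k \<cdot>\<^bsub>C\<^esub> farr D (j, k) = l j" if "(j, k) \<in> r" for j k using coc that by (simp add: poset_cocone_iff)
  have "\<forall>j\<in>J. \<exists>k. (i, k) \<in> r \<and> (j, k) \<in> r" using DP(5) i by blast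
  then obtain \<kappa> where \<kappa>: "\<And>j. j \<in> J \<Longrightarrow> (i, \<kappa> j) \<in> r" "\<And>j. j \<in> J \<Longrightarrow> (j, \<kappa> j) \<in> r" by metis
  show ?thesis
  proof (rule is_colimitI)
    have "category (poset_cat (upset J r i) (uprel J r i))"
      using category_poset_cat directed_poset_upset[OF dir i] by (auto simp: directed_poset_def)
    then show "is_functor (poset_cat (upset J r i) (uprel J r i)) C D"
      using F unfolding is_functor_def by (auto intro: FD(4))
    show "is_cocone (poset_cat (upset J r i) (uprel J r i)) C D a l"
      using coc unfolding poset_cocone_iff by auto
  next
    fix b m
    assume "is_cocone (poset_cat (upset J r i) (uprel J r i)) C D b m"
    then have b: "b \<in> Obj C" and m: "\<And>k. (i, k) \<in> r \<Longrightarrow> m k \<in> hom C (fobj D k) b"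
      and mD: "\<And>j k. (i, j) \<in> r \<Longrightarrow> (j, k) \<in> r \<Longrightarrow> m k \<cdot>\<^bsub>C\<^esub> farr D (j, k) = m j"
      unfolding poset_cocone_iff using DP(2) by auto
    define n where "n j = m (\<kappa> j) \<cdot>\<^bsub>C\<^esub> farr D (j, \<kappa> j)" for j
    have step: "m p \<cdot>\<^bsub>C\<^esub> farr D (j, p) = m q \<cdot>\<^bsub>C\<^esub> farr D (j, q)"
      if "(i, p) \<in> r" "(j, p) \<in> r" "(p, q) \<in> r" for j p q
      using C.comp_assoc[OF FD(2)[OF that(2)] FD(2)[OF that(3)] m] mD[OF that(1,3)] FD(4)[OF that(2,3)]
        DP(4)[OF that(1,3)] by simp
    \<comment> \<open>The extension does not depend on the chosen upper bound: two choices are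
      compared at a stage above both.\<close>
    have n: "n j = m p \<cdot>\<^bsub>C\<^esub> farr D (j, p)" if p: "(i, p) \<in> r" "(j, p) \<in> r" for j p
    proof -
      have j: "j \<in> J" using p DP(1) by blast
      obtain q where "(p, q) \<in> r" "(\<kappa> j, q) \<in> r" using DP(2,5) p(1) \<kappa>(1)[OF j] by metis
      then show ?thesis unfolding n_def using step[OF p] step[OF \<kappa>(1)[OF j] \<kappa>(2)[OF j]] by metis
    qed
    have n_up: "n j = m j" if "(i, j) \<in> r" for j
      using n[OF that DP(3)[OF DP(2)[OF that]]] FD(3)[OF DP(2)[OF that]] C.id_right[OF m[OF that]] by simp
    have "is_cocone (poset_cat J r) C D b n"
      unfolding poset_cocone_iff
    proof (intro conjI ballI allI impI)
      show "b \<in> Obj C" by fact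
      show "n k \<in> hom C (fobj D k) b" if "k \<in> J" for k
        unfolding n_def using C.comp_hom[OF FD(2)[OF \<kappa>(2)[OF that]] m[OF \<kappa>(1)[OF that]]] .
      show "n k \<cdot>\<^bsub>C\<^esub> farr D (j, k) = n j" if jk: "(j, k) \<in> r" for j k
      proof -
        have k: "k \<in> J" using jk DP(2) by blast
        note \<kappa>k = \<kappa>(1)[OF k] \<kappa>(2)[OF k]
        have "n j = m (\<kappa> k) \<cdot>\<^bsub>C\<^esub> farr D (j, \<kappa> k)" using n[OF \<kappa>k(1) DP(4)[OF jk \<kappa>k(2)]] .
        then show ?thesis
          unfolding n_def[of k] FD(4)[OF jk \<kappa>k(2)] using C.comp_assoc[OF FD(2)[OF jk] FD(2)[OF \<kappa>k(2)] m[OF \<kappa>k(1)]] by simp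
      qed
    qed
    from colimit_factor[OF col this] obtain h where "h \<in> hom C a b" "\<And>k. k \<in> J \<Longrightarrow> h \<cdot>\<^bsub>C\<^esub> l k = n k"
      unfolding poset_cat_simps by blast
    then show "\<exists>h. h \<in> hom C a b \<and> (\<forall>k\<in>Obj (poset_cat (upset J r i) (uprel J r i)). h \<cdot>\<^bsub>C\<^esub> l k = m k)"
      using n_up by auto
  next
    fix b h h'
    assume h: "h \<in> hom C a b" "h' \<in> hom C a b"
      and eq: "\<And>k. k \<in> Obj (poset_cat (upset J r i) (uprel J r i)) \<Longrightarrow> h \<cdot>\<^bsub>C\<^esub> l k = h' \<cdot>\<^bsub>C\<^esub> l k"
    show "h = h'"
    proof (rule colimit_joint_epi[OF col h])
      fix j assume "j \<in> Obj (poset_cat J r)"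
      then have j: "j \<in> J" by simp
      note \<kappa>j = \<kappa>(1)[OF j] \<kappa>(2)[OF j]
      have "h \<cdot>\<^bsub>C\<^esub> l (\<kappa> j) = h' \<cdot>\<^bsub>C\<^esub> l (\<kappa> j)" using eq \<kappa>j DP(2) by simp
      then show "h \<cdot>\<^bsub>C\<^esub> l j = h' \<cdot>\<^bsub>C\<^esub> l j"
        using C.comp_assoc[OF FD(2)[OF \<kappa>j(2)] l[OF DP(2)[OF \<kappa>j(1)]] h(1)]
          C.comp_assoc[OF FD(2)[OF \<kappa>j(2)] l[OF DP(2)[OF \<kappa>j(1)]] h(2)] lD[OF \<kappa>j(2)] by simp
    qed
  qed
qed

text \<open>Stage \<open>k\<close> is extended by the translate of the block \<open>X\<close> of
  stage \<open>i\<close>. The functions are total, but they form a diagram only on the final segment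
  above \<open>i\<close>.\<close>

definition ext_diagram ::
  "('sig, 'mor, 'm, 'h, 's, 'x, 'y) inst \<Rightarrow> ('j, 'j \<times> 'j, 'sig, 'mor) fctr \<Rightarrow> 'j \<Rightarrow> 'x \<Rightarrow>
    ('j, 'j \<times> 'j, 'sig, 'mor) fctr" where
  "ext_diagram I D i X = \<lparr>fobj = \<lambda>k. Ext I (fobj D k) (Blk_obj I (farr D (i, k)) X),
     farr = \<lambda>u. Ext_mor I (farr D u) (Blk_obj I (farr D (i, fst u)) X)\<rparr>"

section \<open>Blocks, pushout squares and diagrams of extended signatures\<close>

context delta_institution
begin

interpretation S: category "Sig I" by (rule sig_category)

lemma farr_Blk_hom: "h \<in> hom (Sig I) S S' \<Longrightarrow> farr (Blk_fctr I) h \<in> hom cat_cat (Blk I S) (Blk I S')"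
  using blk_functor by (auto simp: is_functor_def hom_def Blk_fctr_def)

lemma omap_Blk: "h \<in> hom (Sig I) S S' \<Longrightarrow> X \<in> Obj (Blk I S) \<Longrightarrow> omap (farr (Blk_fctr I) h) X = Blk_obj I h X"
  by (simp add: omap_def amap_def Blk_fctr_def restr_fctr_def hom_def)

lemma Blk_obj_in:
  assumes "h \<in> hom (Sig I) S S'" "X \<in> Obj (Blk I S)"
  shows "Blk_obj I h X \<in> Obj (Blk I S')"
  using is_functor_in_objD[of "Blk I S" "Blk I S'" "amap (farr (Blk_fctr I) h)" X]
    cat_cat_hom_triple[OF farr_Blk_hom[OF assms(1)]] omap_Blk[OF assms] assms(2)
  by (simp add: omap_def)

lemma Blk_obj_id:
  assumes "S \<in> Obj (Sig I)" "X \<in> Obj (Blk I S)"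
  shows "Blk_obj I (Id (Sig I) S) X = X"
proof -
  have "farr (Blk_fctr I) (Id (Sig I) S) = Id cat_cat (Blk I S)"
    using blk_functor assms(1) by (simp add: is_functor_def Blk_fctr_def)
  then show ?thesis
    using omap_Blk[OF S.id_hom[OF assms(1)] assms(2)] assms(2)
    by (simp add: omap_def amap_def cat_cat_def restr_fctr_def)
qed

lemma Blk_obj_comp:
  assumes "f \<in> hom (Sig I) a b" "g \<in> hom (Sig I) b c" "X \<in> Obj (Blk I a)"
  shows "Blk_obj I (g \<cdot>\<^bsub>Sig I\<^esub> f) X = Blk_obj I g (Blk_obj I f X)"
proof -
  have "farr (Blk_fctr I) (g \<cdot>\<^bsub>Sig I\<^esub> f) = farr (Blk_fctr I) g \<cdot>\<^bsub>cat_cat\<^esub> farr (Blk_fctr I) f"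
    using blk_functor assms(1,2) by (simp add: is_functor_def hom_def)
  then show ?thesis
    using omap_comp[OF farr_Blk_hom[OF assms(1)] farr_Blk_hom[OF assms(2)] assms(3)]
      omap_Blk[OF S.comp_hom[OF assms(1,2)] assms(3)] omap_Blk[OF assms(1,3)]
      omap_Blk[OF assms(2) Blk_obj_in[OF assms(1,3)]] by simp
qed

lemma amap_Sen: "h \<in> hom (Sig I) S S' \<Longrightarrow> \<gamma> \<in> Sen I S \<Longrightarrow> amap (farr (Sen_fctr I) h) \<gamma> = Sen_map I h \<gamma>"
  by (simp add: amap_def Sen_fctr_def hom_def)

lemma amap_Sub: "h \<in> hom (Sig I) S S' \<Longrightarrow> x \<in> Sub I S \<Longrightarrow> amap (farr (Sub_fctr I) h) x = Sub_map I h x"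
  by (simp add: amap_def Sub_fctr_def hom_def)

lemma Ext_obj: "S \<in> Obj (Sig I) \<Longrightarrow> X \<in> Obj (Blk I S) \<Longrightarrow> Ext I S X \<in> Obj (Sig I)"
  using incl_hom S.cod_obj by (fastforce simp: hom_def)

lemma hom_obj: "h \<in> hom (Sig I) S S' \<Longrightarrow> S \<in> Obj (Sig I)" "h \<in> hom (Sig I) S S' \<Longrightarrow> S' \<in> Obj (Sig I)"
  using S.dom_obj S.cod_obj by (auto simp: hom_def)

lemma ext_mor_factor:
  assumes h: "h \<in> hom (Sig I) S S'" and X: "X \<in> Obj (Blk I S)"
    and p: "p \<in> hom (Sig I) (Ext I S X) T" and q: "q \<in> hom (Sig I) S' T"
    and eq: "p \<cdot>\<^bsub>Sig I\<^esub> Incl I S X = q \<cdot>\<^bsub>Sig I\<^esub> h"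
  shows "\<exists>!w. w \<in> hom (Sig I) (Ext I S' (Blk_obj I h X)) T \<and>
    w \<cdot>\<^bsub>Sig I\<^esub> Ext_mor I h X = p \<and> w \<cdot>\<^bsub>Sig I\<^esub> Incl I S' (Blk_obj I h X) = q"
proof -
  have "Cod (Sig I) (Incl I S X) = Ext I S X" "Cod (Sig I) h = S'"
    "Cod (Sig I) (Ext_mor I h X) = Ext I S' (Blk_obj I h X)"
    using incl_hom[OF hom_obj(1)[OF h] X] h ext_mor_hom[OF h X] by (simp_all add: hom_def)
  then show ?thesis using ext_pushout[OF h X] p q eq unfolding is_pushout_def by metis
qed

text \<open>Both arrows mediate the same cocone on the pushout square. Equality of arrows out of an
  extended signature is thereby split into a block part and a base part.\<close>

lemma ext_mor_joint_epi:
  assumes h: "h \<in> hom (Sig I) S S'" and X: "X \<in> Obj (Blk I S)"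
    and u: "u \<in> hom (Sig I) (Ext I S' (Blk_obj I h X)) T" and v: "v \<in> hom (Sig I) (Ext I S' (Blk_obj I h X)) T"
    and eq: "u \<cdot>\<^bsub>Sig I\<^esub> Ext_mor I h X = v \<cdot>\<^bsub>Sig I\<^esub> Ext_mor I h X"
      "u \<cdot>\<^bsub>Sig I\<^esub> Incl I S' (Blk_obj I h X) = v \<cdot>\<^bsub>Sig I\<^esub> Incl I S' (Blk_obj I h X)"
  shows "u = v"
proof -
  note e = ext_mor_hom[OF h X] and i = incl_hom[OF hom_obj(1)[OF h] X]
    and i' = incl_hom[OF hom_obj(2)[OF h] Blk_obj_in[OF h X]]
  have "u \<cdot>\<^bsub>Sig I\<^esub> Ext_mor I h X \<cdot>\<^bsub>Sig I\<^esub> Incl I S X = u \<cdot>\<^bsub>Sig I\<^esub> Incl I S' (Blk_obj I h X) \<cdot>\<^bsub>Sig I\<^esub> h"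
    using S.comp_assoc[OF i e u] S.comp_assoc[OF h i' u] ext_mor_incl[OF h X] by simp
  from ext_mor_factor[OF h X S.comp_hom[OF e u] S.comp_hom[OF i' u] this] show ?thesis
    using u v eq by metis
qed

definition dcolim :: "'j set \<Rightarrow> 'j rel \<Rightarrow> ('j, 'j \<times> 'j, 'sig, 'mor) fctr \<Rightarrow> 'sig \<Rightarrow> ('j \<Rightarrow> 'mor) \<Rightarrow> bool" where
  "dcolim J r D S l \<longleftrightarrow> directed_poset J r \<and> is_colimit (poset_cat J r) (Sig I) D S l"

lemma dcolimD:
  assumes "dcolim J r D S l"
  shows "directed_poset J r" "S \<in> Obj (Sig I)"
    and "i \<in> J \<Longrightarrow> fobj D i \<in> Obj (Sig I)"
    and "(i, k) \<in> r \<Longrightarrow> farr D (i, k) \<in> hom (Sig I) (fobj D i) (fobj D k)"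
    and "i \<in> J \<Longrightarrow> farr D (i, i) = Id (Sig I) (fobj D i)"
    and "(i, k) \<in> r \<Longrightarrow> (k, m) \<in> r \<Longrightarrow> farr D (i, m) = farr D (k, m) \<cdot>\<^bsub>Sig I\<^esub> farr D (i, k)"
    and "i \<in> J \<Longrightarrow> l i \<in> hom (Sig I) (fobj D i) S"
    and "(i, k) \<in> r \<Longrightarrow> l k \<cdot>\<^bsub>Sig I\<^esub> farr D (i, k) = l i"
proof -
  have F: "is_functor (poset_cat J r) (Sig I) D" and coc: "is_cocone (poset_cat J r) (Sig I) D S l"
    and dir: "directed_poset J r"
    using assms by (auto simp: is_colimit_def dcolim_def)
  show "directed_poset J r" by fact
  show "i \<in> J \<Longrightarrow> fobj D i \<in> Obj (Sig I)"
    "(i, k) \<in> r \<Longrightarrow> farr D (i, k) \<in> hom (Sig I) (fobj D i) (fobj D k)"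
    "i \<in> J \<Longrightarrow> farr D (i, i) = Id (Sig I) (fobj D i)"
    "(i, k) \<in> r \<Longrightarrow> (k, m) \<in> r \<Longrightarrow> farr D (i, m) = farr D (k, m) \<cdot>\<^bsub>Sig I\<^esub> farr D (i, k)"
    by (fact poset_functorD[OF F])+
  show "S \<in> Obj (Sig I)" "i \<in> J \<Longrightarrow> l i \<in> hom (Sig I) (fobj D i) S"
    "(i, k) \<in> r \<Longrightarrow> l k \<cdot>\<^bsub>Sig I\<^esub> farr D (i, k) = l i"
    using coc unfolding poset_cocone_iff by auto
qed

lemma dcolim_upset: "dcolim J r D S l \<Longrightarrow> i \<in> J \<Longrightarrow> dcolim (upset J r i) (uprel J r i) D S l"
  unfolding dcolim_def using colimit_upset[of J r i "Sig I" D S l] directed_poset_upset[of J r i] by blast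

lemma dcolim_blk:
  assumes dc: "dcolim J r D S l" and i: "i \<in> J" and X: "X \<in> Obj (Blk I (fobj D i))"
  shows "(i, k) \<in> r \<Longrightarrow> Blk_obj I (farr D (i, k)) X \<in> Obj (Blk I (fobj D k))"
    and "(i, k) \<in> r \<Longrightarrow> (k, m) \<in> r \<Longrightarrow>
      Blk_obj I (farr D (k, m)) (Blk_obj I (farr D (i, k)) X) = Blk_obj I (farr D (i, m)) X"
    and "(i, k) \<in> r \<Longrightarrow> Blk_obj I (l k) (Blk_obj I (farr D (i, k)) X) = Blk_obj I (l i) X"
    and "Blk_obj I (farr D (i, i)) X = X"
proof -
  note d = dcolimD[OF dc] and DP = directed_posetD[OF dcolimD(1)[OF dc]]
  show "(i, k) \<in> r \<Longrightarrow> Blk_obj I (farr D (i, k)) X \<in> Obj (Blk I (fobj D k))"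
    using Blk_obj_in[OF d(4) X] .
  show "Blk_obj I (farr D (k, m)) (Blk_obj I (farr D (i, k)) X) = Blk_obj I (farr D (i, m)) X"
    if "(i, k) \<in> r" "(k, m) \<in> r"
    using Blk_obj_comp[OF d(4) d(4) X] that d(6)[OF that] by simp
  show "Blk_obj I (l k) (Blk_obj I (farr D (i, k)) X) = Blk_obj I (l i) X" if "(i, k) \<in> r"
    using Blk_obj_comp[OF d(4) d(7) X, of k] that d(8)[OF that] DP(2)[OF that] by simp
  show "Blk_obj I (farr D (i, i)) X = X" using d(3,5)[OF i] Blk_obj_id X by simp
qed

text \<open>A cocone on the extended diagram restricts along the inclusions to a cocone on
  \<open>D\<close>, which the colimit \<open>S\<close> turns into an arrow \<open>g\<close>. The
  pushout square over \<open>l i\<close> glues \<open>g\<close> to the leg at \<open>i\<close>, and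
  the result is the mediating arrow. One square is enough, because the signatures at the other
  stages are pushouts of the one at \<open>i\<close>.\<close>

lemma dcolim_ext:
  assumes dc: "dcolim J r D S l" and i: "i \<in> J" and X: "X \<in> Obj (Blk I (fobj D i))"
  shows "dcolim (upset J r i) (uprel J r i) (ext_diagram I D i X) (Ext I S (Blk_obj I (l i) X))
    (\<lambda>k. Ext_mor I (l k) (Blk_obj I (farr D (i, k)) X))"
proof -
  note d = dcolimD[OF dc] and DP = directed_posetD[OF dcolimD(1)[OF dc]] and b = dcolim_blk[OF dc i X]
  let ?K = "poset_cat (upset J r i) (uprel J r i)"
  let ?X = "\<lambda>k. Blk_obj I (farr D (i, k)) X"
  let ?e = "\<lambda>k. Ext_mor I (l k) (?X k)"
  have dcu: "is_colimit ?K (Sig I) D S l" using dcolim_upset[OF dc i] by (simp add: dcolim_def)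
  have e: "?e k \<in> hom (Sig I) (Ext I (fobj D k) (?X k)) (Ext I S (Blk_obj I (l i) X))" if "(i, k) \<in> r" for k
    using ext_mor_hom[OF d(7)[OF DP(2)[OF that]] b(1)[OF that]] b(3)[OF that] by simp
  have ij: "Ext_mor I (farr D (j, k)) (?X j) \<in> hom (Sig I) (Ext I (fobj D j) (?X j)) (Ext I (fobj D k) (?X k))"
    if "(i, j) \<in> r" "(j, k) \<in> r" for j k
    using ext_mor_hom[OF d(4)[OF that(2)] b(1)[OF that(1)]] b(2)[OF that] by simp
  have eij: "?e k \<cdot>\<^bsub>Sig I\<^esub> Ext_mor I (farr D (j, k)) (?X j) = ?e j" if "(i, j) \<in> r" "(j, k) \<in> r" for j k
    using ext_mor_comp[OF d(4) d(7) b(1), of j k] that b(2)[OF that] d(8)[OF that(2)] DP(2)[OF that(2)] by simp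
  have inc: "Incl I (fobj D k) (?X k) \<in> hom (Sig I) (fobj D k) (Ext I (fobj D k) (?X k))" if "(i, k) \<in> r" for k
    using incl_hom[OF d(3)[OF DP(2)] b(1)] that by blast
  have Y: "Blk_obj I (l i) X \<in> Obj (Blk I S)" using Blk_obj_in[OF d(7) X] i by blast
  have incS: "Incl I S (Blk_obj I (l i) X) \<in> hom (Sig I) S (Ext I S (Blk_obj I (l i) X))"
    using incl_hom[OF d(2) Y] .
  have e_inc: "?e k \<cdot>\<^bsub>Sig I\<^esub> Incl I (fobj D k) (?X k) = Incl I S (Blk_obj I (l i) X) \<cdot>\<^bsub>Sig I\<^esub> l k"
    if "(i, k) \<in> r" for k
    using ext_mor_incl[OF d(7)[OF DP(2)[OF that]] b(1)[OF that]] b(3)[OF that] by simp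
  have ij_inc: "Ext_mor I (farr D (j, k)) (?X j) \<cdot>\<^bsub>Sig I\<^esub> Incl I (fobj D j) (?X j) =
      Incl I (fobj D k) (?X k) \<cdot>\<^bsub>Sig I\<^esub> farr D (j, k)" if "(i, j) \<in> r" "(j, k) \<in> r" for j k
    using ext_mor_incl[OF d(4)[OF that(2)] b(1)[OF that(1)]] b(2)[OF that] by simp
  have ii: "(i, i) \<in> r" using DP(3) i by blast
  have "is_colimit ?K (Sig I) (ext_diagram I D i X) (Ext I S (Blk_obj I (l i) X)) ?e"
  proof (rule is_colimitI)
    have catK: "category ?K"
      using category_poset_cat directed_poset_upset[OF d(1) i] by (auto simp: directed_poset_def)
    have id: "Ext_mor I (farr D (j, j)) (?X j) = Id (Sig I) (Ext I (fobj D j) (?X j))" if "(i, j) \<in> r" for j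
      using ext_mor_id[OF d(3) b(1)[OF that]] d(5) DP(2)[OF that] by simp
    have comp: "Ext_mor I (farr D (j, n)) (?X j) =
        Ext_mor I (farr D (k, n)) (?X k) \<cdot>\<^bsub>Sig I\<^esub> Ext_mor I (farr D (j, k)) (?X j)"
      if "(i, j) \<in> r" "(j, k) \<in> r" "(k, n) \<in> r" for j k n
      using ext_mor_comp[OF d(4)[OF that(2)] d(4)[OF that(3)] b(1)[OF that(1)]] b(2)[OF that(1,2)] d(6)[OF that(2,3)]
      by simp
    have obj: "Ext I (fobj D k) (?X k) \<in> Obj (Sig I)" if "(i, k) \<in> r" for k
      using Ext_obj[OF d(3)[OF DP(2)[OF that]] b(1)[OF that]] .
    show "is_functor ?K (Sig I) (ext_diagram I D i X)"
      using sig_category catK unfolding is_functor_def ext_diagram_def by (auto intro: ij id comp obj)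
    show "is_cocone ?K (Sig I) (ext_diagram I D i X) (Ext I S (Blk_obj I (l i) X)) ?e"
      unfolding poset_cocone_iff ext_diagram_def using e eij Ext_obj[OF d(2) Y] by auto
  next
    fix T m
    assume "is_cocone ?K (Sig I) (ext_diagram I D i X) T m"
    then have T: "T \<in> Obj (Sig I)" and m: "\<And>k. (i, k) \<in> r \<Longrightarrow> m k \<in> hom (Sig I) (Ext I (fobj D k) (?X k)) T"
      and mm: "\<And>j k. (i, j) \<in> r \<Longrightarrow> (j, k) \<in> r \<Longrightarrow> m k \<cdot>\<^bsub>Sig I\<^esub> Ext_mor I (farr D (j, k)) (?X j) = m j"
      unfolding poset_cocone_iff ext_diagram_def using DP(2) by auto
    define n where "n k = m k \<cdot>\<^bsub>Sig I\<^esub> Incl I (fobj D k) (?X k)" for k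
    have n: "n k \<in> hom (Sig I) (fobj D k) T" if "(i, k) \<in> r" for k
      unfolding n_def using S.comp_hom[OF inc[OF that] m[OF that]] .
    have "n k \<cdot>\<^bsub>Sig I\<^esub> farr D (j, k) = n j" if "(i, j) \<in> r" "(j, k) \<in> r" for j k
    proof -
      have ik: "(i, k) \<in> r" using DP(4)[OF that] .
      have "n k \<cdot>\<^bsub>Sig I\<^esub> farr D (j, k) = m k \<cdot>\<^bsub>Sig I\<^esub> (Incl I (fobj D k) (?X k) \<cdot>\<^bsub>Sig I\<^esub> farr D (j, k))"
        unfolding n_def using S.comp_assoc[OF d(4)[OF that(2)] inc[OF ik] m[OF ik]] by simp
      also have "\<dots> = m k \<cdot>\<^bsub>Sig I\<^esub> Ext_mor I (farr D (j, k)) (?X j) \<cdot>\<^bsub>Sig I\<^esub> Incl I (fobj D j) (?X j)"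
        using ij_inc[OF that] S.comp_assoc[OF inc[OF that(1)] ij[OF that] m[OF ik]] by simp
      finally show ?thesis using mm[OF that] by (simp add: n_def)
    qed
    then have "is_cocone ?K (Sig I) D T n" unfolding poset_cocone_iff using T n by auto
    from colimit_factor[OF dcu this] obtain g where g: "g \<in> hom (Sig I) S T"
      "\<And>k. (i, k) \<in> r \<Longrightarrow> g \<cdot>\<^bsub>Sig I\<^esub> l k = n k" using DP(2) unfolding poset_cat_simps by blast
    have "m i \<cdot>\<^bsub>Sig I\<^esub> Incl I (fobj D i) X = g \<cdot>\<^bsub>Sig I\<^esub> l i" using g(2)[OF ii] b(4) by (simp add: n_def)
    from ext_mor_factor[OF d(7)[OF i] X _ g(1) this]
    obtain h where h: "h \<in> hom (Sig I) (Ext I S (Blk_obj I (l i) X)) T"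
      "h \<cdot>\<^bsub>Sig I\<^esub> Ext_mor I (l i) X = m i" "h \<cdot>\<^bsub>Sig I\<^esub> Incl I S (Blk_obj I (l i) X) = g"
      using m[OF ii] b(4) by auto
    have "h \<cdot>\<^bsub>Sig I\<^esub> ?e k = m k" if ik: "(i, k) \<in> r" for k
    \<comment> \<open>By the pushout square over \<open>farr D (i, k)\<close> it suffices to compare
      on the block part, where both sides give \<open>m i\<close>, and on the base part, where both
      are \<open>g\<close> after \<open>l k\<close>.\<close>
    proof (rule ext_mor_joint_epi[OF d(4)[OF ik] X])
      show "h \<cdot>\<^bsub>Sig I\<^esub> ?e k \<in> hom (Sig I) (Ext I (fobj D k) (?X k)) T"
        using S.comp_hom[OF e[OF ik] h(1)] .
      show "m k \<in> hom (Sig I) (Ext I (fobj D k) (?X k)) T" using m[OF ik] .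
      have "h \<cdot>\<^bsub>Sig I\<^esub> ?e k \<cdot>\<^bsub>Sig I\<^esub> Ext_mor I (farr D (i, k)) X = m i"
        using S.comp_assoc[OF ij[OF ii ik] e[OF ik] h(1)] eij[OF ii ik] b(4) h(2) by simp
      then show "h \<cdot>\<^bsub>Sig I\<^esub> ?e k \<cdot>\<^bsub>Sig I\<^esub> Ext_mor I (farr D (i, k)) X = m k \<cdot>\<^bsub>Sig I\<^esub> Ext_mor I (farr D (i, k)) X"
        using mm[OF ii ik] b(4) by simp
      have "h \<cdot>\<^bsub>Sig I\<^esub> ?e k \<cdot>\<^bsub>Sig I\<^esub> Incl I (fobj D k) (?X k) =
          h \<cdot>\<^bsub>Sig I\<^esub> (Incl I S (Blk_obj I (l i) X) \<cdot>\<^bsub>Sig I\<^esub> l k)"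
        using S.comp_assoc[OF inc[OF ik] e[OF ik] h(1)] e_inc[OF ik] by simp
      also have "\<dots> = g \<cdot>\<^bsub>Sig I\<^esub> l k"
        using S.comp_assoc[OF d(7)[OF DP(2)[OF ik]] incS h(1)] h(3) by simp
      also have "\<dots> = m k \<cdot>\<^bsub>Sig I\<^esub> Incl I (fobj D k) (?X k)" using g(2)[OF ik] by (simp add: n_def)
      finally show "h \<cdot>\<^bsub>Sig I\<^esub> ?e k \<cdot>\<^bsub>Sig I\<^esub> Incl I (fobj D k) (?X k) = m k \<cdot>\<^bsub>Sig I\<^esub> Incl I (fobj D k) (?X k)" .
    qed
    then show "\<exists>h. h \<in> hom (Sig I) (Ext I S (Blk_obj I (l i) X)) T \<and> (\<forall>k\<in>Obj ?K. h \<cdot>\<^bsub>Sig I\<^esub> ?e k = m k)"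
      using h(1) by auto
  next
    fix T h h'
    assume h: "h \<in> hom (Sig I) (Ext I S (Blk_obj I (l i) X)) T" "h' \<in> hom (Sig I) (Ext I S (Blk_obj I (l i) X)) T"
      and "\<And>k. k \<in> Obj ?K \<Longrightarrow> h \<cdot>\<^bsub>Sig I\<^esub> ?e k = h' \<cdot>\<^bsub>Sig I\<^esub> ?e k"
    then have eq: "\<And>k. (i, k) \<in> r \<Longrightarrow> h \<cdot>\<^bsub>Sig I\<^esub> ?e k = h' \<cdot>\<^bsub>Sig I\<^esub> ?e k" using DP(2) by simp
    show "h = h'"
    \<comment> \<open>The block part is fixed by the leg at \<open>i\<close>, the base part by the
      colimit property of \<open>S\<close>.\<close>
    proof (rule ext_mor_joint_epi[OF d(7)[OF i] X h])
      show "h \<cdot>\<^bsub>Sig I\<^esub> Ext_mor I (l i) X = h' \<cdot>\<^bsub>Sig I\<^esub> Ext_mor I (l i) X" using eq[OF ii] b(4) by simp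
      show "h \<cdot>\<^bsub>Sig I\<^esub> Incl I S (Blk_obj I (l i) X) = h' \<cdot>\<^bsub>Sig I\<^esub> Incl I S (Blk_obj I (l i) X)"
      proof (rule colimit_joint_epi[OF dcu S.comp_hom[OF incS h(1)] S.comp_hom[OF incS h(2)]])
        fix k assume "k \<in> Obj ?K"
        then have k: "(i, k) \<in> r" "k \<in> J" by auto
        have "w \<cdot>\<^bsub>Sig I\<^esub> Incl I S (Blk_obj I (l i) X) \<cdot>\<^bsub>Sig I\<^esub> l k = w \<cdot>\<^bsub>Sig I\<^esub> ?e k \<cdot>\<^bsub>Sig I\<^esub> Incl I (fobj D k) (?X k)"
          if "w \<in> hom (Sig I) (Ext I S (Blk_obj I (l i) X)) T" for w
          using S.comp_assoc[OF d(7)[OF k(2)] incS that] S.comp_assoc[OF inc[OF k(1)] e[OF k(1)] that] e_inc[OF k(1)]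
          by simp
        then show "h \<cdot>\<^bsub>Sig I\<^esub> Incl I S (Blk_obj I (l i) X) \<cdot>\<^bsub>Sig I\<^esub> l k =
            h' \<cdot>\<^bsub>Sig I\<^esub> Incl I S (Blk_obj I (l i) X) \<cdot>\<^bsub>Sig I\<^esub> l k"
          using h eq[OF k(1)] by simp
      qed
    qed
  qed
  then show ?thesis unfolding dcolim_def using directed_poset_upset[OF d(1) i] by blast
qed

end

section \<open>Directed colimits in $\mathsf{Modify}$\<close>

lemma modify_comp [simp]: "(Q', h', R) \<cdot>\<^bsub>modify_cat I\<^esub> (P, h, Q) = (P, h' \<cdot>\<^bsub>Sig I\<^esub> h, R)"
  by (simp add: modify_cat_def)

lemma modify_Id: "Id (modify_cat I) (\<Gamma>, S, \<Delta>) = ((\<Gamma>, S, \<Delta>), Id (Sig I) S, (\<Gamma>, S, \<Delta>))"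
  by (simp add: modify_cat_def)

lemma modify_obj: "(\<Gamma>, S, \<Delta>) \<in> Obj (modify_cat I) \<longleftrightarrow> S \<in> Obj (Sig I) \<and> \<Gamma> \<subseteq> Sen I S \<and> \<Delta> \<subseteq> Sen I S"
  by (simp add: modify_cat_def)

definition modify_sig :: "('k, 'u, 's set \<times> 'sig \<times> 's set, ('s set \<times> 'sig \<times> 's set) \<times> 'mor \<times> ('s set \<times> 'sig \<times> 's set)) fctr
    \<Rightarrow> ('k, 'u, 'sig, 'mor) fctr" where
  "modify_sig D = \<lparr>fobj = \<lambda>k. fst (snd (fobj D k)), farr = \<lambda>u. amap (farr D u)\<rparr>"

lemma hom_modifyD:
  assumes "f \<in> hom (modify_cat I) (\<Gamma>, S, \<Delta>) (\<Gamma>', S', \<Delta>')"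
  shows "f = ((\<Gamma>, S, \<Delta>), amap f, (\<Gamma>', S', \<Delta>'))" "amap f \<in> hom (Sig I) S S'"
    "Sen_map I (amap f) ` \<Gamma> \<subseteq> \<Gamma>'" "Sen_map I (amap f) ` \<Delta> \<subseteq> \<Delta>'"
    "S \<in> Obj (Sig I)" "\<Gamma> \<subseteq> Sen I S" "\<Delta> \<subseteq> Sen I S"
  using assms unfolding hom_modify_cat amap_def by (auto simp: modify_cat_def)

lemma hom_modifyI:
  assumes "h \<in> hom (Sig I) S S'" "Sen_map I h ` \<Gamma> \<subseteq> \<Gamma>'" "Sen_map I h ` \<Delta> \<subseteq> \<Delta>'"
    "S \<in> Obj (Sig I)" "\<Gamma> \<subseteq> Sen I S" "\<Delta> \<subseteq> Sen I S"
    "S' \<in> Obj (Sig I)" "\<Gamma>' \<subseteq> Sen I S'" "\<Delta>' \<subseteq> Sen I S'"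
  shows "((\<Gamma>, S, \<Delta>), h, (\<Gamma>', S', \<Delta>')) \<in> hom (modify_cat I) (\<Gamma>, S, \<Delta>) (\<Gamma>', S', \<Delta>')"
  using assms unfolding hom_modify_cat by (auto simp: modify_obj)

text \<open>The forgetful functor to signatures has a right adjoint, sending \<open>T\<close> to
  \<open>(Sen I T, T, Sen I T)\<close>, so it preserves colimits; cocones of signatures are lifted
  with this object as vertex. As for the two inclusions, replacing \<Gamma> and \<Delta> by the
  unions of the sets translated from the stages gives another cocone. Its mediating morphism is the
  identity on \<open>S\<close>, and hence must carry \<Gamma> and \<Delta> into these
  unions.\<close>

lemma modify_colimit:
  fixes I :: "('sig, 'mor, 'm, 'h, 's, 'x, 'y) inst"
  assumes F: "is_functor (Sig I) set_cat (Sen_fctr I)"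
    and col: "is_colimit (poset_cat J r) (modify_cat I) D (\<Gamma>, S, \<Delta>) l"
  shows "is_colimit (poset_cat J r) (Sig I) (modify_sig D) S (\<lambda>k. amap (l k))"
    and "\<Gamma> \<subseteq> (\<Union>k\<in>J. Sen_map I (amap (l k)) ` fst (fobj D k))"
    and "\<Delta> \<subseteq> (\<Union>k\<in>J. Sen_map I (amap (l k)) ` snd (snd (fobj D k)))"
proof -
  interpret S: category "Sig I" using F by (simp add: is_functor_def)
  have FD: "is_functor (poset_cat J r) (modify_cat I) D" and coc: "is_cocone (poset_cat J r) (modify_cat I) D (\<Gamma>, S, \<Delta>) l"
    using col by (auto simp: is_colimit_def)
  note fd = poset_functorD[OF FD]
  have r: "i \<in> J \<and> k \<in> J" if "(i, k) \<in> r" for i k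
    using category.dom_obj[of "poset_cat J r" "(i, k)"] category.cod_obj[of "poset_cat J r" "(i, k)"] FD that
    by (auto simp: is_functor_def)
  define G where "G k = fst (fobj D k)" for k
  define H where "H k = snd (snd (fobj D k))" for k
  define D' where "D' = modify_sig D"
  have D_eq: "fobj D k = (G k, fobj D' k, H k)" for k by (simp add: G_def H_def D'_def modify_sig_def)
  have D'_arr: "farr D' u = amap (farr D u)" for u by (simp add: D'_def modify_sig_def)
  have obj: "(\<Gamma>, S, \<Delta>) \<in> Obj (modify_cat I)" using coc by (simp add: poset_cocone_iff)
  have l: "l k \<in> hom (modify_cat I) (G k, fobj D' k, H k) (\<Gamma>, S, \<Delta>)" if "k \<in> J" for k
    using coc that by (simp add: poset_cocone_iff D_eq)
  note l = hom_modifyD[OF l]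
  have a: "farr D (i, k) \<in> hom (modify_cat I) (G i, fobj D' i, H i) (G k, fobj D' k, H k)" if "(i, k) \<in> r" for i k
    using fd(2)[OF that] by (simp add: D_eq)
  note a = hom_modifyD[OF a]
  have lD: "l k \<cdot>\<^bsub>modify_cat I\<^esub> farr D (i, k) = l i" if "(i, k) \<in> r" for i k
    using coc that by (simp add: poset_cocone_iff)
  have l'D: "amap (l k) \<cdot>\<^bsub>Sig I\<^esub> farr D' (i, k) = amap (l i)" if "(i, k) \<in> r" for i k
  proof -
    have "((\<Gamma>', S1, \<Delta>'), h, P) \<cdot>\<^bsub>modify_cat I\<^esub> ((\<Gamma>'', S2, \<Delta>''), g, Q) = l i \<Longrightarrow> h \<cdot>\<^bsub>Sig I\<^esub> g = amap (l i)"
      for \<Gamma>' S1 \<Delta>' h P \<Gamma>'' S2 \<Delta>'' g Q by (simp add: amap_def) (metis fst_conv snd_conv)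
    from this[of "G k" "fobj D' k" "H k" "amap (l k)" "(\<Gamma>, S, \<Delta>)" "G i" "fobj D' i" "H i" "amap (farr D (i, k))" "(G k, fobj D' k, H k)"]
    show ?thesis using lD[OF that] l(1)[of k] a(1)[OF that] r[OF that] by (simp add: D'_arr)
  qed
  show Sig_col: "is_colimit (poset_cat J r) (Sig I) (modify_sig D) S (\<lambda>k. amap (l k))"
    unfolding D'_def[symmetric]
  proof (rule is_colimitI)
    have "farr D' (i, i) = Id (Sig I) (fobj D' i)" if "i \<in> J" for i
      using fd(3)[OF that] unfolding D'_arr D_eq by (simp add: amap_def modify_cat_def)
    moreover have "farr D' (i, m) = farr D' (k, m) \<cdot>\<^bsub>Sig I\<^esub> farr D' (i, k)" if "(i, k) \<in> r" "(k, m) \<in> r" for i k m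
    proof -
      have "farr D (i, m) = ((G k, fobj D' k, H k), farr D' (k, m), (G m, fobj D' m, H m)) \<cdot>\<^bsub>modify_cat I\<^esub>
          ((G i, fobj D' i, H i), farr D' (i, k), (G k, fobj D' k, H k))"
        using fd(4)[OF that] a(1)[OF that(1)] a(1)[OF that(2)] by (simp add: D'_arr)
      then show ?thesis by (simp add: D'_arr amap_def)
    qed
    moreover have "farr D' (i, k) \<in> hom (Sig I) (fobj D' i) (fobj D' k)" if "(i, k) \<in> r" for i k
      using a(2)[OF that] by (simp add: D'_arr)
    moreover have "category (poset_cat J r)" using FD by (simp add: is_functor_def)
    ultimately show "is_functor (poset_cat J r) (Sig I) D'"
      unfolding is_functor_def using S.category_axioms l(5) by auto
    show "is_cocone (poset_cat J r) (Sig I) D' S (\<lambda>k. amap (l k))"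
      unfolding poset_cocone_iff using obj l(2) l'D by (auto simp: modify_obj)
  next
    fix T m assume "is_cocone (poset_cat J r) (Sig I) D' T m"
    then have m: "T \<in> Obj (Sig I)" "\<And>k. k \<in> J \<Longrightarrow> m k \<in> hom (Sig I) (fobj D' k) T"
       "\<And>i k. (i, k) \<in> r \<Longrightarrow> m k \<cdot>\<^bsub>Sig I\<^esub> farr D' (i, k) = m i" by (auto simp: poset_cocone_iff)
    let ?b = "(Sen I T, T, Sen I T)"
    have b: "?b \<in> Obj (modify_cat I)" using m(1) by (simp add: modify_obj)
    have "is_cocone (poset_cat J r) (modify_cat I) D ?b (\<lambda>k. (fobj D k, m k, ?b))"
      unfolding poset_cocone_iff
    proof (intro conjI ballI allI impI b)
      show "(fobj D k, m k, ?b) \<in> hom (modify_cat I) (fobj D k) ?b" if k: "k \<in> J" for k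
        unfolding D_eq using l(5-7)[OF k] m(1) m(2)[OF k] Sen_map_in[OF F m(2)[OF k]]
        by (intro hom_modifyI) auto
      show "(fobj D k, m k, ?b) \<cdot>\<^bsub>modify_cat I\<^esub> farr D (i, k) = (fobj D i, m i, ?b)" if "(i, k) \<in> r" for i k
        by (subst a(1)[OF that]) (simp add: m(3)[OF that, unfolded D'_arr] D_eq)
    qed
    from colimit_factor[OF col this] obtain h where h: "h \<in> hom (modify_cat I) (\<Gamma>, S, \<Delta>) ?b"
      "\<And>k. k \<in> J \<Longrightarrow> h \<cdot>\<^bsub>modify_cat I\<^esub> l k = (fobj D k, m k, ?b)" unfolding poset_cat_simps by blast
    have "amap h \<cdot>\<^bsub>Sig I\<^esub> amap (l k) = m k" if "k \<in> J" for k
    proof -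
      have "((\<Gamma>, S, \<Delta>), amap h, ?b) \<cdot>\<^bsub>modify_cat I\<^esub> (fobj D k, amap (l k), (\<Gamma>, S, \<Delta>)) = (fobj D k, m k, ?b)"
        using h(2)[OF that] hom_modifyD(1)[OF h(1)] l(1)[OF that] by (simp add: D_eq)
      then show ?thesis by simp
    qed
    then show "\<exists>h. h \<in> hom (Sig I) S T \<and> (\<forall>k\<in>Obj (poset_cat J r). h \<cdot>\<^bsub>Sig I\<^esub> amap (l k) = m k)"
      using hom_modifyD(2)[OF h(1)] by auto
  next
    fix T h h' assume h: "h \<in> hom (Sig I) S T" "h' \<in> hom (Sig I) S T"
      and eq: "\<And>k. k \<in> Obj (poset_cat J r) \<Longrightarrow> h \<cdot>\<^bsub>Sig I\<^esub> amap (l k) = h' \<cdot>\<^bsub>Sig I\<^esub> amap (l k)"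
    let ?b = "(Sen I T, T, Sen I T)"
    have T: "T \<in> Obj (Sig I)" using h(1) S.cod_obj by (auto simp: hom_def)
    have m: "((\<Gamma>, S, \<Delta>), g, ?b) \<in> hom (modify_cat I) (\<Gamma>, S, \<Delta>) ?b" if "g \<in> hom (Sig I) S T" for g
      using that obj T Sen_map_in[OF F that] by (intro hom_modifyI) (auto simp: modify_obj)
    have "((\<Gamma>, S, \<Delta>), h, ?b) = ((\<Gamma>, S, \<Delta>), h', ?b)"
    proof (rule colimit_joint_epi[OF col m[OF h(1)] m[OF h(2)]])
      fix k assume "k \<in> Obj (poset_cat J r)"
      then have k: "k \<in> J" by simp
      have "((\<Gamma>, S, \<Delta>), h, ?b) \<cdot>\<^bsub>modify_cat I\<^esub> ((G k, fobj D' k, H k), amap (l k), (\<Gamma>, S, \<Delta>)) =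
          ((\<Gamma>, S, \<Delta>), h', ?b) \<cdot>\<^bsub>modify_cat I\<^esub> ((G k, fobj D' k, H k), amap (l k), (\<Gamma>, S, \<Delta>))"
        using eq k by simp
      then show "((\<Gamma>, S, \<Delta>), h, ?b) \<cdot>\<^bsub>modify_cat I\<^esub> l k = ((\<Gamma>, S, \<Delta>), h', ?b) \<cdot>\<^bsub>modify_cat I\<^esub> l k"
        by (simp only: l(1)[OF k, symmetric])
    qed
    then show "h = h'" by simp
  qed
  define U where "U = (\<Union>k\<in>J. Sen_map I (amap (l k)) ` G k)"
  define V where "V = (\<Union>k\<in>J. Sen_map I (amap (l k)) ` H k)"
  let ?b = "(U, S, V)"
  have S: "S \<in> Obj (Sig I)" using obj by (simp add: modify_obj)
  have UV: "U \<subseteq> Sen I S" "V \<subseteq> Sen I S" unfolding U_def V_def using Sen_map_in[OF F l(2)] l(6,7) by blast+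
  have "is_cocone (poset_cat J r) (modify_cat I) D ?b (\<lambda>k. (fobj D k, amap (l k), ?b))"
    unfolding poset_cocone_iff
  proof (intro conjI ballI allI impI)
    show "?b \<in> Obj (modify_cat I)" using S UV by (simp add: modify_obj)
    show "(fobj D k, amap (l k), ?b) \<in> hom (modify_cat I) (fobj D k) ?b" if k: "k \<in> J" for k
      unfolding D_eq using l(2)[OF k] l(5-7)[OF k] S UV k by (intro hom_modifyI) (auto simp: U_def V_def)
    show "(fobj D k, amap (l k), ?b) \<cdot>\<^bsub>modify_cat I\<^esub> farr D (i, k) = (fobj D i, amap (l i), ?b)" if "(i, k) \<in> r" for i k
      by (subst a(1)[OF that]) (simp add: l'D[OF that, unfolded D'_arr] D_eq)
  qed
  from colimit_factor[OF col this] obtain h where h: "h \<in> hom (modify_cat I) (\<Gamma>, S, \<Delta>) ?b"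
    "\<And>k. k \<in> J \<Longrightarrow> h \<cdot>\<^bsub>modify_cat I\<^esub> l k = (fobj D k, amap (l k), ?b)" unfolding poset_cat_simps by blast
  \<comment> \<open>The underlying arrow mediates the legs of the signature colimit just established
    with themselves.\<close>
  have "amap h = Id (Sig I) S"
  proof (rule colimit_endo_Id[OF Sig_col hom_modifyD(2)[OF h(1)]])
    fix k assume "k \<in> Obj (poset_cat J r)"
    then have k: "k \<in> J" by simp
    have "((\<Gamma>, S, \<Delta>), amap h, ?b) \<cdot>\<^bsub>modify_cat I\<^esub> (fobj D k, amap (l k), (\<Gamma>, S, \<Delta>)) = (fobj D k, amap (l k), ?b)"
      using h(2)[OF k] hom_modifyD(1)[OF h(1)] l(1)[OF k] by (simp add: D_eq)
    then show "amap h \<cdot>\<^bsub>Sig I\<^esub> amap (l k) = amap (l k)" by simp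
  qed
  then have "Sen_map I (amap h) \<gamma> = \<gamma>" if "\<gamma> \<in> Sen I S" for \<gamma> using Sen_map_id[OF F S that] by simp
  then have "\<Gamma> \<subseteq> U" "\<Delta> \<subseteq> V"
    using hom_modifyD(3,4,6,7)[OF h(1)] by (metis image_subset_iff subset_iff)+
  then show "\<Gamma> \<subseteq> (\<Union>k\<in>J. Sen_map I (amap (l k)) ` fst (fobj D k))"
    "\<Delta> \<subseteq> (\<Union>k\<in>J. Sen_map I (amap (l k)) ` snd (snd (fobj D k)))"
    by (simp_all add: U_def V_def G_def H_def)
qed

definition modify_diagram ::
  "('j \<Rightarrow> 's set) \<Rightarrow> ('j, 'j \<times> 'j, 'sig, 'mor) fctr \<Rightarrow> ('j \<Rightarrow> 's set) \<Rightarrow>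
    ('j, 'j \<times> 'j, 's set \<times> 'sig \<times> 's set, ('s set \<times> 'sig \<times> 's set) \<times> 'mor \<times> ('s set \<times> 'sig \<times> 's set)) fctr" where
  "modify_diagram G D H = \<lparr>fobj = \<lambda>k. (G k, fobj D k, H k),
    farr = \<lambda>u. ((G (fst u), fobj D (fst u), H (fst u)), farr D u, (G (snd u), fobj D (snd u), H (snd u)))\<rparr>"

text \<open>The passage in the other direction, needed to invoke the compactness of the base
  institution: an arrow out of \<open>S\<close> respects the unions as soon as it respects the sets
  of each stage.\<close>

lemma modify_diagram_colimit:
  fixes I :: "('sig, 'mor, 'm, 'h, 's, 'x, 'y) inst"
  assumes F: "is_functor (Sig I) set_cat (Sen_fctr I)"
    and col: "is_colimit (poset_cat J r) (Sig I) D S l"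
    and G: "\<And>k. k \<in> J \<Longrightarrow> G k \<subseteq> Sen I (fobj D k)" "\<And>i k. (i, k) \<in> r \<Longrightarrow> Sen_map I (farr D (i, k)) ` G i \<subseteq> G k"
    and H: "\<And>k. k \<in> J \<Longrightarrow> H k \<subseteq> Sen I (fobj D k)" "\<And>i k. (i, k) \<in> r \<Longrightarrow> Sen_map I (farr D (i, k)) ` H i \<subseteq> H k"
  defines "\<Gamma> \<equiv> \<Union>k\<in>J. Sen_map I (l k) ` G k" and "\<Delta> \<equiv> \<Union>k\<in>J. Sen_map I (l k) ` H k"
  shows "is_colimit (poset_cat J r) (modify_cat I) (modify_diagram G D H) (\<Gamma>, S, \<Delta>)
    (\<lambda>k. ((G k, fobj D k, H k), l k, (\<Gamma>, S, \<Delta>)))"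
proof -
  interpret S: category "Sig I" using F by (simp add: is_functor_def)
  have FD: "is_functor (poset_cat J r) (Sig I) D" and coc: "is_cocone (poset_cat J r) (Sig I) D S l"
    using col by (auto simp: is_colimit_def)
  note fd = poset_functorD[OF FD]
  have r: "i \<in> J \<and> k \<in> J" if "(i, k) \<in> r" for i k
    using category.dom_obj[of "poset_cat J r" "(i, k)"] category.cod_obj[of "poset_cat J r" "(i, k)"] FD that
    by (auto simp: is_functor_def)
  have l: "l k \<in> hom (Sig I) (fobj D k) S" if "k \<in> J" for k using coc that by (simp add: poset_cocone_iff)
  have lD: "l k \<cdot>\<^bsub>Sig I\<^esub> farr D (i, k) = l i" if "(i, k) \<in> r" for i k using coc that by (simp add: poset_cocone_iff)
  have S: "S \<in> Obj (Sig I)" using coc by (simp add: poset_cocone_iff)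
  have \<Gamma>: "\<Gamma> \<subseteq> Sen I S" "\<Delta> \<subseteq> Sen I S" unfolding \<Gamma>_def \<Delta>_def using Sen_map_in[OF F l] G(1) H(1) by blast+
  have lh: "((G k, fobj D k, H k), l k, (\<Gamma>, S, \<Delta>)) \<in> hom (modify_cat I) (G k, fobj D k, H k) (\<Gamma>, S, \<Delta>)" if "k \<in> J" for k
    using that fd(1)[OF that] G(1)[OF that] H(1)[OF that] l[OF that] \<Gamma> S
    by (intro hom_modifyI) (auto simp: \<Gamma>_def \<Delta>_def)
  have ar: "((G i, fobj D i, H i), farr D (i, k), (G k, fobj D k, H k)) \<in>
      hom (modify_cat I) (G i, fobj D i, H i) (G k, fobj D k, H k)" if "(i, k) \<in> r" for i k
    using r[OF that] fd(1) fd(2)[OF that] G(1) G(2)[OF that] H(1) H(2)[OF that]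
    by (intro hom_modifyI) simp_all
  show ?thesis
  proof (rule is_colimitI)
    have "category (poset_cat J r)" using FD by (simp add: is_functor_def)
    then show "is_functor (poset_cat J r) (modify_cat I) (modify_diagram G D H)"
      using category_modify_cat[OF S.category_axioms F] fd(1,3) G(1) H(1)
      unfolding is_functor_def modify_diagram_def
      by (auto simp: modify_obj modify_Id intro: fd(4) ar)
    show "is_cocone (poset_cat J r) (modify_cat I) (modify_diagram G D H) (\<Gamma>, S, \<Delta>)
        (\<lambda>k. ((G k, fobj D k, H k), l k, (\<Gamma>, S, \<Delta>)))"
      unfolding poset_cocone_iff modify_diagram_def using lh lD S \<Gamma> by (auto simp: modify_obj)
  next
    fix b m
    assume cc: "is_cocone (poset_cat J r) (modify_cat I) (modify_diagram G D H) b m"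
    obtain \<Gamma>' T \<Delta>' where b: "b = (\<Gamma>', T, \<Delta>')" by (cases b)
    have m: "m k \<in> hom (modify_cat I) (G k, fobj D k, H k) (\<Gamma>', T, \<Delta>')" if "k \<in> J" for k
      using cc that unfolding poset_cocone_iff modify_diagram_def b by simp
    have mD: "m k \<cdot>\<^bsub>modify_cat I\<^esub> ((G i, fobj D i, H i), farr D (i, k), (G k, fobj D k, H k)) = m i" if "(i, k) \<in> r" for i k
      using cc that unfolding poset_cocone_iff modify_diagram_def b by simp
    note m = hom_modifyD[OF m]
    have T: "T \<in> Obj (Sig I)" "\<Gamma>' \<subseteq> Sen I T" "\<Delta>' \<subseteq> Sen I T"
      using cc unfolding poset_cocone_iff b by (simp_all add: modify_obj)
    have "amap (m k) \<cdot>\<^bsub>Sig I\<^esub> farr D (i, k) = amap (m i)" if "(i, k) \<in> r" for i k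
    proof -
      have "((G k, fobj D k, H k), amap (m k), (\<Gamma>', T, \<Delta>')) \<cdot>\<^bsub>modify_cat I\<^esub>
         ((G i, fobj D i, H i), farr D (i, k), (G k, fobj D k, H k)) = m i"
        using mD[OF that] m(1)[of k] r[OF that] by simp
      from arg_cong[OF this, of amap] show ?thesis by (simp add: amap_def[of "(_, _)"])
    qed
    then have "is_cocone (poset_cat J r) (Sig I) D T (\<lambda>k. amap (m k))"
      unfolding poset_cocone_iff using m(2) T by simp
    from colimit_factor[OF col this] obtain h where h: "h \<in> hom (Sig I) S T"
      "\<And>k. k \<in> J \<Longrightarrow> h \<cdot>\<^bsub>Sig I\<^esub> l k = amap (m k)" unfolding poset_cat_simps by blast
    have "Sen_map I h (Sen_map I (l k) \<gamma>) = Sen_map I (amap (m k)) \<gamma>" if "k \<in> J" "\<gamma> \<in> Sen I (fobj D k)" for k \<gamma>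
      using Sen_map_comp[OF F l[OF that(1)] h(1) that(2)] h(2)[OF that(1)] by simp
    then have "Sen_map I h ` \<Gamma> \<subseteq> \<Gamma>'" "Sen_map I h ` \<Delta> \<subseteq> \<Delta>'"
      unfolding \<Gamma>_def \<Delta>_def using m(3,4) G(1) H(1) by (force simp: image_subset_iff)+
    then have "((\<Gamma>, S, \<Delta>), h, b) \<in> hom (modify_cat I) (\<Gamma>, S, \<Delta>) b"
      unfolding b using h(1) S \<Gamma> T by (intro hom_modifyI)
    moreover have "((\<Gamma>, S, \<Delta>), h, b) \<cdot>\<^bsub>modify_cat I\<^esub> ((G k, fobj D k, H k), l k, (\<Gamma>, S, \<Delta>)) = m k" if "k \<in> J" for k
    proof -
      have "((\<Gamma>, S, \<Delta>), h, b) \<cdot>\<^bsub>modify_cat I\<^esub> ((G k, fobj D k, H k), l k, (\<Gamma>, S, \<Delta>)) =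
          ((G k, fobj D k, H k), amap (m k), (\<Gamma>', T, \<Delta>'))" using h(2)[OF that] by (simp add: b)
      then show ?thesis by (simp only: m(1)[OF that, symmetric])
    qed
    ultimately show "\<exists>h. h \<in> hom (modify_cat I) (\<Gamma>, S, \<Delta>) b \<and> (\<forall>k\<in>Obj (poset_cat J r).
        h \<cdot>\<^bsub>modify_cat I\<^esub> ((G k, fobj D k, H k), l k, (\<Gamma>, S, \<Delta>)) = m k)"
      unfolding poset_cat_simps by blast
  next
    fix b h h'
    assume hb: "h \<in> hom (modify_cat I) (\<Gamma>, S, \<Delta>) b" "h' \<in> hom (modify_cat I) (\<Gamma>, S, \<Delta>) b"
      and eq: "\<And>k. k \<in> Obj (poset_cat J r) \<Longrightarrow> h \<cdot>\<^bsub>modify_cat I\<^esub> ((G k, fobj D k, H k), l k, (\<Gamma>, S, \<Delta>)) =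
        h' \<cdot>\<^bsub>modify_cat I\<^esub> ((G k, fobj D k, H k), l k, (\<Gamma>, S, \<Delta>))"
    obtain \<Gamma>' T \<Delta>' where b: "b = (\<Gamma>', T, \<Delta>')" by (cases b)
    note h = hom_modifyD(1,2)[OF hb(1)[unfolded b]] and h' = hom_modifyD(1,2)[OF hb(2)[unfolded b]]
    have "amap h = amap h'"
    proof (rule colimit_joint_epi[OF col h(2) h'(2)])
      fix k assume "k \<in> Obj (poset_cat J r)"
      from eq[OF this] have "((\<Gamma>, S, \<Delta>), amap h, b) \<cdot>\<^bsub>modify_cat I\<^esub> ((G k, fobj D k, H k), l k, (\<Gamma>, S, \<Delta>)) =
        ((\<Gamma>, S, \<Delta>), amap h', b) \<cdot>\<^bsub>modify_cat I\<^esub> ((G k, fobj D k, H k), l k, (\<Gamma>, S, \<Delta>))"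
        using h(1) h'(1) by (simp only: b)
      then show "amap h \<cdot>\<^bsub>Sig I\<^esub> l k = amap h' \<cdot>\<^bsub>Sig I\<^esub> l k" by simp
    qed
    then show "h = h'" using h(1) h'(1) by simp
  qed
qed

section \<open>First-order sentences and derivations\<close>

text \<open>The primitive recursion yields a list of functions that are applied afterwards; the form
  with a single \<open>map\<close> is the one to compute with.\<close>

lemma fol_map_Disj: "fol_map I (Disj \<phi>s) h = Disj (map (\<lambda>\<phi>. fol_map I \<phi> h) \<phi>s)"
  by (simp add: comp_def)

lemma fol_sen_Disj: "fol_sen I (Disj \<phi>s) S \<longleftrightarrow> (\<forall>\<phi>\<in>set \<phi>s. fol_sen I \<phi> S)"
  by simp

lemma FOL_simps [simp]:
  "Sig (FOL I) = Sig I" "Sen (FOL I) S = {\<phi>. fol_sen I \<phi> S}" "Sen_map (FOL I) h \<phi> = fol_map I \<phi> h"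
  by (simp_all add: FOL_def)

abbreviation fol_image :: "('sig, 'mor, 'm, 'h, 's, 'x, 'y) inst \<Rightarrow> 'mor \<Rightarrow> ('s, 'x) fol set \<Rightarrow> ('s, 'x) fol set" where
  "fol_image I h \<Gamma> \<equiv> (\<lambda>\<phi>. fol_map I \<phi> h) ` \<Gamma>"

lemma fol_sequent_iff: "fol_sequent I S \<Gamma> \<Delta> \<longleftrightarrow> S \<in> Obj (Sig I) \<and> (\<forall>\<phi>\<in>\<Gamma> \<union> \<Delta>. fol_sen I \<phi> S)"
  by (auto simp: fol_sequent_def)

text \<open>Every rule carries the well-formedness of its own conclusion as a side condition, so
  each case is immediate.\<close>

lemma derives_sequent: "derives I S \<Gamma> \<Delta> \<Longrightarrow> fol_sequent I S \<Gamma> \<Delta>"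
  by (induction rule: derives.induct)

context delta_institution
begin

interpretation S: category "Sig I" by (rule sig_category)

lemma fol_map_in: "fol_sen I \<phi> S \<Longrightarrow> h \<in> hom (Sig I) S S' \<Longrightarrow> fol_sen I (fol_map I \<phi> h) S'"
  using Sen_map_in[OF FOL_sen_functor[OF delta_institution_axioms], of h S S' \<phi>] by simp

lemma fol_map_id: "fol_sen I \<phi> S \<Longrightarrow> S \<in> Obj (Sig I) \<Longrightarrow> fol_map I \<phi> (Id (Sig I) S) = \<phi>"
  using Sen_map_id[OF FOL_sen_functor[OF delta_institution_axioms], of S \<phi>] by simp

lemma fol_map_comp: "fol_sen I \<phi> a \<Longrightarrow> f \<in> hom (Sig I) a b \<Longrightarrow> g \<in> hom (Sig I) b c \<Longrightarrow>
    fol_map I \<phi> (g \<cdot>\<^bsub>Sig I\<^esub> f) = fol_map I (fol_map I \<phi> f) g"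
  using Sen_map_comp[OF FOL_sen_functor[OF delta_institution_axioms], of f a b g c \<phi>] by simp

lemma fol_map_ext_comp:
  assumes "fol_sen I \<phi> (Ext I a X)" "f \<in> hom (Sig I) a b" "g \<in> hom (Sig I) b c" "X \<in> Obj (Blk I a)"
  shows "fol_map I \<phi> (Ext_mor I (g \<cdot>\<^bsub>Sig I\<^esub> f) X) =
    fol_map I (fol_map I \<phi> (Ext_mor I f X)) (Ext_mor I g (Blk_obj I f X))"
  unfolding ext_mor_comp[OF assms(2-4)]
  using fol_map_comp[OF assms(1) ext_mor_hom[OF assms(2,4)] ext_mor_hom[OF assms(3) Blk_obj_in[OF assms(2,4)]]] .

lemma dcolim_fol:
  assumes dc: "dcolim J r D S l" and \<phi>: "fol_sen I \<phi> (fobj D i)"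
  shows "(i, k) \<in> r \<Longrightarrow> fol_sen I (fol_map I \<phi> (farr D (i, k))) (fobj D k)"
    and "(i, k) \<in> r \<Longrightarrow> (k, m) \<in> r \<Longrightarrow>
      fol_map I (fol_map I \<phi> (farr D (i, k))) (farr D (k, m)) = fol_map I \<phi> (farr D (i, m))"
    and "(i, k) \<in> r \<Longrightarrow> fol_map I (fol_map I \<phi> (farr D (i, k))) (l k) = fol_map I \<phi> (l i)"
    and "i \<in> J \<Longrightarrow> fol_map I \<phi> (farr D (i, i)) = \<phi>"
proof -
  note d = dcolimD[OF dc] and DP = directed_posetD[OF dcolimD(1)[OF dc]]
  show "(i, k) \<in> r \<Longrightarrow> fol_sen I (fol_map I \<phi> (farr D (i, k))) (fobj D k)"
    using fol_map_in[OF \<phi> d(4)] .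
  show "fol_map I (fol_map I \<phi> (farr D (i, k))) (farr D (k, m)) = fol_map I \<phi> (farr D (i, m))"
    if "(i, k) \<in> r" "(k, m) \<in> r"
    using fol_map_comp[OF \<phi> d(4)[OF that(1)] d(4)[OF that(2)]] d(6)[OF that] by simp
  show "fol_map I (fol_map I \<phi> (farr D (i, k))) (l k) = fol_map I \<phi> (l i)" if "(i, k) \<in> r"
    using fol_map_comp[OF \<phi> d(4)[OF that] d(7)[OF DP(2)[OF that]]] d(8)[OF that] by simp
  show "i \<in> J \<Longrightarrow> fol_map I \<phi> (farr D (i, i)) = \<phi>" using fol_map_id[OF \<phi> d(3)] d(5) by simp
qed

lemma derives_translate:
  assumes "derives I S \<Gamma> \<Delta>" "h \<in> hom (Sig I) S S'" "fol_image I h \<Gamma> \<subseteq> \<Gamma>'" "fol_image I h \<Delta> \<subseteq> \<Delta>'"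
    "\<And>\<phi>. \<phi> \<in> \<Gamma>' \<union> \<Delta>' \<Longrightarrow> fol_sen I \<phi> S'"
  shows "derives I S' \<Gamma>' \<Delta>'"
  using assms(3-5) hom_obj(2)[OF assms(2)]
  by (intro Modify[OF assms(1,2)]) (auto simp: fol_sequent_iff)

text \<open>Weakening is (Modify) along the identity.\<close>

lemma derives_weaken:
  assumes "derives I S \<Gamma> \<Delta>" "\<Gamma> \<subseteq> \<Gamma>'" "\<Delta> \<subseteq> \<Delta>'" "\<And>\<phi>. \<phi> \<in> \<Gamma>' \<union> \<Delta>' \<Longrightarrow> fol_sen I \<phi> S"
  shows "derives I S \<Gamma>' \<Delta>'"
proof -
  have S: "S \<in> Obj (Sig I)" and sen: "\<And>\<phi>. \<phi> \<in> \<Gamma> \<union> \<Delta> \<Longrightarrow> fol_sen I \<phi> S"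
    using derives_sequent[OF assms(1)] by (auto simp: fol_sequent_iff)
  then have "fol_image I (Id (Sig I) S) \<Gamma> = \<Gamma>" "fol_image I (Id (Sig I) S) \<Delta> = \<Delta>"
    by (force simp: fol_map_id)+
  then show ?thesis using derives_translate[OF assms(1) S.id_hom[OF S]] assms(2-4) by simp
qed

text \<open>The stage sets are fixed in advance and already contain the principal formula, so the
  rules are wanted in this absorbed form.\<close>

lemma
  assumes seq: "fol_sequent I S \<Gamma> \<Delta>"
  shows derives_Init_mem: "\<psi> \<in> \<Gamma> \<Longrightarrow> \<psi> \<in> \<Delta> \<Longrightarrow> derives I S \<Gamma> \<Delta>"
    and derives_Cut_insert: "derives I S \<Gamma> (insert \<psi> \<Delta>) \<Longrightarrow> derives I S (insert \<psi> \<Gamma>) \<Delta> \<Longrightarrow> derives I S \<Gamma> \<Delta>"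
    and derives_Neg_left_mem: "derives I S \<Gamma> (insert \<phi> \<Delta>) \<Longrightarrow> Neg \<phi> \<in> \<Gamma> \<Longrightarrow> derives I S \<Gamma> \<Delta>"
    and derives_Neg_right_mem: "derives I S (insert \<phi> \<Gamma>) \<Delta> \<Longrightarrow> Neg \<phi> \<in> \<Delta> \<Longrightarrow> derives I S \<Gamma> \<Delta>"
    and derives_Disj_left_mem: "(\<And>\<phi>. \<phi> \<in> set \<phi>s \<Longrightarrow> derives I S (insert \<phi> \<Gamma>) \<Delta>) \<Longrightarrow> Disj \<phi>s \<in> \<Gamma> \<Longrightarrow> derives I S \<Gamma> \<Delta>"
    and derives_Disj_right_mem: "derives I S \<Gamma> (insert \<phi> \<Delta>) \<Longrightarrow> \<phi> \<in> set \<phi>s \<Longrightarrow> Disj \<phi>s \<in> \<Delta> \<Longrightarrow> derives I S \<Gamma> \<Delta>"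
    and derives_Ex_left_mem: "derives I (Ext I S X) (insert \<phi> (fol_image I (Incl I S X) \<Gamma>)) (fol_image I (Incl I S X) \<Delta>) \<Longrightarrow>
      Exists X \<phi> \<in> \<Gamma> \<Longrightarrow> derives I S \<Gamma> \<Delta>"
    and derives_Ex_right_mem: "substitution I (Incl I S X) \<theta> \<Longrightarrow> derives I S \<Gamma> (insert (fol_map I \<phi> \<theta>) \<Delta>) \<Longrightarrow>
      Exists X \<phi> \<in> \<Delta> \<Longrightarrow> derives I S \<Gamma> \<Delta>"
proof -
  have L: "insert \<phi> \<Gamma> = \<Gamma>" if "\<phi> \<in> \<Gamma>" for \<phi> :: "('e, 'x) fol" and \<Gamma> using that by blast
  show "derives I S \<Gamma> \<Delta>" if "\<psi> \<in> \<Gamma>" "\<psi> \<in> \<Delta>"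
    using Init[of I S \<psi> \<Gamma> \<Delta>] seq that by (simp add: insert_absorb)
  show "derives I S \<Gamma> \<Delta>" if "derives I S \<Gamma> (insert \<psi> \<Delta>)" "derives I S (insert \<psi> \<Gamma>) \<Delta>"
    using Cut[of I S \<Gamma> \<Delta> \<psi> \<Gamma> \<Delta>] seq that by simp
  show "derives I S \<Gamma> \<Delta>" if "derives I S \<Gamma> (insert \<phi> \<Delta>)" "Neg \<phi> \<in> \<Gamma>"
    using Neg_left[of I S \<Gamma> \<Delta> \<phi>] seq that by (simp add: insert_absorb)
  show "derives I S \<Gamma> \<Delta>" if "derives I S (insert \<phi> \<Gamma>) \<Delta>" "Neg \<phi> \<in> \<Delta>"
    using Neg_right[of I S \<phi> \<Gamma> \<Delta>] seq that by (simp add: insert_absorb)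
  show "derives I S \<Gamma> \<Delta>" if "\<And>\<phi>. \<phi> \<in> set \<phi>s \<Longrightarrow> derives I S (insert \<phi> \<Gamma>) \<Delta>" "Disj \<phi>s \<in> \<Gamma>"
  \<comment> \<open>For the empty disjunction both unions in \<open>Disj_left\<close> are empty, and
    \<Gamma> and \<Delta> come back only by weakening.\<close>
  proof (rule derives_weaken)
    have "fol_sen I (Disj \<phi>s) S" using that(2) seq unfolding fol_sequent_iff by blast
    then show "derives I S ({Disj \<phi>s} \<union> (\<Union>n<length \<phi>s. \<Gamma>)) (\<Union>n<length \<phi>s. \<Delta>)"
      using that seq by (intro Disj_left) (auto simp: fol_sequent_iff)
  qed (use that seq in \<open>auto simp: fol_sequent_iff\<close>)
  show "derives I S \<Gamma> \<Delta>" if "derives I S \<Gamma> (insert \<phi> \<Delta>)" "\<phi> \<in> set \<phi>s" "Disj \<phi>s \<in> \<Delta>"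
  proof -
    from that(2) obtain n where "n < length \<phi>s" "\<phi>s ! n = \<phi>" by (auto simp: in_set_conv_nth)
    then show ?thesis using Disj_right[of n \<phi>s I S \<Gamma> \<Delta>] seq that by (simp add: insert_absorb)
  qed
  show "derives I S \<Gamma> \<Delta>" if "derives I (Ext I S X) (insert \<phi> (fol_image I (Incl I S X) \<Gamma>)) (fol_image I (Incl I S X) \<Delta>)"
    "Exists X \<phi> \<in> \<Gamma>"
    using Ex_left[of I S X \<phi> \<Gamma> \<Delta>] seq that by (simp add: insert_absorb)
  show "derives I S \<Gamma> \<Delta>" if "substitution I (Incl I S X) \<theta>" "derives I S \<Gamma> (insert (fol_map I \<phi> \<theta>) \<Delta>)"
      "Exists X \<phi> \<in> \<Delta>"
    using Ex_right[of I S X \<theta> \<Gamma> \<Delta> \<phi>] seq that by (simp add: insert_absorb)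
qed

section \<open>Translated substitutions, and families of stage sentences covering a sequent\<close>

lemma substitution_iff:
  assumes "S \<in> Obj (Sig I)" "X \<in> Obj (Blk I S)"
  shows "substitution I (Incl I S X) \<theta> \<longleftrightarrow> \<theta> \<in> hom (Sig I) (Ext I S X) S \<and> \<theta> \<cdot>\<^bsub>Sig I\<^esub> Incl I S X = Id (Sig I) S"
  using incl_hom[OF assms] by (simp add: substitution_def hom_def)

text \<open>The pushout square, applied to \<open>h\<close> after \<theta> and to the identity of
  \<open>S'\<close>, yields exactly one candidate, so the description operator in
  \<open>Sub_map\<close> denotes it.\<close>

lemma Sub_map_spec:
  assumes h: "h \<in> hom (Sig I) S S'" and X: "X \<in> Obj (Blk I S)" and \<theta>: "substitution I (Incl I S X) \<theta>"
  shows "\<exists>\<theta>'. Sub_map I h (X, \<theta>) = (Blk_obj I h X, \<theta>') \<and> substitution I (Incl I S' (Blk_obj I h X)) \<theta>' \<and>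
    \<theta>' \<cdot>\<^bsub>Sig I\<^esub> Ext_mor I h X = h \<cdot>\<^bsub>Sig I\<^esub> \<theta>"
proof -
  have S: "S \<in> Obj (Sig I)" "S' \<in> Obj (Sig I)" "Cod (Sig I) h = S'" using hom_obj[OF h] h by (auto simp: hom_def)
  note X' = Blk_obj_in[OF h X]
  have \<theta>': "\<theta> \<in> hom (Sig I) (Ext I S X) S" "\<theta> \<cdot>\<^bsub>Sig I\<^esub> Incl I S X = Id (Sig I) S"
    using \<theta> substitution_iff[OF S(1) X] by auto
  have "h \<cdot>\<^bsub>Sig I\<^esub> \<theta> \<cdot>\<^bsub>Sig I\<^esub> Incl I S X = Id (Sig I) S' \<cdot>\<^bsub>Sig I\<^esub> h"
    using S.comp_assoc[OF incl_hom[OF S(1) X] \<theta>'(1) h] \<theta>'(2) S.id_left[OF h] S.id_right[OF h] by simp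
  from ext_mor_factor[OF h X S.comp_hom[OF \<theta>'(1) h] S.id_hom[OF S(2)] this]
  have "\<exists>!w. substitution I (Incl I S' (Blk_obj I h X)) w \<and> w \<cdot>\<^bsub>Sig I\<^esub> Ext_mor I h X = h \<cdot>\<^bsub>Sig I\<^esub> \<theta>"
    unfolding substitution_iff[OF S(2) X'] by (simp add: conj_ac)
  from theI'[OF this] show ?thesis unfolding Sub_map_def S(3) by simp
qed

text \<open>The members of \<Phi> must come from the stages, but the stages may produce more.
  Because of this slack a cover survives shrinking \<Phi>, and the family for a conclusion remains
  usable for the premises.\<close>

definition covers :: "'j set \<Rightarrow> 'j rel \<Rightarrow> ('j, 'j \<times> 'j, 'sig, 'mor) fctr \<Rightarrow> ('j \<Rightarrow> 'mor) \<Rightarrow>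
    ('j \<Rightarrow> ('s, 'x) fol set) \<Rightarrow> ('s, 'x) fol set \<Rightarrow> bool" where
  "covers J r D l G \<Phi> \<longleftrightarrow> (\<forall>k\<in>J. \<forall>\<phi>\<in>G k. fol_sen I \<phi> (fobj D k)) \<and>
     (\<forall>i k. (i, k) \<in> r \<longrightarrow> fol_image I (farr D (i, k)) (G i) \<subseteq> G k) \<and>
     (\<forall>\<phi>\<in>\<Phi>. \<exists>k\<in>J. \<exists>\<gamma>\<in>G k. fol_map I \<gamma> (l k) = \<phi>)"

lemma coversD:
  assumes "covers J r D l G \<Phi>"
  shows "k \<in> J \<Longrightarrow> \<phi> \<in> G k \<Longrightarrow> fol_sen I \<phi> (fobj D k)"
    and "(i, k) \<in> r \<Longrightarrow> \<phi> \<in> G i \<Longrightarrow> fol_map I \<phi> (farr D (i, k)) \<in> G k"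
    and "\<phi> \<in> \<Phi> \<Longrightarrow> \<exists>k\<in>J. \<exists>\<gamma>\<in>G k. fol_map I \<gamma> (l k) = \<phi>"
  using assms unfolding covers_def by blast+

lemma coversI:
  assumes "\<And>k \<phi>. k \<in> J \<Longrightarrow> \<phi> \<in> G k \<Longrightarrow> fol_sen I \<phi> (fobj D k)"
    and "\<And>i k \<phi>. (i, k) \<in> r \<Longrightarrow> \<phi> \<in> G i \<Longrightarrow> fol_map I \<phi> (farr D (i, k)) \<in> G k"
    and "\<And>\<phi>. \<phi> \<in> \<Phi> \<Longrightarrow> \<exists>k\<in>J. \<exists>\<gamma>\<in>G k. fol_map I \<gamma> (l k) = \<phi>"
  shows "covers J r D l G \<Phi>"
  unfolding covers_def by (intro conjI ballI allI impI image_subsetI assms)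

lemma covers_subset: "covers J r D l G \<Phi> \<Longrightarrow> \<Phi>' \<subseteq> \<Phi> \<Longrightarrow> covers J r D l G \<Phi>'"
  by (simp add: covers_def subset_iff)

text \<open>A premise has an active formula that the conclusion may lack. Representatives
  \<open>A\<close> chosen at stage \<open>i\<close> are pushed forward along the diagram and
  adjoined, at the cost of forgetting the stages not above \<open>i\<close>.\<close>

lemma covers_extend:
  assumes dc: "dcolim J r D T l" and cov: "covers J r D l G \<Phi>" and i: "i \<in> J"
    and A: "\<And>\<phi>. \<phi> \<in> A \<Longrightarrow> fol_sen I \<phi> (fobj D i)" and sub: "\<Phi>' \<subseteq> \<Phi> \<union> fol_image I (l i) A"
  shows "covers (upset J r i) (uprel J r i) D l (\<lambda>k. fol_image I (farr D (i, k)) A \<union> G k) \<Phi>'"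
proof -
  note d = dcolimD[OF dc] and DP = directed_posetD[OF dcolimD(1)[OF dc]] and c = coversD[OF cov]
  have C: "\<exists>k\<in>upset J r i. \<exists>\<gamma>\<in>fol_image I (farr D (i, k)) A \<union> G k. fol_map I \<gamma> (l k) = \<phi>" if \<phi>: "\<phi> \<in> \<Phi>'" for \<phi>
  proof (cases "\<phi> \<in> \<Phi>")
    case True
    from c(3)[OF this] obtain j \<gamma> where j: "j \<in> J" "\<gamma> \<in> G j" "fol_map I \<gamma> (l j) = \<phi>" by blast
    obtain k where k: "k \<in> J" "(i, k) \<in> r" "(j, k) \<in> r" using DP(5)[OF i j(1)] by blast
    have "fol_map I (fol_map I \<gamma> (farr D (j, k))) (l k) = \<phi>"
      using dcolim_fol(3)[OF dc c(1)[OF j(1,2)] k(3)] j(3) by simp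
    moreover have "fol_map I \<gamma> (farr D (j, k)) \<in> fol_image I (farr D (i, k)) A \<union> G k" using c(2)[OF k(3) j(2)] by simp
    moreover have "k \<in> upset J r i" using k by simp
    ultimately show ?thesis by (intro bexI)
  next
    case False
    then obtain \<gamma> where \<gamma>: "\<gamma> \<in> A" "fol_map I \<gamma> (l i) = \<phi>" using sub \<phi> by blast
    have "fol_map I (fol_map I \<gamma> (farr D (i, i))) (l i) = \<phi>" using dcolim_fol(4)[OF dc A[OF \<gamma>(1)] i] \<gamma>(2) by simp
    moreover have "fol_map I \<gamma> (farr D (i, i)) \<in> fol_image I (farr D (i, i)) A \<union> G i" using \<gamma>(1) by simp
    moreover have "i \<in> upset J r i" using DP(3) i by simp
    ultimately show ?thesis by (intro bexI)
  qed
  have A': "fol_sen I \<phi> (fobj D k)" if k: "(i, k) \<in> r" and \<phi>: "\<phi> \<in> fol_image I (farr D (i, k)) A \<union> G k" for k \<phi>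
    using \<phi> by (elim UnE imageE) (simp_all add: c(1)[OF DP(2)[OF k]] dcolim_fol(1)[OF dc A k])
  have B: "fol_map I \<phi> (farr D (j, k)) \<in> fol_image I (farr D (i, k)) A \<union> G k"
    if jk: "(i, j) \<in> r" "(j, k) \<in> r" and \<phi>: "\<phi> \<in> fol_image I (farr D (i, j)) A \<union> G j" for j k \<phi>
    using \<phi> by (elim UnE imageE) (simp_all add: c(2)[OF jk(2)] dcolim_fol(2)[OF dc A jk])
  show ?thesis
  proof (rule coversI)
    show "\<exists>k\<in>upset J r i. \<exists>\<gamma>\<in>fol_image I (farr D (i, k)) A \<union> G k. fol_map I \<gamma> (l k) = \<phi>" if "\<phi> \<in> \<Phi>'" for \<phi>
      using C[OF that] .
    show "fol_sen I \<phi> (fobj D k)" if "k \<in> upset J r i" "\<phi> \<in> fol_image I (farr D (i, k)) A \<union> G k" for k \<phi>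
      using A'[OF _ that(2)] that(1) by blast
    show "fol_map I \<phi> (farr D (j, k)) \<in> fol_image I (farr D (i, k)) A \<union> G k"
      if "(j, k) \<in> uprel J r i" "\<phi> \<in> fol_image I (farr D (i, j)) A \<union> G j" for j k \<phi>
      using B[OF _ _ that(2)] that(1) by blast
  qed
qed

text \<open>Prepares the premise of \<open>Ex_left\<close>. Including a stage set into its extended
  signature commutes with moving on in the diagram, by the squares
  \<open>ext_mor_incl\<close>.\<close>

lemma covers_ext:
  assumes dc: "dcolim J r D T l" and cov: "covers J r D l G \<Phi>" and i: "i \<in> J" and X: "X \<in> Obj (Blk I (fobj D i))"
  shows "covers (upset J r i) (uprel J r i) (ext_diagram I D i X) (\<lambda>k. Ext_mor I (l k) (Blk_obj I (farr D (i, k)) X))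
    (\<lambda>k. fol_image I (Incl I (fobj D k) (Blk_obj I (farr D (i, k)) X)) (G k))
    (fol_image I (Incl I T (Blk_obj I (l i) X)) \<Phi>)"
proof -
  note d = dcolimD[OF dc] and DP = directed_posetD[OF dcolimD(1)[OF dc]] and c = coversD[OF cov]
    and b = dcolim_blk[OF dc i X]
  let ?X = "\<lambda>k. Blk_obj I (farr D (i, k)) X" and ?Y = "Blk_obj I (l i) X"
  have inc: "Incl I (fobj D k) (?X k) \<in> hom (Sig I) (fobj D k) (Ext I (fobj D k) (?X k))" if "(i, k) \<in> r" for k
    using incl_hom[OF d(3)[OF DP(2)] b(1)] that by blast
  have incS: "Incl I T ?Y \<in> hom (Sig I) T (Ext I T ?Y)"
    using incl_hom[OF d(2)] Blk_obj_in[OF d(7)[OF i] X] by blast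
  have A: "fol_sen I (fol_map I \<gamma> (Incl I (fobj D k) (?X k))) (Ext I (fobj D k) (?X k))" if "(i, k) \<in> r" "\<gamma> \<in> G k" for k \<gamma>
    using fol_map_in[OF c(1)[OF DP(2)[OF that(1)] that(2)] inc[OF that(1)]] .
  have step: "fol_map I (fol_map I \<gamma> (Incl I (fobj D j) (?X j))) (Ext_mor I (farr D (j, k)) (?X j)) =
     fol_map I (fol_map I \<gamma> (farr D (j, k))) (Incl I (fobj D k) (?X k))"
     if jk: "(i, j) \<in> r" "(j, k) \<in> r" and \<gamma>: "\<gamma> \<in> G j" for j k \<gamma>
  proof -
    note s = c(1)[OF DP(1)[OF jk(2)] \<gamma>]
    have ik: "(i, k) \<in> r" using DP(4)[OF jk] .
    show ?thesis
      using fol_map_comp[OF s inc[OF jk(1)] ext_mor_hom[OF d(4)[OF jk(2)] b(1)[OF jk(1)]]]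
        fol_map_comp[OF s d(4)[OF jk(2)] inc[OF ik]] ext_mor_incl[OF d(4)[OF jk(2)] b(1)[OF jk(1)]] b(2)[OF jk] by simp
  qed
  have C: "\<exists>k\<in>upset J r i. \<exists>\<gamma>'\<in>fol_image I (Incl I (fobj D k) (?X k)) (G k).
      fol_map I \<gamma>' (Ext_mor I (l k) (?X k)) = fol_map I \<phi> (Incl I T ?Y)" if \<phi>: "\<phi> \<in> \<Phi>" for \<phi>
  proof -
    from c(3)[OF \<phi>] obtain j \<gamma> where j: "j \<in> J" "\<gamma> \<in> G j" "fol_map I \<gamma> (l j) = \<phi>" by blast
    obtain k where k: "k \<in> J" "(i, k) \<in> r" "(j, k) \<in> r" using DP(5)[OF i j(1)] by blast
    define \<gamma>' where "\<gamma>' = fol_map I \<gamma> (farr D (j, k))"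
    have \<gamma>': "\<gamma>' \<in> G k" "fol_map I \<gamma>' (l k) = \<phi>"
      unfolding \<gamma>'_def using dcolim_fol(3)[OF dc c(1)[OF j(1,2)] k(3)] j(3) c(2)[OF k(3) j(2)] by simp_all
    note s = c(1)[OF k(1) \<gamma>'(1)]
    have "fol_map I (fol_map I \<gamma>' (Incl I (fobj D k) (?X k))) (Ext_mor I (l k) (?X k)) = fol_map I \<phi> (Incl I T ?Y)"
      using fol_map_comp[OF s inc[OF k(2)] ext_mor_hom[OF d(7)[OF k(1)] b(1)[OF k(2)]]]
        fol_map_comp[OF s d(7)[OF k(1)] incS] ext_mor_incl[OF d(7)[OF k(1)] b(1)[OF k(2)]] b(3)[OF k(2)] \<gamma>'(2) by simp
    moreover have "fol_map I \<gamma>' (Incl I (fobj D k) (?X k)) \<in> fol_image I (Incl I (fobj D k) (?X k)) (G k)"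
      using \<gamma>'(1) by simp
    moreover have "k \<in> upset J r i" using k by simp
    ultimately show ?thesis by (intro bexI)
  qed
  have B: "fol_map I \<phi> (Ext_mor I (farr D (j, k)) (?X j)) \<in> fol_image I (Incl I (fobj D k) (?X k)) (G k)"
    if "(i, j) \<in> r" "(j, k) \<in> r" "\<phi> \<in> fol_image I (Incl I (fobj D j) (?X j)) (G j)" for j k \<phi>
  proof -
    from that(3) obtain \<gamma> where \<gamma>: "\<gamma> \<in> G j" "\<phi> = fol_map I \<gamma> (Incl I (fobj D j) (?X j))" by blast
    show ?thesis unfolding \<gamma>(2) step[OF that(1,2) \<gamma>(1)] using c(2)[OF that(2) \<gamma>(1)] by blast
  qed
  show ?thesis
  proof (rule coversI)
    show "fol_sen I \<phi> (fobj (ext_diagram I D i X) k)"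
      if "k \<in> upset J r i" "\<phi> \<in> fol_image I (Incl I (fobj D k) (?X k)) (G k)" for k \<phi>
      using that A by (auto simp: ext_diagram_def)
    show "fol_map I \<phi> (farr (ext_diagram I D i X) (j, k)) \<in> fol_image I (Incl I (fobj D k) (?X k)) (G k)"
      if "(j, k) \<in> uprel J r i" "\<phi> \<in> fol_image I (Incl I (fobj D j) (?X j)) (G j)" for j k \<phi>
      using that(1) B[OF _ _ that(2), of k] by (simp add: ext_diagram_def)
    show "\<exists>k\<in>upset J r i. \<exists>\<gamma>'\<in>fol_image I (Incl I (fobj D k) (?X k)) (G k). fol_map I \<gamma>' (Ext_mor I (l k) (?X k)) = \<phi>"
      if "\<phi> \<in> fol_image I (Incl I T ?Y) \<Phi>" for \<phi>
      using that
    proof (elim imageE)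
      fix \<psi> assume "\<psi> \<in> \<Phi>" "\<phi> = fol_map I \<psi> (Incl I T ?Y)"
      then show ?thesis using C by simp
    qed
  qed
qed

text \<open>All index posets met in the induction are final segments of given ones, so a single
  index type, recorded by the dummy argument, is enough.\<close>

definition stagewise :: "'j itself \<Rightarrow> 'sig \<Rightarrow> ('s, 'x) fol set \<Rightarrow> ('s, 'x) fol set \<Rightarrow> bool" where
  "stagewise _ S \<Gamma> \<Delta> \<longleftrightarrow> (\<forall>(J :: 'j set) r D T l h G H. dcolim J r D T l \<longrightarrow> h \<in> hom (Sig I) S T \<longrightarrow>
     covers J r D l G (fol_image I h \<Gamma>) \<longrightarrow> covers J r D l H (fol_image I h \<Delta>) \<longrightarrow>
     (\<exists>k\<in>J. derives I (fobj D k) (G k) (H k)))"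

text \<open>The hypothesis yields derivability at one stage, and (Modify) along the diagram carries
  it to all later ones. This persistence lets a rule with several premises be applied at a common
  stage.\<close>

lemma stagewise_from:
  fixes J :: "'j set" and ty :: "'j itself"
  assumes st: "stagewise ty S \<Gamma> \<Delta>" and dc: "dcolim J r D T l" and h: "h \<in> hom (Sig I) S T"
    and G: "covers J r D l G \<Phi>" and H: "covers J r D l H \<Psi>" and i: "i \<in> J"
    and A: "\<And>\<phi>. \<phi> \<in> A \<Longrightarrow> fol_sen I \<phi> (fobj D i)" and B: "\<And>\<phi>. \<phi> \<in> B \<Longrightarrow> fol_sen I \<phi> (fobj D i)"
    and sub: "fol_image I h \<Gamma> \<subseteq> \<Phi> \<union> fol_image I (l i) A" "fol_image I h \<Delta> \<subseteq> \<Psi> \<union> fol_image I (l i) B"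
  shows "\<exists>k. (i, k) \<in> r \<and> (\<forall>m. (k, m) \<in> r \<longrightarrow> derives I (fobj D m)
    (fol_image I (farr D (i, m)) A \<union> G m) (fol_image I (farr D (i, m)) B \<union> H m))"
proof -
  note d = dcolimD[OF dc] and DP = directed_posetD[OF dcolimD(1)[OF dc]]
  from st[unfolded stagewise_def, rule_format, OF dcolim_upset[OF dc i] h covers_extend[OF dc G i A sub(1)]
      covers_extend[OF dc H i B sub(2)]]
  obtain k where k: "(i, k) \<in> r"
    "derives I (fobj D k) (fol_image I (farr D (i, k)) A \<union> G k) (fol_image I (farr D (i, k)) B \<union> H k)" by blast
  have "derives I (fobj D m) (fol_image I (farr D (i, m)) A \<union> G m) (fol_image I (farr D (i, m)) B \<union> H m)"
    if km: "(k, m) \<in> r" for m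
  proof (rule derives_translate[OF k(2) d(4)[OF km]])
    have im: "(i, m) \<in> r" using DP(4)[OF k(1) km] .
    show "fol_image I (farr D (k, m)) (fol_image I (farr D (i, k)) A \<union> G k) \<subseteq> fol_image I (farr D (i, m)) A \<union> G m"
      unfolding image_Un image_image using coversD(2)[OF G km] by (intro Un_mono image_subsetI) (simp_all add: dcolim_fol(2)[OF dc A k(1) km])
    show "fol_image I (farr D (k, m)) (fol_image I (farr D (i, k)) B \<union> H k) \<subseteq> fol_image I (farr D (i, m)) B \<union> H m"
      unfolding image_Un image_image using coversD(2)[OF H km] by (intro Un_mono image_subsetI) (simp_all add: dcolim_fol(2)[OF dc B k(1) km])
    show "fol_sen I \<phi> (fobj D m)" if "\<phi> \<in> (fol_image I (farr D (i, m)) A \<union> G m) \<union> (fol_image I (farr D (i, m)) B \<union> H m)" for \<phi>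
      using that by (elim UnE imageE) (simp_all add: coversD(1)[OF G DP(2)[OF km]] coversD(1)[OF H DP(2)[OF km]]
        dcolim_fol(1)[OF dc A im] dcolim_fol(1)[OF dc B im])
  qed
  then show ?thesis using k(1) by blast
qed

end

section \<open>Compactness\<close>

locale dins = delta_institution I for I :: "('sig, 'mor, 'm, 'h, 's, 'x, 'y) inst" +
  fixes ty :: "'j itself"
  assumes dins: "DINS_b ty I"
begin

interpretation S: category "Sig I" by (rule sig_category)

section \<open>Sentences, blocks and substitutions represented at the stages\<close>

lemma dcolim_Sen:
  fixes J :: "'j set"
  assumes dc: "dcolim J r D S l"
  shows "\<gamma> \<in> Sen I S \<Longrightarrow> \<exists>i\<in>J. \<exists>\<gamma>'\<in>Sen I (fobj D i). \<gamma> = Sen_map I (l i) \<gamma>'"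
    and "i \<in> J \<Longrightarrow> a \<in> Sen I (fobj D i) \<Longrightarrow> b \<in> Sen I (fobj D i) \<Longrightarrow> Sen_map I (l i) a = Sen_map I (l i) b \<Longrightarrow>
      \<exists>k. (i, k) \<in> r \<and> Sen_map I (farr D (i, k)) a = Sen_map I (farr D (i, k)) b"
proof -
  note d = dcolimD[OF dc]
  have "preserves_directed_colimits ty (Sig I) set_cat (Sen_fctr I)" using dins by (simp add: DINS_b_def)
  then have col: "is_colimit (poset_cat J r) set_cat (comp_fctr (Sen_fctr I) D) (Sen I S) (\<lambda>j. farr (Sen_fctr I) (l j))"
    using dc unfolding preserves_directed_colimits_def dcolim_def Sen_fctr_def by fastforce
  have [simp]: "fobj (comp_fctr (Sen_fctr I) D) i = Sen I (fobj D i)"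
      "farr (comp_fctr (Sen_fctr I) D) u = farr (Sen_fctr I) (farr D u)" for i u
    by (simp_all add: comp_fctr_def Sen_fctr_def)
  show "\<exists>i\<in>J. \<exists>\<gamma>'\<in>Sen I (fobj D i). \<gamma> = Sen_map I (l i) \<gamma>'" if "\<gamma> \<in> Sen I S"
    using set_directed_colimit_surj[OF col that] amap_Sen[OF d(7)] by force
  show "\<exists>k. (i, k) \<in> r \<and> Sen_map I (farr D (i, k)) a = Sen_map I (farr D (i, k)) b"
    if "i \<in> J" "a \<in> Sen I (fobj D i)" "b \<in> Sen I (fobj D i)" "Sen_map I (l i) a = Sen_map I (l i) b"
    using set_directed_colimit_eq[OF d(1) col that(1), of a b] that amap_Sen[OF d(7)] amap_Sen[OF d(4)] by force
qed

lemma dcolim_Blk: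
  fixes J :: "'j set"
  assumes dc: "dcolim J r D S l"
  shows "X \<in> Obj (Blk I S) \<Longrightarrow> \<exists>i\<in>J. \<exists>X'\<in>Obj (Blk I (fobj D i)). X = Blk_obj I (l i) X'"
    and "i \<in> J \<Longrightarrow> a \<in> Obj (Blk I (fobj D i)) \<Longrightarrow> b \<in> Obj (Blk I (fobj D i)) \<Longrightarrow>
      Blk_obj I (l i) a = Blk_obj I (l i) b \<Longrightarrow>
      \<exists>k. (i, k) \<in> r \<and> Blk_obj I (farr D (i, k)) a = Blk_obj I (farr D (i, k)) b"
proof -
  note d = dcolimD[OF dc]
  have "preserves_directed_colimits ty (Sig I) cat_cat (Blk_fctr I)" using dins by (simp add: DINS_b_def)
  then have col: "is_colimit (poset_cat J r) cat_cat (comp_fctr (Blk_fctr I) D) (Blk I S) (\<lambda>j. farr (Blk_fctr I) (l j))"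
    using dc unfolding preserves_directed_colimits_def dcolim_def Blk_fctr_def by fastforce
  have [simp]: "fobj (comp_fctr (Blk_fctr I) D) i = Blk I (fobj D i)"
      "farr (comp_fctr (Blk_fctr I) D) u = farr (Blk_fctr I) (farr D u)" for i u
    by (simp_all add: comp_fctr_def Blk_fctr_def)
  show "\<exists>i\<in>J. \<exists>X'\<in>Obj (Blk I (fobj D i)). X = Blk_obj I (l i) X'" if "X \<in> Obj (Blk I S)"
    using cat_directed_colimit_surj[OF col that] omap_Blk[OF d(7)] by force
  show "\<exists>k. (i, k) \<in> r \<and> Blk_obj I (farr D (i, k)) a = Blk_obj I (farr D (i, k)) b"
    if "i \<in> J" "a \<in> Obj (Blk I (fobj D i))" "b \<in> Obj (Blk I (fobj D i))" "Blk_obj I (l i) a = Blk_obj I (l i) b"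
    using cat_directed_colimit_eq[OF d(1) col that(1), of a b] that omap_Blk[OF d(7)] omap_Blk[OF d(4)] by force
qed

text \<open>The induction ranges over all diagrams at once: below a quantifier the hypothesis is
  applied to a diagram extended by a block.\<close>

lemma dcolim_fol_surj:
  fixes J :: "'j set"
  assumes "dcolim J r D S l" "fol_sen I \<psi> S"
  shows "\<exists>i\<in>J. \<exists>\<phi>. fol_sen I \<phi> (fobj D i) \<and> fol_map I \<phi> (l i) = \<psi>"
  using assms
proof (induction \<psi> arbitrary: J r D S l)
  case (Atom \<gamma>)
  then have "\<gamma> \<in> Sen I S" by simp
  from dcolim_Sen(1)[OF Atom(1) this] obtain i \<gamma>' where
    "i \<in> J" "\<gamma>' \<in> Sen I (fobj D i)" "\<gamma> = Sen_map I (l i) \<gamma>'" by blast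
  then have "fol_sen I (Atom \<gamma>') (fobj D i)" "fol_map I (Atom \<gamma>') (l i) = Atom \<gamma>" by simp_all
  then show ?case using \<open>i \<in> J\<close> by blast
next
  case (Neg \<psi>)
  then obtain i \<phi> where "i \<in> J" "fol_sen I \<phi> (fobj D i)" "fol_map I \<phi> (l i) = \<psi>" by fastforce
  then have "fol_sen I (Neg \<phi>) (fobj D i)" "fol_map I (Neg \<phi>) (l i) = Neg \<psi>" by simp_all
  then show ?case using \<open>i \<in> J\<close> by blast
next
  case (Disj \<psi>s)
  note dc = Disj.prems(1)
  have "\<forall>\<psi>\<in>set \<psi>s. \<exists>i \<phi>. i \<in> J \<and> fol_sen I \<phi> (fobj D i) \<and> fol_map I \<phi> (l i) = \<psi>"
    using Disj.IH[OF _ dc] Disj.prems(2) unfolding fol_sen_Disj by blast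
  then obtain i \<phi> where *: "\<And>\<psi>. \<psi> \<in> set \<psi>s \<Longrightarrow> i \<psi> \<in> J"
      "\<And>\<psi>. \<psi> \<in> set \<psi>s \<Longrightarrow> fol_sen I (\<phi> \<psi>) (fobj D (i \<psi>))"
      "\<And>\<psi>. \<psi> \<in> set \<psi>s \<Longrightarrow> fol_map I (\<phi> \<psi>) (l (i \<psi>)) = \<psi>"
    by metis
  \<comment> \<open>A disjunction has finitely many members, so their stages have a common bound;
    this is where \<alpha> = \<omega> enters.\<close>
  have "finite (i ` set \<psi>s)" "i ` set \<psi>s \<subseteq> J" using *(1) by auto
  from directed_poset_bound[OF dcolimD(1)[OF dc] this] obtain k where
    k: "k \<in> J" "\<And>\<psi>. \<psi> \<in> set \<psi>s \<Longrightarrow> (i \<psi>, k) \<in> r" by blast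
  let ?\<phi> = "Disj (map (\<lambda>\<psi>. fol_map I (\<phi> \<psi>) (farr D (i \<psi>, k))) \<psi>s)"
  have "fol_sen I ?\<phi> (fobj D k)"
    unfolding fol_sen_Disj using dcolim_fol(1)[OF dc *(2) k(2)] by simp
  moreover have "fol_map I ?\<phi> (l k) = Disj \<psi>s"
    unfolding fol_map_Disj using dcolim_fol(3)[OF dc *(2) k(2)] *(3) by (simp add: map_idI)
  ultimately show ?case using k(1) by blast
next
  case (Exists X \<psi>)
  note dc = Exists.prems(1)
  have X: "X \<in> Obj (Blk I S)" and \<psi>: "fol_sen I \<psi> (Ext I S X)" using Exists.prems(2) by simp_all
  from dcolim_Blk(1)[OF dc X] obtain i X' where i: "i \<in> J" "X' \<in> Obj (Blk I (fobj D i))" "X = Blk_obj I (l i) X'"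
    by blast
  \<comment> \<open>The body lives over the extension of \<open>S\<close> by \<open>X\<close>, which
    is the colimit of the diagram extended by \<open>X'\<close>.\<close>
  from Exists.IH[OF dcolim_ext[OF dc i(1,2)]] \<psi> obtain k \<phi> where
    k: "k \<in> J" "(i, k) \<in> r" and \<phi>: "fol_sen I \<phi> (Ext I (fobj D k) (Blk_obj I (farr D (i, k)) X'))"
      "fol_map I \<phi> (Ext_mor I (l k) (Blk_obj I (farr D (i, k)) X')) = \<psi>"
    unfolding i(3) by (auto simp: ext_diagram_def)
  note b = dcolim_blk[OF dc i(1,2)]
  let ?\<phi> = "Exists (Blk_obj I (farr D (i, k)) X') \<phi>"
  have "fol_sen I ?\<phi> (fobj D k)" "fol_map I ?\<phi> (l k) = Exists X \<psi>"
    using b(1,3)[OF k(2)] \<phi> i(3) by simp_all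
  then show ?case using k(1) by blast
qed

text \<open>The induction runs over the common image \<psi>. Translation preserves the outermost
  constructor, so \<psi> forces the same shape on both representatives.\<close>

lemma dcolim_fol_eq:
  fixes J :: "'j set"
  assumes "dcolim J r D S l" "i \<in> J" "fol_sen I \<phi> (fobj D i)" "fol_sen I \<phi>' (fobj D i)"
    "fol_map I \<phi> (l i) = \<psi>" "fol_map I \<phi>' (l i) = \<psi>"
  shows "\<exists>k. (i, k) \<in> r \<and> fol_map I \<phi> (farr D (i, k)) = fol_map I \<phi>' (farr D (i, k))"
  using assms
proof (induction \<psi> arbitrary: J r D S l i \<phi> \<phi>')
  case (Atom \<gamma>)
  obtain a b where ab: "\<phi> = fol.Atom a" "\<phi>' = fol.Atom b" using Atom.prems(5,6) by (cases \<phi>; cases \<phi>') auto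
  show ?case using dcolim_Sen(2)[OF Atom.prems(1,2), of a b] Atom.prems(3-6) unfolding ab by auto
next
  case (Neg \<psi>)
  obtain a b where ab: "\<phi> = fol.Neg a" "\<phi>' = fol.Neg b" using Neg.prems(5,6) by (cases \<phi>; cases \<phi>') auto
  show ?case using Neg.IH[OF Neg.prems(1,2), of a b] Neg.prems(3-6) unfolding ab by auto
next
  case (Disj \<psi>s)
  note dc = Disj.prems(1) and i = Disj.prems(2)
  note d = dcolimD[OF dc] and DP = directed_posetD[OF dcolimD(1)[OF dc]]
  obtain as bs where ab: "\<phi> = fol.Disj as" "\<phi>' = fol.Disj bs" using Disj.prems(5,6) by (cases \<phi>; cases \<phi>') auto
  have as: "map (\<lambda>\<phi>. fol_map I \<phi> (l i)) as = \<psi>s" and bs: "map (\<lambda>\<phi>. fol_map I \<phi> (l i)) bs = \<psi>s"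
    using Disj.prems(5,6) unfolding ab fol_map_Disj by simp_all
  have len: "length as = length \<psi>s" "length bs = length \<psi>s"
    using arg_cong[OF as, of length] arg_cong[OF bs, of length] by simp_all
  have n: "fol_map I (as ! n) (l i) = \<psi>s ! n" "fol_map I (bs ! n) (l i) = \<psi>s ! n"
    "fol_sen I (as ! n) (fobj D i)" "fol_sen I (bs ! n) (fobj D i)" "\<psi>s ! n \<in> set \<psi>s" if "n < length \<psi>s" for n
    using that len arg_cong[OF as, of "\<lambda>xs. xs ! n"] arg_cong[OF bs, of "\<lambda>xs. xs ! n"] Disj.prems(3,4)
    unfolding ab fol_sen_Disj by simp_all
  have "\<forall>n<length \<psi>s. \<exists>k. (i, k) \<in> r \<and> fol_map I (as ! n) (farr D (i, k)) = fol_map I (bs ! n) (farr D (i, k))"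
    using Disj.IH[OF n(5) dc i n(3,4) n(1,2)] by blast
  then obtain \<kappa> where \<kappa>: "\<And>n. n < length \<psi>s \<Longrightarrow> (i, \<kappa> n) \<in> r"
     "\<And>n. n < length \<psi>s \<Longrightarrow> fol_map I (as ! n) (farr D (i, \<kappa> n)) = fol_map I (bs ! n) (farr D (i, \<kappa> n))"
    by metis
  \<comment> \<open>Inserting \<open>i\<close> keeps the bound above \<open>i\<close> even when the
    disjunction is empty.\<close>
  have "finite (insert i (\<kappa> ` {..<length \<psi>s}))" "insert i (\<kappa> ` {..<length \<psi>s}) \<subseteq> J" using \<kappa>(1) DP(2) i by auto
  from directed_poset_bound[OF d(1) this] obtain k where
    k: "(i, k) \<in> r" "\<And>n. n < length \<psi>s \<Longrightarrow> (\<kappa> n, k) \<in> r" by blast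
  have "fol_map I (as ! n) (farr D (i, k)) = fol_map I (bs ! n) (farr D (i, k))" if "n < length \<psi>s" for n
    using dcolim_fol(2)[OF dc n(3)[OF that] \<kappa>(1)[OF that] k(2)[OF that]]
      dcolim_fol(2)[OF dc n(4)[OF that] \<kappa>(1)[OF that] k(2)[OF that]] \<kappa>(2)[OF that] by simp
  then have "fol_map I \<phi> (farr D (i, k)) = fol_map I \<phi>' (farr D (i, k))"
    unfolding ab fol_map_Disj using len by (simp add: list_eq_iff_nth_eq)
  then show ?case using k(1) by blast
next
  case (Exists Y \<psi>)
  note dc = Exists.prems(1) and i = Exists.prems(2)
  note d = dcolimD[OF dc] and DP = directed_posetD[OF dcolimD(1)[OF dc]]
  obtain X a X' b where ab: "\<phi> = fol.Exists X a" "\<phi>' = fol.Exists X' b"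
    using Exists.prems(5,6) by (cases \<phi>; cases \<phi>') auto
  have X: "X \<in> Obj (Blk I (fobj D i))" "X' \<in> Obj (Blk I (fobj D i))"
    and a: "fol_sen I a (Ext I (fobj D i) X)" "fol_sen I b (Ext I (fobj D i) X')"
    and eq: "Blk_obj I (l i) X = Y" "Blk_obj I (l i) X' = Y" "fol_map I a (Ext_mor I (l i) X) = \<psi>"
      "fol_map I b (Ext_mor I (l i) X') = \<psi>"
    using Exists.prems(3-6) unfolding ab by simp_all
  \<comment> \<open>The bodies live over extensions by possibly different blocks. They become
    comparable once the blocks have been merged, at stage \<open>j\<close>, and the hypothesis is
    then used for the diagram extended by the merged block \<open>Z\<close>.\<close>
  obtain j where j: "(i, j) \<in> r" "Blk_obj I (farr D (i, j)) X = Blk_obj I (farr D (i, j)) X'"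
    using dcolim_Blk(2)[OF dc i X] eq by auto
  define Z where "Z = Blk_obj I (farr D (i, j)) X"
  have j': "j \<in> J" "(j, j) \<in> r" using DP(2,3) j(1) by blast+
  have Z: "Z \<in> Obj (Blk I (fobj D j))" unfolding Z_def using dcolim_blk(1)[OF dc i X(1) j(1)] .
  have ZZ: "Blk_obj I (farr D (j, j)) Z = Z" using dcolim_blk(4)[OF dc j'(1) Z] .
  have ZY: "Blk_obj I (l j) Z = Y" using dcolim_blk(3)[OF dc i X(1) j(1)] eq(1) by (simp add: Z_def)
  let ?a = "fol_map I a (Ext_mor I (farr D (i, j)) X)" and ?b = "fol_map I b (Ext_mor I (farr D (i, j)) X')"
  have "fol_sen I ?a (Ext I (fobj D j) Z)" "fol_sen I ?b (Ext I (fobj D j) Z)"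
    using fol_map_in[OF a(1) ext_mor_hom[OF d(4)[OF j(1)] X(1)]]
      fol_map_in[OF a(2) ext_mor_hom[OF d(4)[OF j(1)] X(2)]] j(2) by (simp_all add: Z_def)
  moreover have "fol_map I ?a (Ext_mor I (l j) Z) = \<psi>" "fol_map I ?b (Ext_mor I (l j) Z) = \<psi>"
    using fol_map_ext_comp[OF a(1) d(4)[OF j(1)] d(7)[OF j'(1)] X(1)]
      fol_map_ext_comp[OF a(2) d(4)[OF j(1)] d(7)[OF j'(1)] X(2)] d(8)[OF j(1)] eq(3,4) j(2) by (simp_all add: Z_def)
  ultimately obtain k where k: "(j, k) \<in> r" "fol_map I ?a (Ext_mor I (farr D (j, k)) Z) = fol_map I ?b (Ext_mor I (farr D (j, k)) Z)"
    using Exists.IH[OF dcolim_ext[OF dc j'(1) Z], of j ?a ?b] j' ZZ by (auto simp: ext_diagram_def)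
  have "fol_map I a (Ext_mor I (farr D (i, k)) X) = fol_map I b (Ext_mor I (farr D (i, k)) X')"
    using fol_map_ext_comp[OF a(1) d(4)[OF j(1)] d(4)[OF k(1)] X(1)]
      fol_map_ext_comp[OF a(2) d(4)[OF j(1)] d(4)[OF k(1)] X(2)] d(6)[OF j(1) k(1)] k(2) j(2) by (simp add: Z_def)
  moreover have "Blk_obj I (farr D (i, k)) X = Blk_obj I (farr D (i, k)) X'"
    using dcolim_blk(2)[OF dc i X(1) j(1) k(1)] dcolim_blk(2)[OF dc i X(2) j(1) k(1)] j(2) by simp
  ultimately show ?case using DP(4)[OF j(1) k(1)] unfolding ab by auto
qed

text \<open>The last two claims are read off from the image diagram being a functor and its legs a
  cocone in \<open>set_cat\<close>, both contained in the preserved colimit, instead of being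
  recomputed from pushouts.\<close>

lemma dcolim_Sub:
  fixes J :: "'j set"
  assumes dc: "dcolim J r D S l"
  shows "y \<in> Sub I S \<Longrightarrow> \<exists>i\<in>J. \<exists>x\<in>Sub I (fobj D i). y = Sub_map I (l i) x"
    and "(i, k) \<in> r \<Longrightarrow> x \<in> Sub I (fobj D i) \<Longrightarrow> Sub_map I (farr D (i, k)) x \<in> Sub I (fobj D k)"
    and "(i, k) \<in> r \<Longrightarrow> x \<in> Sub I (fobj D i) \<Longrightarrow> Sub_map I (l k) (Sub_map I (farr D (i, k)) x) = Sub_map I (l i) x"
proof -
  note d = dcolimD[OF dc] and DP = directed_posetD[OF dcolimD(1)[OF dc]]
  have "preserves_directed_colimits ty (Sig I) set_cat (Sub_fctr I)" using dins by (simp add: DINS_b_def)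
  then have col: "is_colimit (poset_cat J r) set_cat (comp_fctr (Sub_fctr I) D) (Sub I S) (\<lambda>j. farr (Sub_fctr I) (l j))"
    using dc unfolding preserves_directed_colimits_def dcolim_def Sub_fctr_def by fastforce
  have [simp]: "fobj (comp_fctr (Sub_fctr I) D) i = Sub I (fobj D i)"
      "farr (comp_fctr (Sub_fctr I) D) u = farr (Sub_fctr I) (farr D u)" for i u
    by (simp_all add: comp_fctr_def Sub_fctr_def)
  have F: "is_functor (poset_cat J r) set_cat (comp_fctr (Sub_fctr I) D)"
    and coc: "is_cocone (poset_cat J r) set_cat (comp_fctr (Sub_fctr I) D) (Sub I S) (\<lambda>j. farr (Sub_fctr I) (l j))"
    using col by (auto simp: is_colimit_def)
  show "\<exists>i\<in>J. \<exists>x\<in>Sub I (fobj D i). y = Sub_map I (l i) x" if "y \<in> Sub I S"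
    using set_directed_colimit_surj[OF col that] amap_Sub[OF d(7)] by force
  have f: "farr (Sub_fctr I) (farr D (i, k)) \<in> hom set_cat (Sub I (fobj D i)) (Sub I (fobj D k))" if "(i, k) \<in> r" for i k
    using poset_functorD(2)[OF F that] by simp
  have l: "farr (Sub_fctr I) (l k) \<in> hom set_cat (Sub I (fobj D k)) (Sub I S)" if "k \<in> J" for k
    using coc that by (simp add: poset_cocone_iff)
  show in_Sub: "Sub_map I (farr D (i, k)) x \<in> Sub I (fobj D k)" if "(i, k) \<in> r" "x \<in> Sub I (fobj D i)" for i k x
    using PiE_mem[OF conjunct2[OF set_cat_hom_triple[OF f[OF that(1)]]] that(2)]
    unfolding amap_Sub[OF d(4)[OF that(1)] that(2)] .
  show "Sub_map I (l k) (Sub_map I (farr D (i, k)) x) = Sub_map I (l i) x" if ik: "(i, k) \<in> r" and x: "x \<in> Sub I (fobj D i)"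
  proof -
    have "farr (Sub_fctr I) (l k) \<cdot>\<^bsub>set_cat\<^esub> farr (Sub_fctr I) (farr D (i, k)) = farr (Sub_fctr I) (l i)"
      using coc ik by (simp add: poset_cocone_iff)
    then show ?thesis
      using amap_set_comp[OF f[OF ik] l[OF DP(2)[OF ik]] x] amap_Sub[OF d(4)[OF ik] x]
        amap_Sub[OF d(7)[OF DP(2)[OF ik]] in_Sub[OF ik x]] amap_Sub[OF d(7)[OF DP(1)[OF ik]] x] by simp
  qed
qed

section \<open>The rules, carried out at late stages\<close>

lemma stagewiseI:
  assumes "\<And>(J :: 'j set) r D T l h G H. dcolim J r D T l \<Longrightarrow> h \<in> hom (Sig I) S T \<Longrightarrow>
     covers J r D l G (fol_image I h \<Gamma>) \<Longrightarrow> covers J r D l H (fol_image I h \<Delta>) \<Longrightarrow>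
     \<exists>k\<in>J. derives I (fobj D k) (G k) (H k)"
  shows "stagewise ty S \<Gamma> \<Delta>"
  unfolding stagewise_def by (intro allI impI assms)

lemma covers_sequent:
  "dcolim J r D T l \<Longrightarrow> covers J r D l G \<Phi> \<Longrightarrow> covers J r D l H \<Psi> \<Longrightarrow> k \<in> J \<Longrightarrow> fol_sequent I (fobj D k) (G k) (H k)"
  using dcolimD(3)[of J r D T l k] coversD(1)[of J r D l G \<Phi> k] coversD(1)[of J r D l H \<Psi> k]
  by (auto simp: fol_sequent_iff)

text \<open>A family covering the larger sets translated along \<open>h\<close> also covers the
  smaller ones translated along the composite with \<open>g\<close>, which the hypothesis admits as
  its own morphism.\<close>

lemma stagewise_Modify:
  assumes der: "derives I S \<Gamma> \<Delta>" and IH: "stagewise ty S \<Gamma> \<Delta>" and g: "g \<in> hom (Sig I) S S'"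
    and sub: "fol_image I g \<Gamma> \<subseteq> \<Gamma>'" "fol_image I g \<Delta> \<subseteq> \<Delta>'"
  shows "stagewise ty S' \<Gamma>' \<Delta>'"
proof (rule stagewiseI)
  fix J :: "'j set" and r D T l h G H
  assume dc: "dcolim J r D T l" and h: "h \<in> hom (Sig I) S' T" and G: "covers J r D l G (fol_image I h \<Gamma>')"
    and H: "covers J r D l H (fol_image I h \<Delta>')"
  have sen: "\<phi> \<in> \<Gamma> \<union> \<Delta> \<Longrightarrow> fol_sen I \<phi> S" for \<phi> using derives_sequent[OF der] by (simp add: fol_sequent_iff)
  have comp: "fol_map I \<phi> (h \<cdot>\<^bsub>Sig I\<^esub> g) = fol_map I (fol_map I \<phi> g) h" if "\<phi> \<in> \<Gamma> \<union> \<Delta>" for \<phi>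
    using fol_map_comp[OF sen[OF that] g h] .
  have "fol_image I (h \<cdot>\<^bsub>Sig I\<^esub> g) \<Gamma> \<subseteq> fol_image I h \<Gamma>'" "fol_image I (h \<cdot>\<^bsub>Sig I\<^esub> g) \<Delta> \<subseteq> fol_image I h \<Delta>'"
    using comp sub by (auto simp: image_subset_iff)
  then show "\<exists>k\<in>J. derives I (fobj D k) (G k) (H k)"
    by (intro IH[unfolded stagewise_def, rule_format, OF dc S.comp_hom[OF g h]] covers_subset[OF G] covers_subset[OF H])
qed

text \<open>The two families represent the formula independently, possibly by different sentences at
  different stages; \<open>dcolim_fol_eq\<close> makes the representatives coincide later
  on.\<close>

lemma stagewise_Init:
  assumes "\<psi> \<in> \<Gamma>" "\<psi> \<in> \<Delta>"
  shows "stagewise ty S \<Gamma> \<Delta>"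
proof (rule stagewiseI)
  fix J :: "'j set" and r D T l h G H
  assume dc: "dcolim J r D T l" and h: "h \<in> hom (Sig I) S T" and G: "covers J r D l G (fol_image I h \<Gamma>)"
    and H: "covers J r D l H (fol_image I h \<Delta>)"
  note d = dcolimD[OF dc] and DP = directed_posetD[OF dcolimD(1)[OF dc]]
  let ?\<psi> = "fol_map I \<psi> h"
  have "?\<psi> \<in> fol_image I h \<Gamma>" "?\<psi> \<in> fol_image I h \<Delta>" using assms by simp_all
  from coversD(3)[OF G this(1)] coversD(3)[OF H this(2)] obtain i \<gamma> j \<delta> where
    i: "i \<in> J" "\<gamma> \<in> G i" "fol_map I \<gamma> (l i) = ?\<psi>" and j: "j \<in> J" "\<delta> \<in> H j" "fol_map I \<delta> (l j) = ?\<psi>" by blast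
  obtain k where k: "k \<in> J" "(i, k) \<in> r" "(j, k) \<in> r" using DP(5)[OF i(1) j(1)] by blast
  note \<gamma> = coversD(2)[OF G k(2) i(2)] and \<delta> = coversD(2)[OF H k(3) j(2)]
  from dcolim_fol_eq[OF dc k(1) coversD(1)[OF G k(1) \<gamma>] coversD(1)[OF H k(1) \<delta>], of ?\<psi>]
  obtain m where m: "(k, m) \<in> r" "fol_map I (fol_map I \<gamma> (farr D (i, k))) (farr D (k, m)) =
      fol_map I (fol_map I \<delta> (farr D (j, k))) (farr D (k, m))"
    using dcolim_fol(3)[OF dc coversD(1)[OF G i(1,2)] k(2)] dcolim_fol(3)[OF dc coversD(1)[OF H j(1,2)] k(3)] i(3) j(3) by auto
  have "derives I (fobj D m) (G m) (H m)"
    using derives_Init_mem[OF covers_sequent[OF dc G H DP(2)[OF m(1)]] coversD(2)[OF G m(1) \<gamma>]]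
      coversD(2)[OF H m(1) \<delta>] m(2) by simp
  then show "\<exists>k\<in>J. derives I (fobj D k) (G k) (H k)" using DP(2)[OF m(1)] by blast
qed

text \<open>The cut formula need not be represented in either family, so a representative is
  produced by \<open>dcolim_fol_surj\<close>.\<close>

lemma stagewise_Cut:
  assumes IH: "stagewise ty S \<Gamma> (\<Delta> \<union> {\<psi>})" "stagewise ty S ({\<psi>} \<union> \<Gamma>') \<Delta>'" and \<psi>: "fol_sen I \<psi> S"
  shows "stagewise ty S (\<Gamma> \<union> \<Gamma>') (\<Delta> \<union> \<Delta>')"
proof (rule stagewiseI)
  fix J :: "'j set" and r D T l h G H
  assume dc: "dcolim J r D T l" and h: "h \<in> hom (Sig I) S T" and G: "covers J r D l G (fol_image I h (\<Gamma> \<union> \<Gamma>'))"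
    and H: "covers J r D l H (fol_image I h (\<Delta> \<union> \<Delta>'))"
  note d = dcolimD[OF dc] and DP = directed_posetD[OF dcolimD(1)[OF dc]]
  from dcolim_fol_surj[OF dc fol_map_in[OF \<psi> h]] obtain i \<phi> where
    i: "i \<in> J" "fol_sen I \<phi> (fobj D i)" "fol_map I \<phi> (l i) = fol_map I \<psi> h" by blast
  have 1: "\<exists>k. (i, k) \<in> r \<and> (\<forall>m. (k, m) \<in> r \<longrightarrow> derives I (fobj D m)
    (fol_image I (farr D (i, m)) {} \<union> G m) (fol_image I (farr D (i, m)) {\<phi>} \<union> H m))"
    by (rule stagewise_from[OF IH(1) dc h G H i(1)]) (use i(2,3) in \<open>auto simp: image_Un\<close>)
  have 2: "\<exists>k. (i, k) \<in> r \<and> (\<forall>m. (k, m) \<in> r \<longrightarrow> derives I (fobj D m)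
    (fol_image I (farr D (i, m)) {\<phi>} \<union> G m) (fol_image I (farr D (i, m)) {} \<union> H m))"
    by (rule stagewise_from[OF IH(2) dc h G H i(1)]) (use i(2,3) in \<open>auto simp: image_Un\<close>)
  from 1 2 obtain k1 k2 where k: "(i, k1) \<in> r" "(i, k2) \<in> r"
    "\<And>m. (k1, m) \<in> r \<Longrightarrow> derives I (fobj D m) (G m) (insert (fol_map I \<phi> (farr D (i, m))) (H m))"
    "\<And>m. (k2, m) \<in> r \<Longrightarrow> derives I (fobj D m) (insert (fol_map I \<phi> (farr D (i, m))) (G m)) (H m)" by auto
  obtain m where m: "m \<in> J" "(k1, m) \<in> r" "(k2, m) \<in> r" using DP(5)[OF DP(2)[OF k(1)] DP(2)[OF k(2)]] by blast
  from derives_Cut_insert[OF covers_sequent[OF dc G H m(1)] k(3)[OF m(2)] k(4)[OF m(3)]] m(1)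
  show "\<exists>k\<in>J. derives I (fobj D k) (G k) (H k)" by blast
qed

text \<open>The atoms of the two families form a diagram over the base institution with colimit
  \<open>(U, T, V)\<close>, and \<open>U\<close>, \<open>V\<close> contain the translated atoms of
  the rule. The satisfaction condition transports the given entailment along \<open>h\<close>;
  compactness, read contrapositively, then finds an entailment between the atoms of some
  stage.\<close>

lemma stagewise_Atomic:
  assumes b: "\<Gamma>\<^sub>b \<subseteq> Sen I S" "\<Delta>\<^sub>b \<subseteq> Sen I S" "entails I S \<Gamma>\<^sub>b \<Delta>\<^sub>b"
  shows "stagewise ty S (Atom ` \<Gamma>\<^sub>b \<union> \<Gamma>) (\<Delta> \<union> Atom ` \<Delta>\<^sub>b)"
proof (rule stagewiseI)
  fix J :: "'j set" and r D T l h G H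
  assume dc: "dcolim J r D T l" and h: "h \<in> hom (Sig I) S T" and G: "covers J r D l G (fol_image I h (Atom ` \<Gamma>\<^sub>b \<union> \<Gamma>))"
    and H: "covers J r D l H (fol_image I h (\<Delta> \<union> Atom ` \<Delta>\<^sub>b))"
  note d = dcolimD[OF dc] and DP = directed_posetD[OF dcolimD(1)[OF dc]]
  have red: "Red_obj I h A \<in> Obj (Mods I S)" if "A \<in> Obj (Mods I T)" for A
  proof -
    have "farr (Mod_fctr I) h \<in> Arr cat_cat"
      using mod_functor h by (auto simp: is_functor_def op_cat_def hom_def)
    then have "is_functor (Mods I T) (Mods I S) (restr_fctr (Mods I T) \<lparr>fobj = Red_obj I h, farr = Red_arr I h\<rparr>)"
      using h by (simp add: Mod_fctr_def cat_cat_def hom_def)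
    from is_functor_in_objD[OF this that] show ?thesis using that by (simp add: restr_fctr_def)
  qed
  define Gb where "Gb k = {\<gamma>. Atom \<gamma> \<in> G k}" for k
  define Hb where "Hb k = {\<gamma>. Atom \<gamma> \<in> H k}" for k
  have Gb: "Gb k \<subseteq> Sen I (fobj D k)" if "k \<in> J" for k using coversD(1)[OF G that] unfolding Gb_def by force
  have Hb: "Hb k \<subseteq> Sen I (fobj D k)" if "k \<in> J" for k using coversD(1)[OF H that] unfolding Hb_def by force
  have Gb': "Sen_map I (farr D (i, k)) ` Gb i \<subseteq> Gb k" if "(i, k) \<in> r" for i k
    using coversD(2)[OF G that] unfolding Gb_def by force
  have Hb': "Sen_map I (farr D (i, k)) ` Hb i \<subseteq> Hb k" if "(i, k) \<in> r" for i k
    using coversD(2)[OF H that] unfolding Hb_def by force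
  define U where "U = (\<Union>k\<in>J. Sen_map I (l k) ` Gb k)"
  define V where "V = (\<Union>k\<in>J. Sen_map I (l k) ` Hb k)"
  have U: "Sen_map I h \<gamma> \<in> U" if \<gamma>: "\<gamma> \<in> \<Gamma>\<^sub>b" for \<gamma>
  proof -
    have "Atom (Sen_map I h \<gamma>) \<in> fol_image I h (Atom ` \<Gamma>\<^sub>b \<union> \<Gamma>)" using \<gamma> by (force simp: image_Un)
    from coversD(3)[OF G this] obtain k \<phi> where k: "k \<in> J" "\<phi> \<in> G k" "fol_map I \<phi> (l k) = Atom (Sen_map I h \<gamma>)" by blast
    \<comment> \<open>Translation preserves the outermost constructor, so whatever represents an
      atom is an atom.\<close>
    then obtain \<beta> where "\<phi> = Atom \<beta>" "Sen_map I (l k) \<beta> = Sen_map I h \<gamma>" by (cases \<phi>) auto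
    then show ?thesis unfolding U_def Gb_def using k by force
  qed
  have V: "Sen_map I h \<gamma> \<in> V" if \<gamma>: "\<gamma> \<in> \<Delta>\<^sub>b" for \<gamma>
  proof -
    have "Atom (Sen_map I h \<gamma>) \<in> fol_image I h (\<Delta> \<union> Atom ` \<Delta>\<^sub>b)" using \<gamma> by (force simp: image_Un)
    from coversD(3)[OF H this] obtain k \<phi> where k: "k \<in> J" "\<phi> \<in> H k" "fol_map I \<phi> (l k) = Atom (Sen_map I h \<gamma>)" by blast
    then obtain \<beta> where "\<phi> = Atom \<beta>" "Sen_map I (l k) \<beta> = Sen_map I h \<gamma>" by (cases \<phi>) auto
    then show ?thesis unfolding V_def Hb_def using k by force
  qed
  have "entails I T U V"
    unfolding entails_def
  proof
    assume "\<exists>A\<in>Obj (Mods I T). (\<forall>\<gamma>\<in>U. Sat I T A \<gamma>) \<and> (\<forall>\<delta>\<in>V. \<not> Sat I T A \<delta>)"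
    then obtain A where A: "A \<in> Obj (Mods I T)" "\<And>\<gamma>. \<gamma> \<in> U \<Longrightarrow> Sat I T A \<gamma>" "\<And>\<delta>. \<delta> \<in> V \<Longrightarrow> \<not> Sat I T A \<delta>" by blast
    have "Sat I S (Red_obj I h A) \<gamma>" if "\<gamma> \<in> \<Gamma>\<^sub>b" for \<gamma>
      using satisfaction_condition[OF h A(1), of \<gamma>] b(1) that A(2)[OF U[OF that]] by blast
    moreover have "\<not> Sat I S (Red_obj I h A) \<gamma>" if "\<gamma> \<in> \<Delta>\<^sub>b" for \<gamma>
      using satisfaction_condition[OF h A(1), of \<gamma>] b(2) that A(3)[OF V[OF that]] by blast
    ultimately show False using b(3) red[OF A(1)] unfolding entails_def by blast
  qed
  moreover have "compact_sequent ty I (entails I)" using dins by (simp add: DINS_b_def)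
  moreover have "is_colimit (poset_cat J r) (modify_cat I) (modify_diagram Gb D Hb) (U, T, V)
      (\<lambda>k. ((Gb k, fobj D k, Hb k), l k, (U, T, V)))"
    unfolding U_def V_def using modify_diagram_colimit[OF sen_functor _ Gb Gb' Hb Hb'] dc unfolding dcolim_def by blast
  ultimately have "\<exists>k\<in>J. entails I (fobj D k) (Gb k) (Hb k)"
    using d(1) unfolding compact_sequent_def modify_diagram_def by fastforce
  then obtain k where k: "k \<in> J" "entails I (fobj D k) (Gb k) (Hb k)" by blast
  have "Atom ` Gb k \<union> G k = G k" "H k \<union> Atom ` Hb k = H k" unfolding Gb_def Hb_def by auto
  then have "derives I (fobj D k) (G k) (H k)"
    using derives.Atomic[OF Gb[OF k(1)] Hb[OF k(1)] k(2), of "G k" "H k"] covers_sequent[OF dc G H k(1)] by simp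
  then show "\<exists>k\<in>J. derives I (fobj D k) (G k) (H k)" using k(1) by blast
qed

text \<open>The representative of the principal formula is itself a negation, and its body
  represents the active formula of the premise. The other negation rule and the two disjunction
  rules follow the same pattern.\<close>

lemma stagewise_Neg_left:
  assumes IH: "stagewise ty S \<Gamma> (\<Delta> \<union> {\<phi>})"
  shows "stagewise ty S ({Neg \<phi>} \<union> \<Gamma>) \<Delta>"
proof (rule stagewiseI)
  fix J :: "'j set" and r D T l h G H
  assume dc: "dcolim J r D T l" and h: "h \<in> hom (Sig I) S T" and G: "covers J r D l G (fol_image I h ({Neg \<phi>} \<union> \<Gamma>))"
    and H: "covers J r D l H (fol_image I h \<Delta>)"
  note d = dcolimD[OF dc] and DP = directed_posetD[OF dcolimD(1)[OF dc]]
  have "Neg (fol_map I \<phi> h) \<in> fol_image I h ({Neg \<phi>} \<union> \<Gamma>)" by simp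
  from coversD(3)[OF G this] obtain i \<gamma> where i: "i \<in> J" "\<gamma> \<in> G i" "fol_map I \<gamma> (l i) = Neg (fol_map I \<phi> h)" by blast
  then obtain \<psi> where \<psi>: "\<gamma> = Neg \<psi>" "fol_map I \<psi> (l i) = fol_map I \<phi> h" by (cases \<gamma>) auto
  have s: "fol_sen I \<psi> (fobj D i)" using coversD(1)[OF G i(1,2)] \<psi>(1) by simp
  have "\<exists>k. (i, k) \<in> r \<and> (\<forall>m. (k, m) \<in> r \<longrightarrow> derives I (fobj D m)
    (fol_image I (farr D (i, m)) {} \<union> G m) (fol_image I (farr D (i, m)) {\<psi>} \<union> H m))"
    by (rule stagewise_from[OF IH dc h G H i(1)]) (use s \<psi>(2) in \<open>auto simp: image_Un\<close>)
  then obtain k where k: "k \<in> J" "(i, k) \<in> r" "derives I (fobj D k) (G k) (insert (fol_map I \<psi> (farr D (i, k))) (H k))"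
    using DP(2,3) by auto
  from derives_Neg_left_mem[OF covers_sequent[OF dc G H k(1)] k(3)] coversD(2)[OF G k(2) i(2)] k(1)
  show "\<exists>k\<in>J. derives I (fobj D k) (G k) (H k)" unfolding \<psi>(1) by auto
qed

lemma stagewise_Neg_right:
  assumes IH: "stagewise ty S ({\<phi>} \<union> \<Gamma>) \<Delta>"
  shows "stagewise ty S \<Gamma> (\<Delta> \<union> {Neg \<phi>})"
proof (rule stagewiseI)
  fix J :: "'j set" and r D T l h G H
  assume dc: "dcolim J r D T l" and h: "h \<in> hom (Sig I) S T" and G: "covers J r D l G (fol_image I h \<Gamma>)"
    and H: "covers J r D l H (fol_image I h (\<Delta> \<union> {Neg \<phi>}))"
  note d = dcolimD[OF dc] and DP = directed_posetD[OF dcolimD(1)[OF dc]]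
  have "Neg (fol_map I \<phi> h) \<in> fol_image I h (\<Delta> \<union> {Neg \<phi>})" by simp
  from coversD(3)[OF H this] obtain i \<gamma> where i: "i \<in> J" "\<gamma> \<in> H i" "fol_map I \<gamma> (l i) = Neg (fol_map I \<phi> h)" by blast
  then obtain \<psi> where \<psi>: "\<gamma> = Neg \<psi>" "fol_map I \<psi> (l i) = fol_map I \<phi> h" by (cases \<gamma>) auto
  have s: "fol_sen I \<psi> (fobj D i)" using coversD(1)[OF H i(1,2)] \<psi>(1) by simp
  have "\<exists>k. (i, k) \<in> r \<and> (\<forall>m. (k, m) \<in> r \<longrightarrow> derives I (fobj D m)
    (fol_image I (farr D (i, m)) {\<psi>} \<union> G m) (fol_image I (farr D (i, m)) {} \<union> H m))"
    by (rule stagewise_from[OF IH dc h G H i(1)]) (use s \<psi>(2) in \<open>auto simp: image_Un\<close>)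
  then obtain k where k: "k \<in> J" "(i, k) \<in> r" "derives I (fobj D k) (insert (fol_map I \<psi> (farr D (i, k))) (G k)) (H k)"
    using DP(2,3) by auto
  from derives_Neg_right_mem[OF covers_sequent[OF dc G H k(1)] k(3)] coversD(2)[OF H k(2) i(2)] k(1)
  show "\<exists>k\<in>J. derives I (fobj D k) (G k) (H k)" unfolding \<psi>(1) by auto
qed

lemma stagewise_Disj_left:
  assumes IH: "\<And>n. n < length \<phi>s \<Longrightarrow> stagewise ty S ({\<phi>s ! n} \<union> \<Gamma>s n) (\<Delta>s n)"
  shows "stagewise ty S ({Disj \<phi>s} \<union> (\<Union>n<length \<phi>s. \<Gamma>s n)) (\<Union>n<length \<phi>s. \<Delta>s n)"
    (is "stagewise ty S (_ \<union> ?\<Gamma>) ?\<Delta>")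
proof (rule stagewiseI)
  fix J :: "'j set" and r D T l h G H
  assume dc: "dcolim J r D T l" and h: "h \<in> hom (Sig I) S T" and G: "covers J r D l G (fol_image I h ({Disj \<phi>s} \<union> ?\<Gamma>))"
    and H: "covers J r D l H (fol_image I h ?\<Delta>)"
  note d = dcolimD[OF dc] and DP = directed_posetD[OF dcolimD(1)[OF dc]]
  have "fol_map I (Disj \<phi>s) h \<in> fol_image I h ({Disj \<phi>s} \<union> ?\<Gamma>)" by blast
  from coversD(3)[OF G this] obtain i \<gamma> where i: "i \<in> J" "\<gamma> \<in> G i" "fol_map I \<gamma> (l i) = fol_map I (Disj \<phi>s) h" by blast
  then obtain \<psi>s where \<psi>: "\<gamma> = Disj \<psi>s" by (cases \<gamma>) auto
  have eq: "map (\<lambda>\<phi>. fol_map I \<phi> (l i)) \<psi>s = map (\<lambda>\<phi>. fol_map I \<phi> h) \<phi>s"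
    using i(3) unfolding \<psi> fol_map_Disj by simp
  have len: "length \<psi>s = length \<phi>s" using arg_cong[OF eq, of length] by simp
  have n: "fol_map I (\<psi>s ! n) (l i) = fol_map I (\<phi>s ! n) h" "fol_sen I (\<psi>s ! n) (fobj D i)" if "n < length \<phi>s" for n
    using arg_cong[OF eq, of "\<lambda>xs. xs ! n"] that len coversD(1)[OF G i(1,2)] unfolding \<psi> by simp_all
  have "\<exists>k. (i, k) \<in> r \<and> (\<forall>m. (k, m) \<in> r \<longrightarrow> derives I (fobj D m)
    (fol_image I (farr D (i, m)) {\<psi>s ! n} \<union> G m) (fol_image I (farr D (i, m)) {} \<union> H m))" if "n < length \<phi>s" for n
    by (rule stagewise_from[OF IH[OF that] dc h G H i(1)]) (use n[OF that] that in \<open>auto simp: image_Un\<close>)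
  then have "\<forall>n<length \<phi>s. \<exists>k. (i, k) \<in> r \<and> (\<forall>m. (k, m) \<in> r \<longrightarrow> derives I (fobj D m)
    (insert (fol_map I (\<psi>s ! n) (farr D (i, m))) (G m)) (H m))" by simp
  then obtain \<kappa> where \<kappa>: "\<And>n. n < length \<phi>s \<Longrightarrow> (i, \<kappa> n) \<in> r"
    "\<And>n m. n < length \<phi>s \<Longrightarrow> (\<kappa> n, m) \<in> r \<Longrightarrow> derives I (fobj D m) (insert (fol_map I (\<psi>s ! n) (farr D (i, m))) (G m)) (H m)"
    by metis
  \<comment> \<open>One stage has to serve all the premises, of which there are finitely many;
    \<open>i\<close> covers the case that there are none.\<close>
  have "finite (insert i (\<kappa> ` {..<length \<phi>s}))" "insert i (\<kappa> ` {..<length \<phi>s}) \<subseteq> J" using \<kappa>(1) DP(2) i(1) by auto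
  from directed_poset_bound[OF d(1) this] obtain m where
    m: "m \<in> J" "(i, m) \<in> r" "\<And>n. n < length \<phi>s \<Longrightarrow> (\<kappa> n, m) \<in> r" by blast
  have "derives I (fobj D m) (insert \<phi> (G m)) (H m)" if "\<phi> \<in> set (map (\<lambda>\<phi>. fol_map I \<phi> (farr D (i, m))) \<psi>s)" for \<phi>
    using that \<kappa>(2) m(3) len by (auto simp: in_set_conv_nth)
  moreover have "Disj (map (\<lambda>\<phi>. fol_map I \<phi> (farr D (i, m))) \<psi>s) \<in> G m"
    using coversD(2)[OF G m(2) i(2)] unfolding \<psi> fol_map_Disj .
  ultimately have "derives I (fobj D m) (G m) (H m)"
    by (rule derives_Disj_left_mem[OF covers_sequent[OF dc G H m(1)]])
  then show "\<exists>k\<in>J. derives I (fobj D k) (G k) (H k)" using m(1) by blast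
qed

lemma stagewise_Disj_right:
  assumes IH: "stagewise ty S \<Gamma> (\<Delta> \<union> {\<phi>})" and \<phi>: "\<phi> \<in> set \<phi>s"
  shows "stagewise ty S \<Gamma> (\<Delta> \<union> {Disj \<phi>s})"
proof (rule stagewiseI)
  fix J :: "'j set" and r D T l h G H
  assume dc: "dcolim J r D T l" and h: "h \<in> hom (Sig I) S T" and G: "covers J r D l G (fol_image I h \<Gamma>)"
    and H: "covers J r D l H (fol_image I h (\<Delta> \<union> {Disj \<phi>s}))"
  note d = dcolimD[OF dc] and DP = directed_posetD[OF dcolimD(1)[OF dc]]
  have "fol_map I (Disj \<phi>s) h \<in> fol_image I h (\<Delta> \<union> {Disj \<phi>s})" by blast
  from coversD(3)[OF H this] obtain i \<gamma> where i: "i \<in> J" "\<gamma> \<in> H i" "fol_map I \<gamma> (l i) = fol_map I (Disj \<phi>s) h" by blast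
  then obtain \<psi>s where \<psi>s: "\<gamma> = Disj \<psi>s" by (cases \<gamma>) auto
  have "map (\<lambda>\<phi>. fol_map I \<phi> (l i)) \<psi>s = map (\<lambda>\<phi>. fol_map I \<phi> h) \<phi>s"
    using i(3) unfolding \<psi>s fol_map_Disj by simp
  \<comment> \<open>Only membership matters: some member of the representing disjunction has the
    same image in \<open>T\<close> as \<phi>.\<close>
  from arg_cong[OF this, of set] have "fol_image I (l i) (set \<psi>s) = fol_image I h (set \<phi>s)"
    unfolding set_map .
  moreover have "fol_map I \<phi> h \<in> fol_image I h (set \<phi>s)" using \<phi> by simp
  ultimately have "fol_map I \<phi> h \<in> fol_image I (l i) (set \<psi>s)" by simp
  then obtain \<psi> where \<psi>: "\<psi> \<in> set \<psi>s" "fol_map I \<psi> (l i) = fol_map I \<phi> h" by (elim imageE) simp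
  have s: "fol_sen I \<psi> (fobj D i)" using coversD(1)[OF H i(1,2)] \<psi>(1) \<psi>s by simp
  have "\<exists>k. (i, k) \<in> r \<and> (\<forall>m. (k, m) \<in> r \<longrightarrow> derives I (fobj D m)
    (fol_image I (farr D (i, m)) {} \<union> G m) (fol_image I (farr D (i, m)) {\<psi>} \<union> H m))"
    by (rule stagewise_from[OF IH dc h G H i(1)]) (use s \<psi>(2) in \<open>auto simp: image_Un\<close>)
  then obtain k where k: "k \<in> J" "(i, k) \<in> r" "derives I (fobj D k) (G k) (insert (fol_map I \<psi> (farr D (i, k))) (H k))"
    using DP(2,3) by auto
  have "Disj (map (\<lambda>\<phi>. fol_map I \<phi> (farr D (i, k))) \<psi>s) \<in> H k"
    using coversD(2)[OF H k(2) i(2)] unfolding \<psi>s fol_map_Disj .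
  moreover have "fol_map I \<psi> (farr D (i, k)) \<in> set (map (\<lambda>\<phi>. fol_map I \<phi> (farr D (i, k))) \<psi>s)" using \<psi>(1) by simp
  ultimately have "derives I (fobj D k) (G k) (H k)"
    using derives_Disj_right_mem[OF covers_sequent[OF dc G H k(1)] k(3)] by blast
  then show "\<exists>k\<in>J. derives I (fobj D k) (G k) (H k)" using k(1) by blast
qed

text \<open>The block \<open>Z\<close> of the representative and the block \<open>X\<close> have the
  same translate in \<open>T\<close>. The diagram extended by \<open>Z\<close> therefore has as
  colimit exactly the extension of \<open>T\<close> into which the premise is translated, and the
  body of the representative is the sentence to adjoin.\<close>

lemma stagewise_Ex_left:
  assumes IH: "stagewise ty (Ext I S X) ({\<phi>} \<union> fol_image I (Incl I S X) \<Gamma>) (fol_image I (Incl I S X) \<Delta>)"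
    and seq: "fol_sequent I S ({Exists X \<phi>} \<union> \<Gamma>) \<Delta>"
  shows "stagewise ty S ({Exists X \<phi>} \<union> \<Gamma>) \<Delta>"
proof (rule stagewiseI)
  fix J :: "'j set" and r D T l h G H
  assume dc: "dcolim J r D T l" and h: "h \<in> hom (Sig I) S T"
    and G: "covers J r D l G (fol_image I h ({Exists X \<phi>} \<union> \<Gamma>))"
    and H: "covers J r D l H (fol_image I h \<Delta>)"
  note d = dcolimD[OF dc] and DP = directed_posetD[OF dcolimD(1)[OF dc]]
  have X: "X \<in> Obj (Blk I S)" "fol_sen I \<phi> (Ext I S X)" using seq by (auto simp: fol_sequent_iff)
  have sen: "fol_sen I \<gamma> S" if "\<gamma> \<in> \<Gamma> \<union> \<Delta>" for \<gamma> using seq that by (auto simp: fol_sequent_iff)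
  let ?Y = "Blk_obj I h X"
  have "fol_map I (Exists X \<phi>) h \<in> fol_image I h ({Exists X \<phi>} \<union> \<Gamma>)" by blast
  from coversD(3)[OF G this] obtain i \<gamma> where i: "i \<in> J" "\<gamma> \<in> G i" "fol_map I \<gamma> (l i) = fol_map I (Exists X \<phi>) h" by blast
  then obtain Z \<psi> where \<gamma>: "\<gamma> = Exists Z \<psi>" by (cases \<gamma>) auto
  have Z: "Blk_obj I (l i) Z = ?Y" "fol_map I \<psi> (Ext_mor I (l i) Z) = fol_map I \<phi> (Ext_mor I h X)"
    using i(3) unfolding \<gamma> by simp_all
  have Z': "Z \<in> Obj (Blk I (fobj D i))" "fol_sen I \<psi> (Ext I (fobj D i) Z)"
    using coversD(1)[OF G i(1,2)] unfolding \<gamma> by simp_all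
  note b = dcolim_blk[OF dc i(1) Z'(1)]
  \<comment> \<open>The square \<open>ext_mor_incl\<close> on sentences: the context of the premise,
    translated by the extension of \<open>h\<close>, is the included translate along
    \<open>h\<close>, which is what \<open>covers_ext\<close> covers.\<close>
  have swap: "fol_map I (fol_map I \<gamma> (Incl I S X)) (Ext_mor I h X) = fol_map I (fol_map I \<gamma> h) (Incl I T ?Y)"
    if "\<gamma> \<in> \<Gamma> \<union> \<Delta>" for \<gamma>
    using fol_map_comp[OF sen[OF that] incl_hom[OF hom_obj(1)[OF h] X(1)] ext_mor_hom[OF h X(1)]]
      fol_map_comp[OF sen[OF that] h incl_hom[OF hom_obj(2)[OF h] Blk_obj_in[OF h X(1)]]] ext_mor_incl[OF h X(1)] by simp
  have ii: "i \<in> upset J r i" "(i, i) \<in> r" using DP(3) i(1) by simp_all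
  let ?Z = "\<lambda>m. Blk_obj I (farr D (i, m)) Z"
  have hX: "Ext_mor I h X \<in> hom (Sig I) (Ext I S X) (Ext I T (Blk_obj I (l i) Z))"
    using ext_mor_hom[OF h X(1)] Z(1) by simp
  \<comment> \<open>Stage \<open>i\<close> belongs to its own final segment, and there the
    translated block is \<open>Z\<close> itself by \<open>b(4)\<close>, so \<psi> can be adjoined at
    that stage.\<close>
  have "\<exists>k. (i, k) \<in> uprel J r i \<and> (\<forall>m. (k, m) \<in> uprel J r i \<longrightarrow> derives I (fobj (ext_diagram I D i Z) m)
    (fol_image I (farr (ext_diagram I D i Z) (i, m)) {\<psi>} \<union> fol_image I (Incl I (fobj D m) (?Z m)) (G m))
    (fol_image I (farr (ext_diagram I D i Z) (i, m)) {} \<union> fol_image I (Incl I (fobj D m) (?Z m)) (H m)))"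
  proof (rule stagewise_from[OF IH dcolim_ext[OF dc i(1) Z'(1)] hX covers_ext[OF dc G i(1) Z'(1)]
        covers_ext[OF dc H i(1) Z'(1)] ii(1)])
    show "fol_sen I \<phi>' (fobj (ext_diagram I D i Z) i)" if "\<phi>' \<in> {\<psi>}" for \<phi>'
      using that Z'(2) b(4) by (simp add: ext_diagram_def)
    show "fol_image I (Ext_mor I h X) ({\<phi>} \<union> fol_image I (Incl I S X) \<Gamma>)
      \<subseteq> fol_image I (Incl I T (Blk_obj I (l i) Z)) (fol_image I h ({Exists X \<phi>} \<union> \<Gamma>)) \<union>
         fol_image I (Ext_mor I (l i) (?Z i)) {\<psi>}"
      using swap Z b(4) by auto
    show "fol_image I (Ext_mor I h X) (fol_image I (Incl I S X) \<Delta>)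
      \<subseteq> fol_image I (Incl I T (Blk_obj I (l i) Z)) (fol_image I h \<Delta>) \<union> fol_image I (Ext_mor I (l i) (?Z i)) {}"
      using swap Z b(4) by auto
  qed simp
  then obtain k where k: "(i, k) \<in> r" "derives I (Ext I (fobj D k) (?Z k))
      (insert (fol_map I \<psi> (Ext_mor I (farr D (i, k)) Z)) (fol_image I (Incl I (fobj D k) (?Z k)) (G k)))
      (fol_image I (Incl I (fobj D k) (?Z k)) (H k))"
    using DP(2,3) b(4) by (auto simp: ext_diagram_def)
  have "Exists (?Z k) (fol_map I \<psi> (Ext_mor I (farr D (i, k)) Z)) \<in> G k"
    using coversD(2)[OF G k(1) i(2)] unfolding \<gamma> by simp
  from derives_Ex_left_mem[OF covers_sequent[OF dc G H DP(2)[OF k(1)]] k(2) this]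
  show "\<exists>k\<in>J. derives I (fobj D k) (G k) (H k)" using DP(2)[OF k(1)] by blast
qed

text \<open>The substitution and the principal formula reach the stages separately: \<theta> is
  translated to \<open>T\<close> and descends through \<open>Sub\<close>, bringing a block
  \<open>W\<close>, while the representative of the formula brings its own block \<open>Z\<close>.
  The two blocks agree over \<open>T\<close>, hence at some stage \<open>k\<close>, where their
  common translate is \<open>V\<close>.\<close>

lemma stagewise_Ex_right:
  assumes \<theta>: "substitution I (Incl I S X) \<theta>" and IH: "stagewise ty S \<Gamma> (\<Delta> \<union> {fol_map I \<phi> \<theta>})"
    and seq: "fol_sequent I S \<Gamma> (\<Delta> \<union> {Exists X \<phi>})"
  shows "stagewise ty S \<Gamma> (\<Delta> \<union> {Exists X \<phi>})"
proof (rule stagewiseI)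
  fix J :: "'j set" and r D T l h G H
  assume dc: "dcolim J r D T l" and h: "h \<in> hom (Sig I) S T" and G: "covers J r D l G (fol_image I h \<Gamma>)"
    and H: "covers J r D l H (fol_image I h (\<Delta> \<union> {Exists X \<phi>}))"
  note d = dcolimD[OF dc] and DP = directed_posetD[OF dcolimD(1)[OF dc]]
  have X: "X \<in> Obj (Blk I S)" "fol_sen I \<phi> (Ext I S X)" and S: "S \<in> Obj (Sig I)"
    using seq by (auto simp: fol_sequent_iff)
  let ?Y = "Blk_obj I h X"
  have Y: "?Y \<in> Obj (Blk I T)" using Blk_obj_in[OF h X(1)] .
  have "fol_map I (Exists X \<phi>) h \<in> fol_image I h (\<Delta> \<union> {Exists X \<phi>})" by blast
  from coversD(3)[OF H this] obtain i \<gamma> where i: "i \<in> J" "\<gamma> \<in> H i" "fol_map I \<gamma> (l i) = fol_map I (Exists X \<phi>) h" by blast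
  then obtain Z \<psi> where \<gamma>: "\<gamma> = Exists Z \<psi>" by (cases \<gamma>) auto
  have Z: "Blk_obj I (l i) Z = ?Y" "fol_map I \<psi> (Ext_mor I (l i) Z) = fol_map I \<phi> (Ext_mor I h X)"
    using i(3) unfolding \<gamma> by simp_all
  have Z': "Z \<in> Obj (Blk I (fobj D i))" "fol_sen I \<psi> (Ext I (fobj D i) Z)"
    using coversD(1)[OF H i(1,2)] unfolding \<gamma> by simp_all
  note bZ = dcolim_blk[OF dc i(1) Z'(1)]
  from Sub_map_spec[OF h X(1) \<theta>] obtain \<theta>' where
    \<theta>': "substitution I (Incl I T ?Y) \<theta>'" "\<theta>' \<cdot>\<^bsub>Sig I\<^esub> Ext_mor I h X = h \<cdot>\<^bsub>Sig I\<^esub> \<theta>" by blast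
  have "(?Y, \<theta>') \<in> Sub I T" using Y \<theta>'(1) by (simp add: Sub_def)
  from dcolim_Sub(1)[OF dc this] obtain j W \<eta> where
    j: "j \<in> J" "(W, \<eta>) \<in> Sub I (fobj D j)" "Sub_map I (l j) (W, \<eta>) = (?Y, \<theta>')" by force
  have W: "W \<in> Obj (Blk I (fobj D j))" "substitution I (Incl I (fobj D j) W) \<eta>" using j(2) by (simp_all add: Sub_def)
  have lW: "Blk_obj I (l j) W = ?Y" using Sub_map_spec[OF d(7)[OF j(1)] W] j(3) by auto
  note bW = dcolim_blk[OF dc j(1) W(1)]
  obtain k0 where k0: "k0 \<in> J" "(i, k0) \<in> r" "(j, k0) \<in> r" using DP(5)[OF i(1) j(1)] by blast
  from dcolim_Blk(2)[OF dc k0(1) bZ(1)[OF k0(2)] bW(1)[OF k0(3)]] obtain k where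
    k: "(k0, k) \<in> r" "Blk_obj I (farr D (k0, k)) (Blk_obj I (farr D (i, k0)) Z) =
      Blk_obj I (farr D (k0, k)) (Blk_obj I (farr D (j, k0)) W)"
    using bZ(3)[OF k0(2)] bW(3)[OF k0(3)] Z(1) lW by auto
  have ik: "(i, k) \<in> r" and jk: "(j, k) \<in> r" using DP(4)[OF _ k(1)] k0 by blast+
  define V where "V = Blk_obj I (farr D (i, k)) Z"
  have V: "Blk_obj I (farr D (j, k)) W = V" "V \<in> Obj (Blk I (fobj D k))" "Blk_obj I (l k) V = ?Y"
    using bZ(2)[OF k0(2) k(1)] bW(2)[OF k0(3) k(1)] k(2) bZ(1)[OF ik] bZ(3)[OF ik] Z(1) by (simp_all add: V_def)
  from Sub_map_spec[OF d(4)[OF jk] W] obtain \<sigma> where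
    \<sigma>: "Sub_map I (farr D (j, k)) (W, \<eta>) = (V, \<sigma>)" "substitution I (Incl I (fobj D k) V) \<sigma>" unfolding V(1) by blast
  have kJ: "k \<in> J" using DP(2)[OF ik] .
  have "Sub_map I (l k) (V, \<sigma>) = (?Y, \<theta>')" using dcolim_Sub(3)[OF dc jk j(2)] \<sigma>(1) j(3) by simp
  with Sub_map_spec[OF d(7)[OF kJ] V(2) \<sigma>(2)]
  have l\<sigma>: "\<theta>' \<cdot>\<^bsub>Sig I\<^esub> Ext_mor I (l k) V = l k \<cdot>\<^bsub>Sig I\<^esub> \<sigma>" by auto
  define \<chi> where "\<chi> = fol_map I \<psi> (Ext_mor I (farr D (i, k)) Z)"
  have \<chi>: "fol_sen I \<chi> (Ext I (fobj D k) V)" "fol_map I \<chi> (Ext_mor I (l k) V) = fol_map I \<phi> (Ext_mor I h X)"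
    unfolding \<chi>_def V_def using fol_map_in[OF Z'(2) ext_mor_hom[OF d(4)[OF ik] Z'(1)]]
      fol_map_ext_comp[OF Z'(2) d(4)[OF ik] d(7)[OF kJ] Z'(1)] d(8)[OF ik] Z(2) by simp_all
  have \<sigma>h: "\<sigma> \<in> hom (Sig I) (Ext I (fobj D k) V) (fobj D k)"
    using \<sigma>(2) substitution_iff[OF d(3)[OF kJ] V(2)] by simp
  have \<theta>h: "\<theta> \<in> hom (Sig I) (Ext I S X) S" using \<theta> substitution_iff[OF S X(1)] by simp
  have \<theta>'h: "\<theta>' \<in> hom (Sig I) (Ext I T ?Y) T" using \<theta>'(1) substitution_iff[OF d(2) Y] by simp
  have eVh: "Ext_mor I (l k) V \<in> hom (Sig I) (Ext I (fobj D k) V) (Ext I T ?Y)"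
    using ext_mor_hom[OF d(7)[OF kJ] V(2)] V(3) by simp
  \<comment> \<open>Instantiating at stage \<open>k\<close> and then moving to \<open>T\<close>
    equals moving to \<open>T\<close> and then instantiating, so the instance formed at stage
    \<open>k\<close> represents the active formula of the premise.\<close>
  have "fol_map I (fol_map I \<chi> \<sigma>) (l k) = fol_map I (fol_map I \<chi> (Ext_mor I (l k) V)) \<theta>'"
    using fol_map_comp[OF \<chi>(1) \<sigma>h d(7)[OF kJ]] fol_map_comp[OF \<chi>(1) eVh \<theta>'h] l\<sigma> by simp
  also have "\<dots> = fol_map I (fol_map I \<phi> \<theta>) h"
    using fol_map_comp[OF X(2) \<theta>h h] fol_map_comp[OF X(2) ext_mor_hom[OF h X(1)] \<theta>'h] \<theta>'(2) \<chi>(2) by simp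
  finally have \<chi>\<sigma>: "fol_map I (fol_map I \<chi> \<sigma>) (l k) = fol_map I (fol_map I \<phi> \<theta>) h" .
  have s: "fol_sen I (fol_map I \<chi> \<sigma>) (fobj D k)" using fol_map_in[OF \<chi>(1) \<sigma>h] .
  have "\<exists>n. (k, n) \<in> r \<and> (\<forall>m. (n, m) \<in> r \<longrightarrow> derives I (fobj D m)
    (fol_image I (farr D (k, m)) {} \<union> G m) (fol_image I (farr D (k, m)) {fol_map I \<chi> \<sigma>} \<union> H m))"
    by (rule stagewise_from[OF IH dc h G H kJ]) (use s \<chi>\<sigma> in \<open>auto simp: image_Un\<close>)
  then obtain m where m: "m \<in> J" "(k, m) \<in> r"
    "derives I (fobj D m) (G m) (insert (fol_map I (fol_map I \<chi> \<sigma>) (farr D (k, m))) (H m))"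
    using DP(2,3) by auto
  let ?V = "Blk_obj I (farr D (k, m)) V" and ?e = "Ext_mor I (farr D (k, m)) V"
  \<comment> \<open>The premise is available only at a later stage \<open>m\<close>, and the rule
    has to be applied there, so the substitution is carried along once more, as \<tau>.\<close>
  from Sub_map_spec[OF d(4)[OF m(2)] V(2) \<sigma>(2)] obtain \<tau> where
    \<tau>: "substitution I (Incl I (fobj D m) ?V) \<tau>" "\<tau> \<cdot>\<^bsub>Sig I\<^esub> ?e = farr D (k, m) \<cdot>\<^bsub>Sig I\<^esub> \<sigma>" by blast
  have \<tau>h: "\<tau> \<in> hom (Sig I) (Ext I (fobj D m) ?V) (fobj D m)"
    using \<tau>(1) substitution_iff[OF d(3)[OF m(1)] Blk_obj_in[OF d(4)[OF m(2)] V(2)]] by simp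
  have "fol_map I (fol_map I \<chi> \<sigma>) (farr D (k, m)) = fol_map I (fol_map I \<chi> ?e) \<tau>"
    using fol_map_comp[OF \<chi>(1) \<sigma>h d(4)[OF m(2)]] fol_map_comp[OF \<chi>(1) ext_mor_hom[OF d(4)[OF m(2)] V(2)] \<tau>h] \<tau>(2) by simp
  with m(3) have "derives I (fobj D m) (G m) (insert (fol_map I (fol_map I \<chi> ?e) \<tau>) (H m))" by simp
  moreover have "Exists ?V (fol_map I \<chi> ?e) \<in> H m"
    using coversD(2)[OF H m(2) coversD(2)[OF H ik i(2)]] unfolding \<gamma> \<chi>_def V_def by simp
  ultimately have "derives I (fobj D m) (G m) (H m)"
    using derives_Ex_right_mem[OF covers_sequent[OF dc G H m(1)] \<tau>(1)] by blast
  then show "\<exists>k\<in>J. derives I (fobj D k) (G k) (H k)" using m(1) by blast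
qed

lemma derives_stagewise: "derives I S \<Gamma> \<Delta> \<Longrightarrow> stagewise ty S \<Gamma> \<Delta>"
proof (induction rule: derives.induct)
  case (Modify S \<Gamma> \<Delta> h S' \<Gamma>' \<Delta>')
  then show ?case using stagewise_Modify[of S \<Gamma> \<Delta> h S' \<Gamma>' \<Delta>'] by simp
next
  case (Init S \<psi> \<Gamma> \<Delta>)
  show ?case by (rule stagewise_Init[of \<psi>]) simp_all
next
  case (Cut S \<Gamma> \<Delta> \<psi> \<Gamma>' \<Delta>')
  have "fol_sen I \<psi> S" using derives_sequent[OF Cut.hyps(1)] by (simp add: fol_sequent_iff)
  then show ?case using stagewise_Cut Cut.IH by blast
next
  case (Atomic \<Gamma>\<^sub>b S \<Delta>\<^sub>b \<Gamma> \<Delta>)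
  then show ?case using stagewise_Atomic by blast
next
  case (Neg_left S \<Gamma> \<Delta> \<phi>)
  then show ?case using stagewise_Neg_left by blast
next
  case (Neg_right S \<phi> \<Gamma> \<Delta>)
  then show ?case using stagewise_Neg_right by blast
next
  case (Disj_left \<phi>s S \<Gamma>s \<Delta>s)
  then show ?case using stagewise_Disj_left by blast
next
  case (Disj_right n \<phi>s S \<Gamma> \<Delta>)
  then show ?case using stagewise_Disj_right nth_mem by blast
next
  case (Ex_left S X \<phi> \<Gamma> \<Delta>)
  then show ?case using stagewise_Ex_left[of S X \<phi> \<Gamma> \<Delta>] by simp
next
  case (Ex_right S X \<theta> \<Gamma> \<Delta> \<phi>)
  then show ?case using stagewise_Ex_right[of S X \<theta> \<Gamma> \<Delta> \<phi>] by simp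
qed

end

theorem theorem4p9:
  fixes I :: "('sig, 'mor, 'm, 'h, 's, 'x, 'y) inst"
  assumes "DINS_b TYPE('j) I"
  shows "compact_sequent TYPE('j) (FOL I) (derives I)"
proof -
  have "delta_institution I" using assms by (simp add: DINS_b_def)
  then interpret dins I "TYPE('j)" using assms by (simp add: dins_def dins_axioms_def)
  interpret S: category "Sig I" by (rule sig_category)
  note FF = FOL_sen_functor[OF delta_institution_axioms]
  show ?thesis
    unfolding compact_sequent_def
  proof (intro allI impI notI, elim conjE)
    fix J :: "'j set" and r D \<Gamma> S \<Delta> l
    assume dir: "directed_poset J r" and col: "is_colimit (poset_cat J r) (modify_cat (FOL I)) D (\<Gamma>, S, \<Delta>) l"
      and nd: "\<forall>i\<in>J. \<forall>\<Gamma>\<^sub>i S\<^sub>i \<Delta>\<^sub>i. fobj D i = (\<Gamma>\<^sub>i, S\<^sub>i, \<Delta>\<^sub>i) \<longrightarrow> \<not> derives I S\<^sub>i \<Gamma>\<^sub>i \<Delta>\<^sub>i"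
      and der: "derives I S \<Gamma> \<Delta>"
    note mc = modify_colimit[OF FF col]
    have dc: "dcolim J r (modify_sig D) S (\<lambda>k. amap (l k))" using dir mc(1) by (simp add: dcolim_def)
    have S: "S \<in> Obj (Sig I)" and sen: "\<And>\<phi>. \<phi> \<in> \<Gamma> \<union> \<Delta> \<Longrightarrow> fol_sen I \<phi> S"
      using derives_sequent[OF der] by (auto simp: fol_sequent_iff)
    \<comment> \<open>The induction statement is used with the identity of \<open>S\<close> as its
      morphism; translation along it has to disappear before the sets of the diagram can cover
      \<Gamma> and \<Delta>.\<close>
    have id: "fol_image I (Id (Sig I) S) \<Gamma> = \<Gamma>" "fol_image I (Id (Sig I) S) \<Delta> = \<Delta>"
      using sen S by (force simp: fol_map_id)+
    have FD: "is_functor (poset_cat J r) (modify_cat (FOL I)) D" using col by (simp add: is_colimit_def)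
    have obj: "fobj D k \<in> Obj (modify_cat (FOL I))" if "k \<in> J" for k using poset_functorD(1)[OF FD that] .
    have arr: "farr D (i, k) \<in> hom (modify_cat (FOL I)) (fobj D i) (fobj D k)" if "(i, k) \<in> r" for i k
      using poset_functorD(2)[OF FD that] .
    let ?G = "\<lambda>k. fst (fobj D k)" and ?H = "\<lambda>k. snd (snd (fobj D k))"
    have G: "covers J r (modify_sig D) (\<lambda>k. amap (l k)) ?G \<Gamma>"
    proof (rule coversI)
      show "fol_sen I \<phi> (fobj (modify_sig D) k)" if "k \<in> J" "\<phi> \<in> ?G k" for k \<phi>
        using obj[OF that(1)] that(2) by (cases "fobj D k") (auto simp: modify_obj modify_sig_def)
      show "fol_map I \<phi> (farr (modify_sig D) (i, k)) \<in> ?G k" if "(i, k) \<in> r" "\<phi> \<in> ?G i" for i k \<phi>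
        using arr[OF that(1)] that(2) by (auto simp: hom_modify_cat amap_def modify_sig_def)
      show "\<exists>k\<in>J. \<exists>\<gamma>\<in>?G k. fol_map I \<gamma> (amap (l k)) = \<phi>" if "\<phi> \<in> \<Gamma>" for \<phi>
        using subsetD[OF mc(2) that] by auto
    qed
    have H: "covers J r (modify_sig D) (\<lambda>k. amap (l k)) ?H \<Delta>"
    proof (rule coversI)
      show "fol_sen I \<phi> (fobj (modify_sig D) k)" if "k \<in> J" "\<phi> \<in> ?H k" for k \<phi>
        using obj[OF that(1)] that(2) by (cases "fobj D k") (auto simp: modify_obj modify_sig_def)
      show "fol_map I \<phi> (farr (modify_sig D) (i, k)) \<in> ?H k" if "(i, k) \<in> r" "\<phi> \<in> ?H i" for i k \<phi>
        using arr[OF that(1)] that(2) by (auto simp: hom_modify_cat amap_def modify_sig_def)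
      show "\<exists>k\<in>J. \<exists>\<gamma>\<in>?H k. fol_map I \<gamma> (amap (l k)) = \<phi>" if "\<phi> \<in> \<Delta>" for \<phi>
        using subsetD[OF mc(3) that] by auto
    qed
    from derives_stagewise[OF der, unfolded stagewise_def, rule_format, OF dc S.id_hom[OF S], unfolded id, OF G H]
    obtain k where "k \<in> J" "derives I (fobj (modify_sig D) k) (?G k) (?H k)" by blast
    then show False using nd[rule_format, of k "?G k" "fobj (modify_sig D) k" "?H k"] by (simp add: modify_sig_def)
  qed
qed

end
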